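(* Let $\mathbf{w} = (w_1,\ldots,w_m) : [0,1] \to \mathbb{R}^m$ be a step function with $w_1,\ldots,w_m$ linearly independent, and let $\Lambda_{\mathbf{w}} : L^1[0,1] \to \mathbb{R}^m$, $\Lambda_{\mathbf{w}}(f) = \int_0^1 f(x)\mathbf{w}(x)\,dx$, be the induced surjective linear operator. Let $y_0 \in \operatorname{int}(\Lambda_{\mathbf{w}}(Q^\infty))$. Then the centroid of $\Lambda_{\mathbf{w}}^{-1}(y_0)\cap Q^\infty$ with respect to the profile-gauge directed filtration $\mathscr{P}$ of $L^1[0,1]$ exists and $$\operatorname{centroid}_{\mathscr{P}}\left(\Lambda_{\mathbf{w}}^{-1}(y_0)\cap Q^\infty\right) = \sigma(\langle \tau_0,\mathbf{w}\rangle),$$ where $\tau_0\in\mathbb{R}^m$ is the unique solution of the saddlepoint equation $$\int_0^1 \sigma(\langle \tau,\mathbf{w}(x)\rangle)\,\mathbf{w}(x)\,dx = y_0 ,$$ and where $\sigma(t) := (\coth(t/2) - 2/t + 1)/2$ (with the removable singularity at $t=0$ filled in, $\sigma(0)=1/2$).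
   Context: All functions are real-valued and identified when equal a.e. A function $\mathbf{w}:[0,1]\to\mathbb{R}^m$ is a step function iff there is a finite partition of $[0,1]$ into subintervals on each of which $\mathbf{w}$ is constant. $Q^\infty := \{f : 0\le f(x)\le 1 \text{ for a.e. } x\in[0,1]\}\subset L^\infty[0,1]\subset L^1[0,1]$. $\langle\cdot,\cdot\rangle$ is the standard inner product on $\mathbb{R}^m$, and $\sigma(\langle \tau,\mathbf{w}\rangle)$ denotes the function $x\mapsto\sigma(\langle\tau,\mathbf{w}(x)\rangle)$. A directed filtration of a Banach space $E$ is a collection of finite-dimensional subspaces of $E$ which is a directed set under inclusion and whose union is dense in $E$. The profile-gauge directed filtration $\mathscr{P}$ of $L^1[0,1]$ is $\{V_n : n\in\mathbb{N}, n\ge 1\}$, where $V_n$ is the $n$-dimensional space of step functions spanned by the indicator functions $\mathbf{1}_{[(j-1)/n,\,j/n]}$, $j=1,\ldots,n$. ($V_n\subseteq V_{n'}$ iff $n$ divides $n'$.) For a bounded set $S$ contained in a finite-dimensional affine space $F$ and having positive Lebesgue measure in $F$ (Lebesgue measure $\mu_F$ transported to $F$ by any affine isomorphism $\mathbb{R}^k\to F$, $k=\dim F$), $\operatorname{centroid}(S) := \frac{1}{\mu_F(S)}\int_S x\,d\mu_F(x)$; this does not depend on the affine isomorphism. For $A=\Lambda_{\mathbf{w}}^{-1}(y_0)\cap Q^\infty$ and $V\in\mathscr{P}$, the set $V\cap A$ lies in the affine space $V\cap\Lambda_{\mathbf{w}}^{-1}(y_0)$, and $\operatorname{centroid}(V\cap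 A)$ is taken in that affine space; one restricts to the cofinal set of those $V\in\mathscr{P}$ for which $V\cap A$ has positive measure there. By definition $\operatorname{centroid}_{\mathscr{P}}(A) := \lim_{V\in\mathscr{P}}\operatorname{centroid}(V\cap A)$, the limit of this net (indexed by $\mathscr{P}$ directed by inclusion) in $L^1[0,1]$, if it exists. *)

theory Defs
  imports "HOL-Analysis.Analysis"
begin

section \<open>The normed space \<open>L\<^sup>1[0,1]\<close>\<close>

abbreviation unit_leb :: "real measure" where
  "unit_leb \<equiv> lebesgue_on {0..1}"

definition L1_rel :: "(real \<Rightarrow> real) \<Rightarrow> (real \<Rightarrow> real) \<Rightarrow> bool" where
  "L1_rel f g \<longleftrightarrow> integrable unit_leb f \<and> integrable unit_leb g \<and> (AE x in unit_leb. f x = g x)"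

lemma part_equivp_L1_rel: "part_equivp L1_rel"
proof (rule part_equivpI)
  show "\<exists>f. L1_rel f f"
    by (rule exI[of _ "\<lambda>_. 0"]) (simp add: L1_rel_def)
  show "symp L1_rel"
    by (rule sympI) (auto simp: L1_rel_def elim: AE_mp)
  show "transp L1_rel"
  proof (rule transpI)
    fix f g h assume "L1_rel f g" "L1_rel g h"
    then show "L1_rel f h"
      by (auto simp: L1_rel_def elim: eventually_elim2)
  qed
qed

text \<open>
  \<open>L1_of f\<close> is the class of an integrable function \<open>f\<close> modulo equality a.e.\ on \<open>[0,1]\<close>;
  \<open>L1_rep\<close> chooses a representative. \<open>L1_of f\<close> is unspecified unless \<open>f\<close> is integrable.
\<close>

quotient_type L1 = "real \<Rightarrow> real" / partial: L1_rel
  morphisms L1_rep L1_of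
  by (rule part_equivp_L1_rel)

lemma L1_rel_rep: "L1_rel (L1_rep F) (L1_rep F)"
  by (rule Quotient3_rep_reflp[OF Quotient3_L1])

lemma integrable_L1_rep [simp, intro]: "integrable unit_leb (L1_rep F)"
  using L1_rel_rep[of F] by (simp add: L1_rel_def)

lemma L1_of_rep [simp]: "L1_of (L1_rep F) = F"
  by (rule Quotient3_abs_rep[OF Quotient3_L1])

lemma L1_rep_of: "integrable unit_leb f \<Longrightarrow> AE x in unit_leb. L1_rep (L1_of f) x = f x"
  using Quotient3_rep_abs[OF Quotient3_L1, of f] by (simp add: L1_rel_def)

lemma L1_of_eq_iff:
  "integrable unit_leb f \<Longrightarrow> integrable unit_leb g \<Longrightarrow>
    L1_of f = L1_of g \<longleftrightarrow> (AE x in unit_leb. f x = g x)"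
  using Quotient3_rel[OF Quotient3_L1, of f g] by (auto simp: L1_rel_def)

lemma L1_cases: obtains f where "integrable unit_leb f" "F = L1_of f"
  by (metis L1_of_rep integrable_L1_rep)

instantiation L1 :: real_normed_vector
begin

lift_definition zero_L1 :: L1 is "\<lambda>_. 0"
  by (simp add: L1_rel_def)

lift_definition plus_L1 :: "L1 \<Rightarrow> L1 \<Rightarrow> L1" is "\<lambda>f g x. f x + g x"
  by (auto simp: L1_rel_def elim: eventually_elim2)

lift_definition minus_L1 :: "L1 \<Rightarrow> L1 \<Rightarrow> L1" is "\<lambda>f g x. f x - g x"
  by (auto simp: L1_rel_def elim: eventually_elim2)

lift_definition uminus_L1 :: "L1 \<Rightarrow> L1" is "\<lambda>f x. - f x"
  by (auto simp: L1_rel_def elim: eventually_mono)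

lift_definition scaleR_L1 :: "real \<Rightarrow> L1 \<Rightarrow> L1" is "\<lambda>c f x. c * f x"
  by (auto simp: L1_rel_def elim: eventually_mono)

lift_definition norm_L1 :: "L1 \<Rightarrow> real" is "\<lambda>f. \<integral>x. \<bar>f x\<bar> \<partial>unit_leb"
  by (auto simp: L1_rel_def intro!: integral_cong_AE elim: eventually_mono)

definition dist_L1 :: "L1 \<Rightarrow> L1 \<Rightarrow> real" where
  "dist_L1 F G = norm (F - G)"

definition sgn_L1 :: "L1 \<Rightarrow> L1" where
  "sgn_L1 F = inverse (norm F) *\<^sub>R F"

definition uniformity_L1 :: "(L1 \<times> L1) filter" where
  "uniformity_L1 = (INF e\<in>{0<..}. principal {(x, y). dist x y < e})"

definition open_L1 :: "L1 set \<Rightarrow> bool" where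
  "open_L1 U \<longleftrightarrow> (\<forall>x\<in>U. eventually (\<lambda>(x', y). x' = x \<longrightarrow> y \<in> U) uniformity)"

instance
proof
  fix F G H :: L1 and a b :: real and U :: "L1 set"
  show "F + G + H = F + (G + H)"
    by transfer (auto simp: L1_rel_def algebra_simps)
  show "F + G = G + F"
    by transfer (auto simp: L1_rel_def algebra_simps)
  show "0 + F = F"
    by transfer (auto simp: L1_rel_def)
  show "- F + F = 0"
    by transfer (auto simp: L1_rel_def)
  show "F - G = F + - G"
    by transfer (auto simp: L1_rel_def)
  show "a *\<^sub>R (F + G) = a *\<^sub>R F + a *\<^sub>R G"
    by transfer (auto simp: L1_rel_def algebra_simps)
  show "(a + b) *\<^sub>R F = a *\<^sub>R F + b *\<^sub>R F"
    by transfer (auto simp: L1_rel_def algebra_simps)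
  show "a *\<^sub>R b *\<^sub>R F = (a * b) *\<^sub>R F"
    by transfer (auto simp: L1_rel_def algebra_simps)
  show "1 *\<^sub>R F = F"
    by transfer (auto simp: L1_rel_def)
  show "dist F G = norm (F - G)"
    by (rule dist_L1_def)
  show "sgn F = inverse (norm F) *\<^sub>R F"
    by (rule sgn_L1_def)
  show "uniformity = (INF e\<in>{0<..}. principal {(x, y :: L1). dist x y < e})"
    by (rule uniformity_L1_def)
  show "open U = (\<forall>x\<in>U. \<forall>\<^sub>F (x', y) in uniformity. x' = x \<longrightarrow> y \<in> U)"
    by (rule open_L1_def)
  show "norm F = 0 \<longleftrightarrow> F = 0"
    by transfer (auto simp: L1_rel_def integral_nonneg_eq_0_iff_AE)
  show "norm (F + G) \<le> norm F + norm G"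
  proof transfer
    fix f g assume "L1_rel f f" "L1_rel g g"
    then have [simp]: "integrable unit_leb f" "integrable unit_leb g"
      by (auto simp: L1_rel_def)
    have "(\<integral>x. \<bar>f x + g x\<bar> \<partial>unit_leb) \<le> (\<integral>x. \<bar>f x\<bar> + \<bar>g x\<bar> \<partial>unit_leb)"
      by (rule integral_mono) auto
    then show "(\<integral>x. \<bar>f x + g x\<bar> \<partial>unit_leb)
        \<le> (\<integral>x. \<bar>f x\<bar> \<partial>unit_leb) + (\<integral>x. \<bar>g x\<bar> \<partial>unit_leb)"
      by simp
  qed
  show "norm (a *\<^sub>R F) = \<bar>a\<bar> * norm F"
    by transfer (simp add: abs_mult)
qed

end

lemma L1_of_zero: "L1_of (\<lambda>_. 0) = 0"
  by (simp add: zero_L1_def)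

lemma L1_of_add:
  "integrable unit_leb f \<Longrightarrow> integrable unit_leb g \<Longrightarrow> L1_of (\<lambda>x. f x + g x) = L1_of f + L1_of g"
  by (rule plus_L1.abs_eq[symmetric]) (auto simp: L1_rel_def)

lemma L1_of_diff:
  "integrable unit_leb f \<Longrightarrow> integrable unit_leb g \<Longrightarrow> L1_of (\<lambda>x. f x - g x) = L1_of f - L1_of g"
  by (rule minus_L1.abs_eq[symmetric]) (auto simp: L1_rel_def)

lemma L1_of_scaleR: "integrable unit_leb f \<Longrightarrow> L1_of (\<lambda>x. c * f x) = c *\<^sub>R L1_of f"
  by (rule scaleR_L1.abs_eq[symmetric]) (auto simp: L1_rel_def)

lemma norm_L1_of: "integrable unit_leb f \<Longrightarrow> norm (L1_of f) = (\<integral>x. \<bar>f x\<bar> \<partial>unit_leb)"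
  by (rule norm_L1.abs_eq) (auto simp: L1_rel_def)


section \<open>Directed filtrations and the profile-gauge filtration\<close>

text \<open>The second condition is ``finite-dimensional'', the third ``directed under inclusion''.\<close>

definition directed_filtration :: "'a::real_normed_vector set set \<Rightarrow> bool" where
  "directed_filtration P \<longleftrightarrow>
     P \<noteq> {} \<and>
     (\<forall>V\<in>P. \<exists>B. finite B \<and> V = span B) \<and>
     (\<forall>V\<in>P. \<forall>W\<in>P. \<exists>U\<in>P. V \<subseteq> U \<and> W \<subseteq> U) \<and>
     closure (\<Union>P) = UNIV"

definition profile_space :: "nat \<Rightarrow> L1 set" where
  "profile_space n =
     span ((\<lambda>j. L1_of (indicator {(real j - 1) / real n .. real j / real n})) ` {1..n})"

definition profile_filtration :: "L1 set set" where
  "profile_filtration = profile_space ` {1..}"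

lemma finite_measure_unit_leb: "finite_measure unit_leb"
  by (rule finite_measure_lebesgue_on) auto

lemma integrable_unit_indicator [simp]:
  assumes "A \<in> sets lebesgue"
  shows "integrable unit_leb (indicator A :: real \<Rightarrow> real)"
proof (rule finite_measure.integrable_const_bound[OF finite_measure_unit_leb, where B = 1])
  show "indicat_real A \<in> borel_measurable unit_leb"
    using assms by (intro measurable_restrict_space1 borel_measurable_indicator) auto
qed (auto simp: indicator_def)

lemma integral_unit_indicator:
  assumes "A \<in> sets lebesgue"
  shows "(\<integral>x. indicator A x \<partial>unit_leb) = measure lebesgue (A \<inter> {0..1})"
proof -
  have "(\<integral>x. indicator A x \<partial>unit_leb) = measure unit_leb (A \<inter> space unit_leb)"
    by (rule Bochner_Integration.integral_indicator)
  then show ?thesis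
    using assms by (simp add: measure_restrict_space)
qed

lemma AE_unit_lebI: "finite N \<Longrightarrow> (\<And>x. x \<in> {0..1} \<Longrightarrow> x \<notin> N \<Longrightarrow> P x) \<Longrightarrow> AE x in unit_leb. P x"
  by (subst AE_restrict_space_iff, simp)
     (rule AE_I'[of N], auto simp: negligible_iff_null_sets[symmetric] negligible_finite)

lemma profile_space_prefix:
  assumes "n \<ge> 1" "k \<le> n"
  shows "L1_of (indicator {0..real k / real n}) \<in> profile_space n"
  using assms(2)
proof (induction k)
  case 0
  have "L1_of (indicator {0..0::real}) = L1_of (\<lambda>_. 0)"
    by (subst L1_of_eq_iff) (auto intro!: AE_unit_lebI[of "{0}"] simp: indicator_def)
  then show ?case
    by (simp add: L1_of_zero profile_space_def span_zero)
next
  case (Suc k)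
  let ?I = "{(real (Suc k) - 1) / real n .. real (Suc k) / real n}"
  have "L1_of (indicator {0..real (Suc k) / real n}) =
        L1_of (\<lambda>x. indicator {0..real k / real n} x + indicator ?I x)"
  proof (subst L1_of_eq_iff)
    show "AE x in unit_leb. indicat_real {0..real (Suc k) / real n} x =
        indicator {0..real k / real n} x + indicator ?I x"
    proof (rule AE_unit_lebI[of "{real k / real n}"])
      fix x :: real assume x: "x \<in> {0..1}" "x \<notin> {real k / real n}"
      have "real k / real n \<le> real (Suc k) / real n"
        by (simp add: divide_right_mono)
      then show "indicat_real {0..real (Suc k) / real n} x =
          indicator {0..real k / real n} x + indicator ?I x"
        using x by (auto simp: indicator_def)
    qed simp
  qed auto
  also have "\<dots> = L1_of (indicator {0..real k / real n}) + L1_of (indicator ?I)"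
    by (rule L1_of_add) auto
  also have "\<dots> \<in> profile_space n"
  proof -
    have "L1_of (indicator ?I) \<in> profile_space n"
      unfolding profile_space_def
      by (rule span_base, rule image_eqI[of _ _ "Suc k"]) (use Suc in auto)
    then show ?thesis
      using Suc unfolding profile_space_def by (intro span_add) auto
  qed
  finally show ?case .
qed

lemma profile_space_dvd:
  assumes "n \<ge> 1" "m \<ge> 1"
  shows "profile_space n \<subseteq> profile_space (n * m)"
proof -
  have "L1_of (indicator {(real j - 1) / real n .. real j / real n}) \<in> profile_space (n * m)"
    if j: "j \<in> {1..n}" for j
  proof -
    have eq: "real (i * m) / real (n * m) = real i / real n" for i
      using assms by simp
    have pre: "L1_of (indicator {0..real i / real n}) \<in> profile_space (n * m)" if "i \<le> n" for i
      using profile_space_prefix[of "n * m" "i * m"] assms that by (simp add: eq)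
    have le: "real (j - 1) / real n \<le> real j / real n"
      by (simp add: divide_right_mono)
    have "L1_of (indicator {(real j - 1) / real n .. real j / real n}) =
        L1_of (\<lambda>x. indicator {0..real j / real n} x - indicator {0..real (j - 1) / real n} x)"
    proof (subst L1_of_eq_iff)
      show "AE x in unit_leb. indicat_real {(real j - 1) / real n .. real j / real n} x =
          indicator {0..real j / real n} x - indicator {0..real (j - 1) / real n} x"
        by (rule AE_unit_lebI[of "{real (j - 1) / real n}"])
           (use le j in \<open>auto simp: indicator_def of_nat_diff\<close>)
    qed auto
    also have "\<dots> = L1_of (indicator {0..real j / real n}) -
        L1_of (indicator {0..real (j - 1) / real n})"
      by (rule L1_of_diff) auto
    also have "\<dots> \<in> profile_space (n * m)"
      using pre[of j] pre[of "j - 1"] j unfolding profile_space_def by (intro span_diff) auto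
    finally show ?thesis .
  qed
  then show ?thesis
    unfolding profile_space_def[of n]
    by (intro span_minimal) (auto simp: profile_space_def)
qed

lemma profile_filtration_directed:
  assumes "V \<in> profile_filtration" "W \<in> profile_filtration"
  shows "\<exists>U\<in>profile_filtration. V \<subseteq> U \<and> W \<subseteq> U"
proof -
  obtain n m where *: "n \<ge> 1" "V = profile_space n" "m \<ge> 1" "W = profile_space m"
    using assms by (auto simp: profile_filtration_def)
  then show ?thesis
    using profile_space_dvd[of n m] profile_space_dvd[of m n]
    by (auto simp: profile_filtration_def mult.commute intro!: bexI[of _ "n * m"])
qed

lemma subspace_Union_profile: "subspace (\<Union>profile_filtration)"
proof (rule subspaceI)
  show "0 \<in> \<Union>profile_filtration"
    by (auto simp: profile_filtration_def profile_space_def span_zero intro!: bexI[of _ 1])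
next
  fix F G assume "F \<in> \<Union>profile_filtration" "G \<in> \<Union>profile_filtration"
  then obtain U where "U \<in> profile_filtration" "F \<in> U" "G \<in> U"
    using profile_filtration_directed by blast
  then show "F + G \<in> \<Union>profile_filtration"
    by (auto simp: profile_filtration_def profile_space_def intro!: bexI span_add)
next
  fix c F assume "F \<in> \<Union>profile_filtration"
  then show "c *\<^sub>R F \<in> \<Union>profile_filtration"
    by (auto simp: profile_filtration_def profile_space_def intro!: bexI span_scale)
qed

lemma subspace_closure_normed:
  fixes S :: "'a::real_normed_vector set"
  assumes "subspace S"
  shows "subspace (closure S)"
proof (rule subspaceI)
  show "0 \<in> closure S"
    using assms closure_subset subspace_0 by blast
next
  fix x y assume "x \<in> closure S" "y \<in> closure S"
  then obtain f g where "\<And>n. f n \<in> S" "f \<longlonglongrightarrow> x" "\<And>n. g n \<in> S" "g \<longlonglongrightarrow> y"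
    unfolding closure_sequential by blast
  then show "x + y \<in> closure S"
    using assms unfolding closure_sequential
    by (intro exI[of _ "\<lambda>n. f n + g n"]) (auto intro: tendsto_add subspace_add)
next
  fix c and x assume "x \<in> closure S"
  then obtain f where "\<And>n. f n \<in> S" "f \<longlonglongrightarrow> x"
    unfolding closure_sequential by blast
  then show "c *\<^sub>R x \<in> closure S"
    using assms unfolding closure_sequential
    by (intro exI[of _ "\<lambda>n. c *\<^sub>R f n"]) (auto intro: tendsto_scaleR subspace_scale)
qed

lemma profile_closure_prefix:
  "L1_of (indicator {..a}) \<in> closure (\<Union>profile_filtration)"
proof -
  define b where "b = max 0 (min 1 a)"
  have b: "0 \<le> b" "b \<le> 1" by (auto simp: b_def)
  have eq: "L1_of (indicator {..a}) = L1_of (indicator {0..b})"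
    by (subst L1_of_eq_iff)
       (auto intro!: AE_unit_lebI[of "{0}"] simp: indicator_def b_def max_def min_def)
  show ?thesis
    unfolding eq closure_approachable
  proof (intro allI impI)
    fix e :: real assume "e > 0"
    then obtain n :: nat where n: "n \<ge> 1" "1 / real n < e"
      by (metis One_nat_def Suc_leI nat_approx_posE zero_less_Suc)
    define k where "k = nat \<lfloor>b * real n\<rfloor>"
    have k: "real k \<le> b * real n" "b * real n < real k + 1"
      using b by (auto simp: k_def)
    have "real k \<le> real n"
      using k(1) b mult_right_mono[of b 1 "real n"] by simp
    then have kn: "k \<le> n" by simp
    define c where "c = real k / real n"
    have c: "0 \<le> c" "c \<le> b" "b - c < e"
    proof -
      show "0 \<le> c" by (simp add: c_def)
      show "c \<le> b" using k n by (simp add: c_def field_simps)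
      have "b < (real k + 1) / real n" using k n by (simp add: pos_less_divide_eq)
      then have "b - c \<le> 1 / real n" by (simp add: c_def add_divide_distrib)
      then show "b - c < e" using n by simp
    qed
    have "dist (L1_of (indicator {0..c})) (L1_of (indicator {0..b})) =
        norm (L1_of (\<lambda>x. indicator {0..c} x - indicator {0..b} x))"
      unfolding dist_norm by (subst L1_of_diff) auto
    also have "\<dots> = (\<integral>x. \<bar>indicator {0..c} x - indicator {0..b} x\<bar> \<partial>unit_leb)"
      by (subst norm_L1_of) auto
    also have "\<dots> = (\<integral>x. indicator {c<..b} x \<partial>unit_leb)"
      using c by (intro Bochner_Integration.integral_cong) (auto simp: indicator_def)
    also have "\<dots> = measure lebesgue ({c<..b} \<inter> {0..1})"
      by (rule integral_unit_indicator) auto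
    also have "{c<..b} \<inter> {0..1} = {c<..b}"
      using b c by auto
    also have "measure lebesgue {c<..b} = b - c"
      using c by simp
    finally have "dist (L1_of (indicator {0..c})) (L1_of (indicator {0..b})) < e"
      using c by simp
    moreover have "L1_of (indicator {0..c}) \<in> \<Union>profile_filtration"
      using profile_space_prefix[OF n(1) kn] n(1) by (auto simp: c_def profile_filtration_def)
    ultimately show "\<exists>y\<in>\<Union>profile_filtration. dist y (L1_of (indicator {0..b})) < e"
      by blast
  qed
qed

lemma profile_closure_borel:
  assumes "A \<in> sets borel"
  shows "L1_of (indicator A) \<in> closure (\<Union>profile_filtration)" (is "_ \<in> ?C")
proof -
  have C: "subspace ?C"
    by (rule subspace_closure_normed[OF subspace_Union_profile])
  have leb: "X \<in> sets lebesgue" if "X \<in> sets borel" for X :: "real set"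
    using that by simp
  have A: "A \<in> sigma_sets UNIV (range (\<lambda>a::real. {..a}))"
    using assms unfolding borel_eq_atMost by simp
  have borel: "X \<in> sets borel" if "X \<in> sigma_sets UNIV (range (\<lambda>a::real. {..a}))" for X
    using that unfolding borel_eq_atMost by simp
  show ?thesis
  proof (rule sigma_sets_induct_disjoint[OF _ _ A])
    show "Int_stable (range (\<lambda>a::real. {..a}))"
      by (auto simp: Int_stable_def intro!: image_eqI[of _ _ "min _ _"])
    show "L1_of (indicator X) \<in> ?C" if "X \<in> range (\<lambda>a::real. {..a})" for X
      using that profile_closure_prefix by auto
    have "indicat_real {} = (\<lambda>_ :: real. 0)"
      by (simp add: fun_eq_iff)
    then show "L1_of (indicator {}) \<in> ?C"
      using subspace_0[OF C] L1_of_zero by simp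
  next
    fix X :: "real set"
    assume X: "X \<in> sigma_sets UNIV (range (\<lambda>a. {..a}))" "L1_of (indicator X) \<in> ?C"
    have "L1_of (indicator (UNIV - X)) = L1_of (\<lambda>x. indicator {..1} x - indicator X x)"
    proof (subst L1_of_eq_iff)
      show "AE x in unit_leb. indicat_real (UNIV - X) x = indicator {..1} x - indicator X x"
        by (rule AE_unit_lebI[of "{}"]) (auto simp: indicator_def)
    qed (use borel[OF X(1)] in auto)
    also have "\<dots> = L1_of (indicator {..1}) - L1_of (indicator X)"
      using borel[OF X(1)] by (intro L1_of_diff) auto
    also have "\<dots> \<in> ?C"
      using X(2) profile_closure_prefix by (intro subspace_diff[OF C])
    finally show "L1_of (indicator (UNIV - X)) \<in> ?C" .
  next
    fix X :: "nat \<Rightarrow> real set"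
    assume X: "disjoint_family X" "range X \<subseteq> sigma_sets UNIV (range (\<lambda>a. {..a}))"
      "\<And>i. L1_of (indicator (X i)) \<in> ?C"
    have bX: "X i \<in> sets borel" for i
      using X(2) borel by auto
    have bY: "(\<Union>i<n. X i) \<in> sets borel" for n using bX by auto
    have bU: "(\<Union>i. X i) \<in> sets borel" using bX by auto
    have part: "L1_of (indicator (\<Union>i<n. X i)) \<in> ?C" for n
    proof (induction n)
      case 0
      then show ?case using subspace_0[OF C] by (simp add: L1_of_zero)
    next
      case (Suc n)
      have "X n \<inter> X i = {}" if "i < n" for i
        using disjoint_family_onD[OF X(1), of n i] that by simp
      then have disj: "X n \<inter> (\<Union>i<n. X i) = {}"
        by blast
      have "(\<Union>i<Suc n. X i) = X n \<union> (\<Union>i<n. X i)"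
        by (simp add: lessThan_Suc)
      then have "indicat_real (\<Union>i<Suc n. X i) = (\<lambda>x. indicator (\<Union>i<n. X i) x + indicator (X n) x)"
        using disj by (auto simp: fun_eq_iff split: split_indicator)
      then have "L1_of (indicator (\<Union>i<Suc n. X i)) =
          L1_of (\<lambda>x. indicator (\<Union>i<n. X i) x + indicator (X n) x)"
        by (rule arg_cong)
      also have "\<dots> = L1_of (indicator (\<Union>i<n. X i)) + L1_of (indicator (X n))"
        using bX bY by (intro L1_of_add integrable_unit_indicator leb)
      also have "\<dots> \<in> ?C"
        by (rule subspace_add[OF C Suc X(3)])
      finally show ?case .
    qed
    have "(\<lambda>n. \<integral>x. \<bar>indicator (\<Union>i<n. X i) x - indicator (\<Union>i. X i) x\<bar> \<partial>unit_leb)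
        \<longlonglongrightarrow> (\<integral>x. (0::real) \<partial>unit_leb)"
    proof (rule integral_dominated_convergence[where w = "\<lambda>_. 1"])
      show "AE x in unit_leb. (\<lambda>n. \<bar>indicat_real (\<Union>i<n. X i) x - indicator (\<Union>i. X i) x\<bar>) \<longlonglongrightarrow> 0"
      proof (rule AE_I2)
        fix x
        have "(\<lambda>n. indicat_real (\<Union>i<n. X i) x) \<longlonglongrightarrow> indicator (\<Union>i. X i) x"
          by (rule LIMSEQ_indicator_UN)
        then show "(\<lambda>n. \<bar>indicat_real (\<Union>i<n. X i) x - indicator (\<Union>i. X i) x\<bar>) \<longlonglongrightarrow> 0"
          by (intro tendsto_rabs_zero LIM_zero)
      qed
      have int: "integrable unit_leb (\<lambda>x. \<bar>indicat_real (\<Union>i<n. X i) x - indicator (\<Union>i. X i) x\<bar>)" for n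
        using bY bU
        by (intro integrable_abs Bochner_Integration.integrable_diff integrable_unit_indicator leb)
      then show "(\<lambda>x. \<bar>indicat_real (\<Union>i<n. X i) x - indicator (\<Union>i. X i) x\<bar>) \<in> borel_measurable unit_leb" for n
        by (rule borel_measurable_integrable)
      show "integrable unit_leb (\<lambda>_. 1 :: real)"
        by (rule finite_measure.integrable_const[OF finite_measure_unit_leb])
      show "AE x in unit_leb. norm \<bar>indicat_real (\<Union>i<n. X i) x - indicator (\<Union>i. X i) x\<bar> \<le> 1" for n
        by (rule AE_I2) (simp add: indicator_def)
    qed simp
    then have "(\<lambda>n. norm (L1_of (indicator (\<Union>i<n. X i)) - L1_of (indicator (\<Union>i. X i)))) \<longlonglongrightarrow> 0"
      using bY bU by (simp add: L1_of_diff[symmetric] norm_L1_of)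
    then have "(\<lambda>n. L1_of (indicator (\<Union>i<n. X i))) \<longlonglongrightarrow> L1_of (indicator (\<Union>i. X i))"
      by (simp add: tendsto_norm_zero_iff LIM_zero_iff)
    then show "L1_of (indicator (\<Union>i. X i)) \<in> ?C"
      by (rule closed_sequentially[OF closed_closure part])
  qed auto
qed


lemma profile_dense: "closure (\<Union>profile_filtration) = UNIV" (is "?C = _")
proof -
  have C: "subspace ?C"
    by (rule subspace_closure_normed[OF subspace_Union_profile])
  have ind: "L1_of (indicator A) \<in> ?C" if A: "A \<in> sets unit_leb" for A
  proof -
    have "A \<in> sets lebesgue"
      using A by (auto simp: sets_restrict_space)
    then have "indicat_real A \<in> borel_measurable (completion lborel)"
      by simp
    then obtain g where g: "g \<in> borel_measurable lborel" "AE x in lborel. indicat_real A x = g x"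
      using completion_ex_borel_measurable_real by blast
    define B where "B = g -` {1}"
    have B: "B \<in> sets borel"
      using measurable_sets[OF g(1), of "{1}"] by (simp add: B_def)
    have "AE x in lebesgue. indicat_real A x = g x"
      using g(2) by (rule AE_completion)
    then have "AE x in unit_leb. indicat_real A x = indicator B x"
      by (subst AE_restrict_space_iff) (auto elim!: eventually_mono simp: B_def indicator_def)
    then have "L1_of (indicator A) = L1_of (indicator B)"
      using \<open>A \<in> sets lebesgue\<close> B by (subst L1_of_eq_iff) auto
    then show ?thesis
      using profile_closure_borel[OF B] by simp
  qed
  have "L1_of f \<in> ?C" if "integrable unit_leb f" for f
    using that
  proof (induct f rule: integrable_induct)
    case (base A c)
    then have "integrable unit_leb (indicator A :: real \<Rightarrow> real)"
      by (auto simp: sets_restrict_space)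
    then have "L1_of (\<lambda>x. indicator A x *\<^sub>R c) = c *\<^sub>R L1_of (indicator A)"
      using L1_of_scaleR[of "indicator A" c] by (simp add: mult.commute)
    then show ?case
      using ind[OF base(1)] subspace_scale[OF C] by simp
  next
    case (add f g)
    then show ?case
      using subspace_add[OF C] by (simp add: L1_of_add)
  next
    case (lim f s)
    have "(\<lambda>n. \<integral>x. \<bar>s n x - f x\<bar> \<partial>unit_leb) \<longlonglongrightarrow> (\<integral>x. (0::real) \<partial>unit_leb)"
    proof (rule integral_dominated_convergence[where w = "\<lambda>x. 3 * \<bar>f x\<bar>"])
      show "AE x in unit_leb. (\<lambda>n. \<bar>s n x - f x\<bar>) \<longlonglongrightarrow> 0"
        using lim(3) by (intro AE_I2 tendsto_rabs_zero LIM_zero)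
      show "AE x in unit_leb. norm \<bar>s n x - f x\<bar> \<le> 3 * \<bar>f x\<bar>" for n
      proof (rule AE_I2)
        fix x assume "x \<in> space unit_leb"
        from lim(4)[OF this, of n] show "norm \<bar>s n x - f x\<bar> \<le> 3 * \<bar>f x\<bar>" by simp
      qed
    qed (use lim in \<open>auto intro!: borel_measurable_integrable integrable_abs Bochner_Integration.integrable_diff\<close>)
    then have "(\<lambda>n. norm (L1_of (s n) - L1_of f)) \<longlonglongrightarrow> 0"
      using lim by (simp add: L1_of_diff[symmetric] norm_L1_of)
    then have "(\<lambda>n. L1_of (s n)) \<longlonglongrightarrow> L1_of f"
      by (simp add: tendsto_norm_zero_iff LIM_zero_iff)
    then show ?case
      by (rule closed_sequentially[OF closed_closure lim(2)])
  qed
  then show ?thesis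
    by (metis L1_cases UNIV_eq_I)
qed

lemma directed_filtration_profile: "directed_filtration profile_filtration"
  unfolding directed_filtration_def
proof (intro conjI)
  show "profile_filtration \<noteq> {}"
    by (auto simp: profile_filtration_def)
  show "\<forall>V\<in>profile_filtration. \<exists>B. finite B \<and> V = span B"
    unfolding profile_filtration_def profile_space_def by blast
  show "\<forall>V\<in>profile_filtration. \<forall>W\<in>profile_filtration. \<exists>U\<in>profile_filtration. V \<subseteq> U \<and> W \<subseteq> U"
    by (intro ballI profile_filtration_directed)
qed (rule profile_dense)

lemma separable_closure_span:
  fixes D :: "'a::real_normed_vector set"
  assumes "countable D"
  obtains R where "countable R" "span D \<subseteq> closure R"
proof
  define R where "R = (\<lambda>xs. \<Sum>(q, d)\<leftarrow>xs. q *\<^sub>R d) ` lists (\<rat> \<times> D)"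
  show "countable R"
    unfolding R_def using assms by (intro countable_image countable_lists countable_SIGMA countable_rat)
  have add: "x + y \<in> R" if "x \<in> R" "y \<in> R" for x y
  proof -
    from that obtain xs ys where "xs \<in> lists (\<rat> \<times> D)" "ys \<in> lists (\<rat> \<times> D)"
      "x = (\<Sum>(q, d)\<leftarrow>xs. q *\<^sub>R d)" "y = (\<Sum>(q, d)\<leftarrow>ys. q *\<^sub>R d)"
      by (auto simp: R_def)
    then show ?thesis
      unfolding R_def by (intro image_eqI[of _ _ "xs @ ys"]) auto
  qed
  have scale: "q *\<^sub>R d \<in> R" if "q \<in> \<rat>" "d \<in> D" for q d
    unfolding R_def using that by (intro image_eqI[of _ _ "[(q, d)]"]) auto
  have zero: "0 \<in> R"
    unfolding R_def by (intro image_eqI[of _ _ "[]"]) auto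
  have cadd: "x + y \<in> closure R" if "x \<in> closure R" "y \<in> closure R" for x y
  proof -
    from that obtain f g where "\<And>n. f n \<in> R" "f \<longlonglongrightarrow> x" "\<And>n. g n \<in> R" "g \<longlonglongrightarrow> y"
      unfolding closure_sequential by blast
    then show ?thesis
      unfolding closure_sequential using add
      by (intro exI[of _ "\<lambda>n. f n + g n"]) (auto intro: tendsto_add)
  qed
  have cscale: "c *\<^sub>R d \<in> closure R" if "d \<in> D" for c d
  proof -
    have "c \<in> closure \<rat>"
      unfolding closure_approachable
    proof (intro allI impI)
      fix e :: real assume "e > 0"
      then obtain r where "r \<in> \<rat>" "c < r" "r < c + e"
        using Rats_dense_in_real[of c "c + e"] by auto
      then show "\<exists>y\<in>\<rat>. dist y c < e"
        by (intro bexI[of _ r]) (auto simp: dist_real_def)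
    qed
    then obtain q where "\<And>n. q n \<in> \<rat>" "q \<longlonglongrightarrow> c"
      unfolding closure_sequential by blast
    then show ?thesis
      unfolding closure_sequential using scale that
      by (intro exI[of _ "\<lambda>n. q n *\<^sub>R d"]) (auto intro: tendsto_scaleR)
  qed
  show "span D \<subseteq> closure R"
  proof
    fix x assume "x \<in> span D"
    then show "x \<in> closure R"
    proof (induction rule: span_induct_alt)
      case base
      then show ?case using zero closure_subset by blast
    next
      case (step c x y)
      then show ?case using cadd cscale by blast
    qed
  qed
qed

instance L1 :: second_countable_topology
proof
  define D where "D = (\<lambda>(n, j). L1_of (indicator {(real j - 1) / real n .. real j / real n})) ` (UNIV :: (nat \<times> nat) set)"
  obtain R where R: "countable R" "span D \<subseteq> closure R"
    using separable_closure_span[of D] by (auto simp: D_def)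
  have "\<Union>profile_filtration \<subseteq> span D"
  proof (rule Union_least)
    fix V assume "V \<in> profile_filtration"
    then obtain n where "V = profile_space n"
      by (auto simp: profile_filtration_def)
    moreover have "profile_space n \<subseteq> span D"
      unfolding profile_space_def by (intro span_mono) (auto simp: D_def)
    ultimately show "V \<subseteq> span D" by simp
  qed
  then have dense: "closure R = UNIV"
    using R(2) profile_dense closure_minimal[of "\<Union>profile_filtration" "closure R"] by auto
  define B where "B = (\<lambda>(x, n). ball x (1 / real (Suc n))) ` (R \<times> UNIV)"
  have "topological_basis B"
  proof (rule topological_basisI)
    show "open U" if "U \<in> B" for U
      using that by (auto simp: B_def)
    fix U and x :: L1 assume "open U" "x \<in> U"
    then obtain e where e: "e > 0" "ball x e \<subseteq> U"
      using open_contains_ball by blast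
    then obtain n where n: "1 / real (Suc n) < e / 2"
      by (metis half_gt_zero nat_approx_posE)
    obtain y where y: "y \<in> R" "dist y x < 1 / real (Suc n)"
      using dense closure_approachable[of x R] by (metis UNIV_I of_nat_0_less_iff zero_less_Suc zero_less_divide_1_iff)
    have "ball y (1 / real (Suc n)) \<subseteq> ball x e"
    proof
      fix z assume "z \<in> ball y (1 / real (Suc n))"
      then show "z \<in> ball x e"
        using y(2) n dist_triangle[of x z y] by (simp add: dist_commute)
    qed
    then show "\<exists>B'\<in>B. x \<in> B' \<and> B' \<subseteq> U"
      using y e by (intro bexI[of _ "ball y (1 / real (Suc n))"]) (auto simp: B_def)
  qed
  then have "open = generate_topology B"
    by (rule topological_basis_imp_subbasis)
  moreover have "countable B"
    using R(1) by (auto simp: B_def)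
  ultimately show "\<exists>B::L1 set set. countable B \<and> open = generate_topology B"
    by blast
qed


section \<open>Centroids\<close>

definition affine_frame :: "'a::real_vector set \<Rightarrow> nat \<Rightarrow> 'a \<Rightarrow> (nat \<Rightarrow> 'a) \<Rightarrow> bool" where
  "affine_frame F k p b \<longleftrightarrow>
     inj_on b {..<k} \<and> independent (b ` {..<k}) \<and> F = (\<lambda>v. p + v) ` span (b ` {..<k})"

definition affine_chart :: "nat \<Rightarrow> 'a::real_vector \<Rightarrow> (nat \<Rightarrow> 'a) \<Rightarrow> (nat \<Rightarrow> real) \<Rightarrow> 'a" where
  "affine_chart k p b t = p + (\<Sum>i<k. t i *\<^sub>R b i)"

text \<open>
  Lebesgue measure on \<open>\<real>\<^sup>k\<close>, realized as the product measure on \<open>{..<k} \<rightarrow>\<^sub>E \<real>\<close> because \<open>k\<close> varies,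
  transported to \<open>F\<close> by an affine isomorphism. Different isomorphisms give proportional measures,
  so neither positivity of a measure nor a centroid depends on the choice. The measure is
  declared on the Borel sets of the ambient space and is concentrated on \<open>F\<close>; it is unspecified if
  \<open>F\<close> is not a nonempty finite-dimensional affine subspace.
\<close>

definition affine_lebesgue :: "'a::real_normed_vector set \<Rightarrow> 'a measure" where
  "affine_lebesgue F = (SOME \<mu>. \<exists>k p b. affine_frame F k p b \<and>
     \<mu> = distr (Pi\<^sub>M {..<k} (\<lambda>_. lborel)) borel (affine_chart k p b))"

definition centroid ::
  "'a::{real_normed_vector, second_countable_topology} set \<Rightarrow> 'a set \<Rightarrow> 'a" where
  "centroid F S =
     (1 / measure (affine_lebesgue F) S) *\<^sub>R (\<integral>x\<in>S. x \<partial>affine_lebesgue F)"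

text \<open>The filter of a net indexed by \<open>I\<close>, directed by inclusion.\<close>

definition directed_filter :: "'a set set \<Rightarrow> 'a set filter" where
  "directed_filter I = (INF V\<in>I. principal {W \<in> I. V \<subseteq> W})"

text \<open>
  For \<open>A\<close> contained in the affine space \<open>F\<close>: the centroid of \<open>A\<close> with respect to \<open>P\<close> exists
  and equals \<open>c\<close>. The indices with positive measure are required to be cofinal in \<open>P\<close>, so
  that the limit is that of a genuine net.
\<close>

definition has_filtration_centroid ::
  "'a::{real_normed_vector, second_countable_topology} set set \<Rightarrow> 'a set \<Rightarrow> 'a set \<Rightarrow> 'a \<Rightarrow> bool"
  where
  "has_filtration_centroid P F A c \<longleftrightarrow>
     directed_filtration P \<and>
     (let I = {V \<in> P. measure (affine_lebesgue (V \<inter> F)) (V \<inter> A) > 0}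
      in (\<forall>V\<in>P. \<exists>W\<in>I. V \<subseteq> W) \<and>
         ((\<lambda>V. centroid (V \<inter> F) (V \<inter> A)) \<longlongrightarrow> c) (directed_filter I))"


section \<open>The moment operator\<close>

definition step_function :: "(real \<Rightarrow> 'b) \<Rightarrow> bool" where
  "step_function w \<longleftrightarrow>
     (\<exists>\<I>. finite \<I> \<and> partition_on {0..1} \<I> \<and> (\<forall>J\<in>\<I>. is_interval J \<and> w constant_on J))"

definition Q_infty :: "L1 set" where
  "Q_infty = {F. AE x in unit_leb. 0 \<le> L1_rep F x \<and> L1_rep F x \<le> 1}"

definition Lambda :: "(real \<Rightarrow> real ^ 'm) \<Rightarrow> L1 \<Rightarrow> real ^ 'm" where
  "Lambda w F = (\<integral>x. L1_rep F x *\<^sub>R w x \<partial>unit_leb)"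

text \<open>\<open>cosh (t / 2) / sinh (t / 2)\<close> is \<open>coth (t / 2)\<close>.\<close>

definition sigma_fn :: "real \<Rightarrow> real" where
  "sigma_fn t = (if t = 0 then 1 / 2 else (cosh (t / 2) / sinh (t / 2) - 2 / t + 1) / 2)"

end

theory Submission
  imports Defs "HOL-Probability.Probability" "HOL-Real_Asymp.Real_Asymp"
begin

text \<open>
  On \<open>V\<^sub>n\<close> the fibre over \<open>y0\<close> is a slice of the cube \<open>[0,1]\<^sup>n\<close> by \<open>m\<close> linear equations. Weighting the cube
  by \<open>exp (\<Sum>\<^sub>j s\<^sub>j t\<^sub>j)\<close> with \<open>s\<^sub>j = \<langle>\<tau>, w\<^sub>j\<rangle>\<close> does not change the uniform measure on the slice, because the
  exponent is constant there. Under this product weight the coordinates are independent with mean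
  \<open>\<sigma>(s\<^sub>j)\<close>, and if \<open>\<tau>\<close> solves the saddlepoint equation then the slice passes within bounded distance of the
  mean. Sub-Gaussian estimates bound the deviation of the conditional means from \<open>\<sigma>(s\<^sub>j)\<close> by
  minus the logarithm of the mass of the slice. That mass is at least \<open>exp (- O(\<surd>n log n))\<close>: the
  fluctuations of order \<open>\<surd>n\<close> of most coordinates can be compensated by \<open>O(\<surd>n)\<close> others. So the deviation of
  the means is \<open>o(n)\<close> in total, which is \<open>L\<^sup>1\<close>-convergence. The solution \<open>\<tau>\<close> is the minimum point of a
  strictly convex coercive potential.
\<close>

section \<open>Exponential tilts of the uniform distribution\<close>

text \<open>The scale of the claim is what makes a crude mass bound sufficient. For a fixed tilt
  size \<open>h\<close>, Jensen bounds \<open>h\<close> times the summed deviation by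
  \<open>n * h^2 + O(1)\<close> minus the logarithm of the mass. The deviation may be as large as a
  small multiple of n, so a logarithm of order o(n) is harmless and no local limit theorem is
  involved. Compensating the fluctuations requires many cells on which \<open>w\<close> takes each
  of m linearly independent values. A linear change of coordinates in R^m turns these values into
  the unit vectors; a coordinate on such a cell then moves one component of the constraint only. One
  cell per direction is solved for, which gives a chart of the fibre by the remaining coordinates.
  The weight lives on these alone and the eliminated values range over [0,1]; so the slice is cut
  out by windows of length 1 and can have positive measure, and the weight is constant on it only up
  to a bounded factor. Breakpoints of \<open>w\<close> spoil a bounded number of cells. Lebesgue
  measure on the fibre comes from an unspecified frame, hence the uniqueness argument for
  translation-invariant measures.\<close>

definition tilt_mass :: "real \<Rightarrow> real" where
  "tilt_mass s = integral {0..1} (\<lambda>t. exp (s * t))"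

lemma integral_pos_continuous:
  fixes f :: "real \<Rightarrow> real"
  assumes "continuous_on {0..1} f" "\<And>t. t \<in> {0..1} \<Longrightarrow> 0 \<le> f t" "x \<in> {0..1}" "f x \<noteq> 0"
  shows "0 < integral {0..1} f"
proof -
  have "0 \<le> integral {0..1} f"
    using assms by (intro integral_nonneg integrable_continuous_interval) auto
  moreover have "integral {0..1} f \<noteq> 0"
    using integral_eq_0_iff[of 0 1 f] assms by force
  ultimately show ?thesis by simp
qed

lemma tilt_mass_pos: "0 < tilt_mass s"
  unfolding tilt_mass_def
  by (rule integral_pos_continuous[where x = 0]) (auto intro!: continuous_intros)

lemma tilt_mass_eq:
  assumes "s \<noteq> 0" shows "tilt_mass s = (exp s - 1) / s"
proof -
  have "((\<lambda>t. exp (s * t)) has_integral exp (s * 1) / s - exp (s * 0) / s) {0..1}"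
    using assms by (intro fundamental_theorem_of_calculus)
      (auto intro!: derivative_eq_intros simp: has_real_derivative_iff_has_vector_derivative[symmetric])
  then show ?thesis
    unfolding tilt_mass_def by (simp add: integral_unique diff_divide_distrib)
qed

text \<open>Identifies \<open>sigma_fn s\<close> as the mean of the density proportional to
  \<open>exp (s * t)\<close> on [0,1]. The explicit formula with coth is unfolded only here; all
  later facts about \<open>sigma_fn\<close> come from this interpretation.\<close>

lemma tilt_moment: "integral {0..1} (\<lambda>t. t * exp (s * t)) = sigma_fn s * tilt_mass s"
proof (cases "s = 0")
  case True
  have "((\<lambda>t::real. t) has_integral 1^2/2 - 0^2/2) {0..1}"
    by (intro fundamental_theorem_of_calculus)
      (auto intro!: derivative_eq_intros simp: has_real_derivative_iff_has_vector_derivative[symmetric])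
  then show ?thesis
    using True by (simp add: integral_unique sigma_fn_def tilt_mass_def)
next
  case False
  have "((\<lambda>t. t * exp (s * t)) has_integral
      (1 / s - 1 / s^2) * exp (s * 1) - (0 / s - 1 / s^2) * exp (s * 0)) {0..1}"
    using False by (intro fundamental_theorem_of_calculus)
      (auto intro!: derivative_eq_intros simp: has_real_derivative_iff_has_vector_derivative[symmetric] field_simps power2_eq_square)
  then have 1: "integral {0..1} (\<lambda>t. t * exp (s * t)) = exp s / s - exp s / s^2 + 1 / s^2"
    by (simp add: integral_unique algebra_simps)
  \<comment> \<open>In terms of \<open>exp (s/2)\<close> the hyperbolic cotangent becomes a rational
    function.\<close>
  define u where "u = exp (s/2)"
  have u: "u > 0" "exp s = u^2" "exp (-(s/2)) = inverse u"
    by (auto simp: u_def power2_eq_square exp_minus simp flip: exp_add)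
  have ne: "u^2 - 1 \<noteq> 0"
    using False u(2) by (metis exp_eq_one_iff right_minus_eq)
  have "cosh (s/2) / sinh (s/2) = (u + inverse u) / (u - inverse u)"
    unfolding cosh_field_def sinh_field_def u(3) u_def[symmetric]
    by (cases "u = inverse u") (auto simp: divide_simps)
  also have "\<dots> = (u^2 + 1) / (u^2 - 1)"
  proof -
    have "u - inverse u \<noteq> 0"
      using ne u(1) by (simp add: field_simps power2_eq_square)
    then show ?thesis using ne u(1) by (simp add: frac_eq_eq) (simp add: field_simps power2_eq_square)
  qed
  finally have 2: "sigma_fn s = ((u^2 + 1) / (u^2 - 1) - 2 / s + 1) / 2"
    using False by (simp add: sigma_fn_def)
  \<comment> \<open>The denominator \<open>exp s - 1\<close> as a single nonzero atom, so that
    clearing denominators leaves a polynomial identity.\<close>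
  define E where "E = u^2 - 1"
  have E: "u^2 = E + 1" "E \<noteq> 0" using ne by (auto simp: E_def)
  show ?thesis
    unfolding 1 2 tilt_mass_eq[OF False] u(2) E(1) using False E(2)
    by (simp add: field_simps power2_eq_square)
qed

text \<open>The linear term has mean zero under the tilted density. After factoring out
  \<open>exp (h * sigma_fn s)\<close>, this is the integral of the tangent line to the exponential;
  both comparisons of \<open>tilt_mass (s + h)\<close> with \<open>tilt_mass s\<close> are made
  against it.\<close>

lemma tilt_moment_centered:
  "integral {0..1} (\<lambda>t. exp (s * t) * (1 + h * (t - sigma_fn s))) = tilt_mass s"
proof -
  have "integral {0..1} (\<lambda>t. exp (s * t) * (1 + h * (t - sigma_fn s))) =
      integral {0..1} (\<lambda>t. (1 - h * sigma_fn s) * exp (s * t) + h * (t * exp (s * t)))"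
    by (rule arg_cong[where f = "integral {0..1}"]) (auto simp: algebra_simps)
  also have "\<dots> = (1 - h * sigma_fn s) * tilt_mass s + h * (sigma_fn s * tilt_mass s)"
    unfolding tilt_moment[symmetric] unfolding tilt_mass_def
    by (subst Henstock_Kurzweil_Integration.integral_add)
       (rule integrable_continuous_interval continuous_intros | simp)+
  finally show ?thesis by (simp add: algebra_simps)
qed

lemma sigma_fn_bounds: "0 < sigma_fn s" "sigma_fn s < 1"
proof -
  have "0 < integral {0..1} (\<lambda>t. t * exp (s * t))"
    by (rule integral_pos_continuous[where x = 1]) (auto intro!: continuous_intros)
  then show "0 < sigma_fn s"
    using tilt_mass_pos[of s] by (simp add: tilt_moment zero_less_mult_iff)
  have "0 < integral {0..1} (\<lambda>t. (1 - t) * exp (s * t))"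
    by (rule integral_pos_continuous[where x = 0]) (auto intro!: continuous_intros)
  also have "integral {0..1} (\<lambda>t. (1 - t) * exp (s * t)) = tilt_mass s - sigma_fn s * tilt_mass s"
    unfolding tilt_moment[symmetric] unfolding tilt_mass_def left_diff_distrib mult_1
    by (rule Henstock_Kurzweil_Integration.integral_diff)
       (intro integrable_continuous_interval continuous_intros)+
  finally have "0 < (1 - sigma_fn s) * tilt_mass s" by (simp add: algebra_simps)
  then show "sigma_fn s < 1"
    using tilt_mass_pos[of s] by (simp add: zero_less_mult_iff)
qed

lemma exp_le_quadratic:
  fixes x :: real assumes "\<bar>x\<bar> \<le> 1" shows "exp x \<le> 1 + x + x^2"
proof (cases "x \<ge> 0")
  case True then show ?thesis using assms exp_bound by auto
next
  case False
  define y where "y = - x"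
  have y: "0 \<le> y" "y \<le> 1" using False assms by (auto simp: y_def)
  \<comment> \<open>Multiplied by \<open>exp y\<close>, the claim reads 1 \<le> (1 - y + y^2) * exp
    y, and \<open>exp y\<close> is at least its quadratic Taylor polynomial.\<close>
  have "1 \<le> (1 - y + y^2) * (1 + y + y^2/2)"
  proof -
    have "(1 - y + y^2) * (1 + y + y^2/2) = 1 + y^2/2 + y^3/2 + y^4/2"
      by (simp add: field_simps power2_eq_square power3_eq_cube power4_eq_xxxx)
    then show ?thesis using y by simp
  qed
  also have "\<dots> \<le> (1 - y + y^2) * exp y"
    using y exp_lower_Taylor_quadratic[of y] by (intro mult_left_mono) auto
  finally have "exp (- y) \<le> 1 - y + y^2"
    by (simp add: exp_minus field_simps)
  then show ?thesis by (simp add: y_def)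
qed

text \<open>The sub-Gaussian estimate for one coordinate. Since |t - sigma_fn s| \<le> 1, the
  quadratic bound on \<open>exp\<close> applies pointwise; its linear term integrates to zero, its
  square is at most h^2, and 1 + h^2 \<le> exp (h^2).\<close>

lemma tilt_mass_shift_le:
  assumes "\<bar>h\<bar> \<le> 1"
  shows "tilt_mass (s + h) \<le> exp (h * sigma_fn s + h^2) * tilt_mass s"
proof -
  have *: "exp ((s + h) * t) \<le>
      exp (h * sigma_fn s) * (exp (s * t) * (1 + h * (t - sigma_fn s)) + h^2 * exp (s * t))"
    if "t \<in> {0..1}" for t
  proof -
    let ?x = "h * (t - sigma_fn s)"
    have t: "\<bar>t - sigma_fn s\<bar> \<le> 1" using that sigma_fn_bounds[of s] by (auto simp: abs_if)
    have "\<bar>?x\<bar> \<le> 1 * 1" unfolding abs_mult using assms t by (intro mult_mono) auto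
    then have "exp ?x \<le> 1 + ?x + ?x^2" by (intro exp_le_quadratic) simp
    also have "?x^2 = h^2 * (t - sigma_fn s)^2" by (simp add: power_mult_distrib)
    also have "\<dots> \<le> h^2 * 1" using t by (intro mult_left_mono) (auto simp: abs_square_le_1)
    finally have "exp ?x \<le> 1 + ?x + h^2" by simp
    then have "exp (h * sigma_fn s) * exp (s * t) * exp ?x \<le>
        exp (h * sigma_fn s) * exp (s * t) * (1 + ?x + h^2)"
      by (intro mult_left_mono) auto
    moreover have "exp (h * sigma_fn s) * exp (s * t) * exp ?x = exp ((s + h) * t)"
      by (simp add: algebra_simps flip: exp_add)
    ultimately show ?thesis by (simp add: algebra_simps)
  qed
  have "tilt_mass (s + h) \<le> integral {0..1} (\<lambda>t.
      exp (h * sigma_fn s) * (exp (s * t) * (1 + h * (t - sigma_fn s)) + h^2 * exp (s * t)))"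
    unfolding tilt_mass_def by (intro integral_le * integrable_continuous_interval continuous_intros)
  also have "\<dots> = exp (h * sigma_fn s) * (tilt_mass s + h^2 * tilt_mass s)"
    unfolding tilt_moment_centered[of s h, symmetric]
    by (subst integral_mult_right, subst Henstock_Kurzweil_Integration.integral_add)
       (rule integrable_continuous_interval continuous_intros | simp add: tilt_moment_centered tilt_mass_def[of s])+
  also have "\<dots> = exp (h * sigma_fn s) * (1 + h^2) * tilt_mass s" by (simp add: algebra_simps)
  also have "\<dots> \<le> exp (h * sigma_fn s) * exp (h^2) * tilt_mass s"
    using tilt_mass_pos[of s] by (intro mult_right_mono mult_left_mono) auto
  finally show ?thesis by (simp add: exp_add)
qed

text \<open>Strict Jensen inequality: the exponential lies above its tangent line, and strictly so
  at t = 0 because \<open>h * sigma_fn s\<close> is nonzero; continuity makes the integrated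
  inequality strict.\<close>

lemma tilt_mass_shift_gt:
  assumes "h \<noteq> 0"
  shows "exp (h * sigma_fn s) * tilt_mass s < tilt_mass (s + h)"
proof -
  let ?g = "\<lambda>t. exp ((s + h) * t) - exp (h * sigma_fn s) * (exp (s * t) * (1 + h * (t - sigma_fn s)))"
  have g: "?g t = exp (h * sigma_fn s) * exp (s * t) * (exp (h * (t - sigma_fn s)) - (1 + h * (t - sigma_fn s)))" for t
    by (simp add: algebra_simps flip: exp_add)
  have "0 < integral {0..1} ?g"
  proof (rule integral_pos_continuous[where x = 0])
    show "0 \<le> ?g t" for t unfolding g by (intro mult_nonneg_nonneg) (auto simp: exp_ge_add_one_self)
    have "1 + (h * (0 - sigma_fn s)) < exp (h * (0 - sigma_fn s))"
      using assms sigma_fn_bounds[of s] exp_gt_one exp_minus_greater[of "h * sigma_fn s"] by simp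
    then show "?g 0 \<noteq> 0" unfolding g by simp
  qed (auto intro!: continuous_intros)
  also have "integral {0..1} ?g = tilt_mass (s + h) - exp (h * sigma_fn s) * tilt_mass s"
    unfolding tilt_moment_centered[of s h, symmetric] unfolding tilt_mass_def
    by (subst Henstock_Kurzweil_Integration.integral_diff)
       (rule integrable_continuous_interval continuous_intros | simp)+
  finally show ?thesis by simp
qed

text \<open>Strict convexity of \<open>ln (tilt_mass s)\<close> used from \<open>a\<close> to
  \<open>b\<close> and from \<open>b\<close> to \<open>a\<close>; chaining the two inequalities
  cancels the masses. No derivative of \<open>sigma_fn\<close> is taken.\<close>

lemma sigma_fn_monotone:
  assumes "a \<noteq> b"
  shows "0 < (a - b) * (sigma_fn a - sigma_fn b)"
proof -
  have "exp ((b - a) * sigma_fn a) * tilt_mass a < tilt_mass b"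
    using tilt_mass_shift_gt[of "b - a" a] assms by simp
  then have "exp ((a - b) * sigma_fn b) * (exp ((b - a) * sigma_fn a) * tilt_mass a) < exp ((a - b) * sigma_fn b) * tilt_mass b"
    by simp
  also have "\<dots> < tilt_mass a"
    using tilt_mass_shift_gt[of "a - b" b] assms by simp
  finally have "exp ((a - b) * sigma_fn b + (b - a) * sigma_fn a) < 1"
    using tilt_mass_pos[of a] by (simp add: exp_add)
  then show ?thesis by (simp add: algebra_simps)
qed

lemma mono_sigma_fn: "mono sigma_fn"
proof (rule monoI)
  fix a b :: real assume "a \<le> b"
  then show "sigma_fn a \<le> sigma_fn b"
    using sigma_fn_monotone[of b a] by (cases "a = b") (auto simp: zero_less_mult_iff)
qed

lemma borel_measurable_sigma_fn [measurable]: "sigma_fn \<in> borel_measurable borel"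
  by (rule borel_measurable_mono[OF mono_sigma_fn])

lemma tilt_mass_le: "tilt_mass s \<le> exp \<bar>s\<bar>"
proof -
  have "s * t \<le> \<bar>s\<bar>" if "t \<in> {0..1}" for t
    using that mult_mono[of s "\<bar>s\<bar>" t 1] by simp
  then have *: "exp (s * t) \<le> exp \<bar>s\<bar>" if "t \<in> {0..1}" for t
    using that by simp
  have "tilt_mass s \<le> integral {0..1::real} (\<lambda>t. exp \<bar>s\<bar>)"
    unfolding tilt_mass_def
    by (intro integral_le integrable_continuous_interval continuous_intros *)
  then show ?thesis by simp
qed

text \<open>Steering coordinates will be confined to short intervals anywhere in [0,1], so the
  density needs a lower bound uniform in \<open>t\<close>: numerator at least
  \<open>exp (-\<bar>s\<bar>)\<close>, normalisation at most
  \<open>exp \<bar>s\<bar>\<close>.\<close>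

lemma tilt_density_ge:
  assumes "t \<in> {0..1}"
  shows "exp (- 2 * \<bar>s\<bar>) \<le> exp (s * t) / tilt_mass s"
proof -
  have "- \<bar>s\<bar> \<le> s * t"
    using assms mult_mono[of "-s" "\<bar>s\<bar>" t 1] abs_ge_minus_self[of s] by simp
  then have "exp (- 2 * \<bar>s\<bar>) * tilt_mass s \<le> exp (- 2 * \<bar>s\<bar>) * exp \<bar>s\<bar>"
    using tilt_mass_le by (intro mult_left_mono) auto
  also have "\<dots> \<le> exp (s * t)"
    using \<open>- \<bar>s\<bar> \<le> s * t\<close> by (simp flip: exp_add)
  finally show ?thesis
    using tilt_mass_pos[of s] by (simp add: field_simps)
qed

text \<open>Keeps only the piece of length \<open>d\<close> at the end of [0,1] where the exponent
  is largest. The parameter stays free so that the loss \<open>d * \<bar>s\<bar>\<close> can later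
  be made smaller than the linear growth of the potential.\<close>

lemma ln_tilt_mass_ge:
  assumes "0 < d" "d \<le> 1"
  shows "ln d + max s 0 - d * \<bar>s\<bar> \<le> ln (tilt_mass s)"
proof -
  let ?I = "if s \<ge> 0 then {1 - d..1} else {0..d}"
  have sub: "?I \<subseteq> {0..1}" using assms by auto
  have le: "max s 0 - d * \<bar>s\<bar> \<le> s * t" if "t \<in> ?I" for t
  proof (cases "s \<ge> 0")
    case True
    then have "s * (1 - d) \<le> s * t" using that by (intro mult_left_mono) auto
    then show ?thesis using True by (simp add: algebra_simps)
  next
    case False
    then have "s * d \<le> s * t" using that by (intro mult_left_mono_neg) auto
    then show ?thesis using False by (simp add: algebra_simps)
  qed
  have "d * exp (max s 0 - d * \<bar>s\<bar>) = integral ?I (\<lambda>t. exp (max s 0 - d * \<bar>s\<bar>))"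
    using assms by auto
  also have "\<dots> \<le> integral ?I (\<lambda>t. exp (s * t))"
    using le by (intro integral_le) (auto intro!: integrable_continuous_interval continuous_intros split: if_splits)
  also have "\<dots> \<le> tilt_mass s"
    unfolding tilt_mass_def using sub
    by (intro integral_subset_le) (auto intro!: integrable_continuous_interval continuous_intros split: if_splits)
  finally have "ln (d * exp (max s 0 - d * \<bar>s\<bar>)) \<le> ln (tilt_mass s)"
    using assms tilt_mass_pos by (subst ln_le_cancel_iff) auto
  then show ?thesis using assms by (simp add: ln_mult)
qed

lemma ln_tilt_mass_shift_le:
  assumes "\<bar>h\<bar> \<le> 1"
  shows "ln (tilt_mass (s + h)) \<le> ln (tilt_mass s) + h * sigma_fn s + h^2"
proof -
  have "ln (tilt_mass (s + h)) \<le> ln (exp (h * sigma_fn s + h^2) * tilt_mass s)"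
    using tilt_mass_shift_le[OF assms] tilt_mass_pos by (subst ln_le_cancel_iff) auto
  then show ?thesis using tilt_mass_pos[of s] by (simp add: ln_mult)
qed

lemma continuous_on_tilt_mass: "continuous_on UNIV tilt_mass"
proof -
  have "continuous_on UNIV (\<lambda>s. integral (cbox 0 1) (\<lambda>t. exp (s * t)) :: real)"
    by (rule integral_continuous_on_param) (auto intro!: continuous_intros simp: split_def)
  then show ?thesis by (simp add: tilt_mass_def[abs_def])
qed

section \<open>Tilted product weights on the cube\<close>

abbreviation lebPi :: "'i set \<Rightarrow> ('i \<Rightarrow> real) measure" where
  "lebPi I \<equiv> Pi\<^sub>M I (\<lambda>_. lborel)"

interpretation lebPi: product_sigma_finite "\<lambda>_::'i. lborel :: real measure"
  by standard

definition tilt_density :: "real \<Rightarrow> real \<Rightarrow> real" where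
  "tilt_density s t = indicator {0..1} t * (exp (s * t) / tilt_mass s)"

definition tilt_weight :: "('i \<Rightarrow> real) \<Rightarrow> 'i set \<Rightarrow> ('i \<Rightarrow> real) \<Rightarrow> ennreal" where
  "tilt_weight s I t = (\<Prod>i\<in>I. ennreal (tilt_density (s i) (t i)))"

lemma tilt_density_nonneg: "0 \<le> tilt_density s t"
  using tilt_mass_pos[of s] by (simp add: tilt_density_def)

lemma measurable_tilt_density [measurable]: "tilt_density s \<in> borel_measurable borel"
  unfolding tilt_density_def[abs_def] by measurable

lemma measurable_tilt_weight [measurable]:
  "finite I \<Longrightarrow> I \<subseteq> J \<Longrightarrow> tilt_weight s I \<in> borel_measurable (lebPi J)"
  unfolding tilt_weight_def[abs_def]
  by (intro borel_measurable_prod_ennreal measurable_compose[OF _ measurable_ennreal]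
      measurable_compose[OF measurable_component_singleton])
     (auto simp: measurable_lborel1)

lemma nn_integral_unit_interval:
  fixes f :: "real \<Rightarrow> real"
  assumes "continuous_on {0..1} f" "f \<in> borel_measurable borel" "\<And>t. 0 \<le> f t"
  shows "(\<integral>\<^sup>+ t. ennreal (indicator {0..1} t * f t) \<partial>lborel) = ennreal (integral {0..1} f)"
proof (rule nn_integral_has_integral_lborel)
  have "(f has_integral integral {0..1} f) {0..1}"
    using assms(1) by (intro integrable_integral integrable_continuous_interval)
  then show "((\<lambda>t. indicator {0..1} t * f t) has_integral integral {0..1} f) UNIV"
    by (subst (asm) has_integral_restrict_UNIV[symmetric], elim has_integral_eq[rotated]) (auto simp: indicator_def)
qed (use assms in auto)

lemma nn_integral_tilt_exp:
  "(\<integral>\<^sup>+ t. ennreal (exp (h * (t - sigma_fn s))) * ennreal (tilt_density s t) \<partial>lborel) =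
     ennreal (exp (- h * sigma_fn s) * tilt_mass (s + h) / tilt_mass s)"
proof -
  have "(\<integral>\<^sup>+ t. ennreal (exp (h * (t - sigma_fn s))) * ennreal (tilt_density s t) \<partial>lborel) =
      (\<integral>\<^sup>+ t. ennreal (indicator {0..1} t * (exp (- h * sigma_fn s) / tilt_mass s * exp ((s + h) * t))) \<partial>lborel)"
    using tilt_mass_pos[of s]
    by (intro nn_integral_cong, subst ennreal_mult'[symmetric])
       (auto simp: tilt_density_def indicator_def algebra_simps exp_diff exp_add exp_minus divide_simps)
  also have "\<dots> = ennreal (integral {0..1} (\<lambda>t. exp (- h * sigma_fn s) / tilt_mass s * exp ((s + h) * t)))"
    using tilt_mass_pos[of s] by (intro nn_integral_unit_interval continuous_intros) auto
  finally show ?thesis by (simp add: tilt_mass_def)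
qed

lemma nn_integral_tilt_density: "(\<integral>\<^sup>+ t. ennreal (tilt_density s t) \<partial>lborel) = 1"
  using nn_integral_tilt_exp[of 0 s] tilt_mass_pos[of s] by simp

lemma nn_integral_tilt_weight:
  assumes "finite I" shows "(\<integral>\<^sup>+ t. tilt_weight s I t \<partial>lebPi I) = 1"
  unfolding tilt_weight_def using assms
  by (subst lebPi.product_nn_integral_prod) (simp_all add: nn_integral_tilt_density)

text \<open>The exponential moment factors over the coordinates, and each factor is the
  one-dimensional sub-Gaussian estimate.\<close>

lemma tilt_weight_mgf:
  assumes "finite I" "\<And>i. i \<in> I \<Longrightarrow> \<bar>h i\<bar> \<le> 1"
  shows "(\<integral>\<^sup>+ t. ennreal (exp (\<Sum>i\<in>I. h i * (t i - sigma_fn (s i)))) * tilt_weight s I t \<partial>lebPi I)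
    \<le> ennreal (exp (\<Sum>i\<in>I. (h i)^2))"
proof -
  have "(\<integral>\<^sup>+ t. ennreal (exp (\<Sum>i\<in>I. h i * (t i - sigma_fn (s i)))) * tilt_weight s I t \<partial>lebPi I) =
     (\<integral>\<^sup>+ t. (\<Prod>i\<in>I. (\<lambda>x. ennreal (exp (h i * (x - sigma_fn (s i)))) * ennreal (tilt_density (s i) x)) (t i)) \<partial>lebPi I)"
    using assms(1) by (simp add: tilt_weight_def exp_sum prod.distrib prod_ennreal)
  also have "\<dots> = (\<Prod>i\<in>I. \<integral>\<^sup>+ x. ennreal (exp (h i * (x - sigma_fn (s i)))) * ennreal (tilt_density (s i) x) \<partial>lborel)"
    by (rule lebPi.product_nn_integral_prod[OF assms(1)]) measurable
  also have "\<dots> \<le> (\<Prod>i\<in>I. ennreal (exp ((h i)^2)))"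
  proof (rule prod_mono_ennreal)
    fix i assume "i \<in> I"
    have "exp (- h i * sigma_fn (s i)) * tilt_mass (s i + h i) / tilt_mass (s i) \<le> exp ((h i)^2)"
      using tilt_mass_shift_le[OF assms(2)[OF \<open>i \<in> I\<close>], of "s i"] tilt_mass_pos[of "s i"]
      by (simp add: exp_minus exp_add field_simps)
    then show "(\<integral>\<^sup>+ x. ennreal (exp (h i * (x - sigma_fn (s i)))) * ennreal (tilt_density (s i) x) \<partial>lborel) \<le> ennreal (exp ((h i)^2))"
      unfolding nn_integral_tilt_exp by (rule ennreal_leI)
  qed
  also have "\<dots> = ennreal (exp (\<Sum>i\<in>I. (h i)^2))"
    using assms(1) by (simp add: exp_sum prod_ennreal)
  finally show ?thesis .
qed

lemma tilt_weight_tail: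
  assumes "finite I" "\<And>i. i \<in> I \<Longrightarrow> \<bar>h i\<bar> \<le> 1"
  shows "(\<integral>\<^sup>+ t. indicator {t. r \<le> (\<Sum>i\<in>I. h i * (t i - sigma_fn (s i)))} t * tilt_weight s I t \<partial>lebPi I)
    \<le> ennreal (exp ((\<Sum>i\<in>I. (h i)^2) - r))"
proof -
  have "(\<integral>\<^sup>+ t. indicator {t. r \<le> (\<Sum>i\<in>I. h i * (t i - sigma_fn (s i)))} t * tilt_weight s I t \<partial>lebPi I)
     \<le> (\<integral>\<^sup>+ t. ennreal (exp (-r)) * (ennreal (exp (\<Sum>i\<in>I. h i * (t i - sigma_fn (s i)))) * tilt_weight s I t) \<partial>lebPi I)"
    unfolding mult.assoc[symmetric]
    by (intro nn_integral_mono mult_right_mono) (auto simp: indicator_def simp flip: ennreal_mult' exp_add)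
  also have "\<dots> = ennreal (exp (-r)) * (\<integral>\<^sup>+ t. (ennreal (exp (\<Sum>i\<in>I. h i * (t i - sigma_fn (s i)))) * tilt_weight s I t) \<partial>lebPi I)"
    using assms(1) by (intro nn_integral_cmult) measurable
  also have "\<dots> \<le> ennreal (exp (-r)) * ennreal (exp (\<Sum>i\<in>I. (h i)^2))"
    by (intro mult_left_mono tilt_weight_mgf assms) auto
  also have "\<dots> = ennreal (exp ((\<Sum>i\<in>I. (h i)^2) - r))"
    by (simp flip: ennreal_mult' exp_add)
  finally show ?thesis .
qed

text \<open>A union bound over the 2m one-sided deviations. Normalised by \<open>C * sqrt n\<close>,
  the coefficients of each have squares summing to at most 1, so a Chernoff bound at level 1 + ln
  (4m) gives tail mass at most 1/(4m); together at most half of the mass is lost.\<close>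

lemma tilt_weight_concentration:
  fixes v :: "'i \<Rightarrow> real ^ 'm"
  assumes I: "finite I" "card I \<le> n" and n: "1 \<le> n" and C: "1 \<le> C"
    and v: "\<And>i l. i \<in> I \<Longrightarrow> \<bar>v i $ l\<bar> \<le> C"
  defines "r \<equiv> C * (1 + ln (4 * real CARD('m))) * sqrt n"
  shows "ennreal (1 / 2) \<le> (\<integral>\<^sup>+ t. indicator {t. \<forall>l. \<bar>\<Sum>i\<in>I. (t i - sigma_fn (s i)) * v i $ l\<bar> \<le> r} t * tilt_weight s I t \<partial>lebPi I)"
proof -
  define X where "X l t = (\<Sum>i\<in>I. (t i - sigma_fn (s i)) * v i $ l)" for l t
  have X[measurable]: "X l \<in> borel_measurable (lebPi I)" for l
    unfolding X_def[abs_def] by measurable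
  define h where "h e l i = e * v i $ l / (C * sqrt n)" for e :: real and l i
  define \<mu> where "\<mu> = 1 + ln (4 * real CARD('m))"
  have tail: "(\<integral>\<^sup>+ t. indicator {t. r \<le> e * X l t} t * tilt_weight s I t \<partial>lebPi I) \<le> ennreal (1 / (4 * CARD('m)))"
    if e: "\<bar>e\<bar> = 1" for e l
  proof -
    have pos: "0 < C * sqrt n" using C n by simp
    have h2: "(h e l i)^2 \<le> 1 / n" if "i \<in> I" for i
    proof -
      have "(v i $ l)^2 \<le> C^2" using v[OF that, of l] C abs_le_square_iff[of "v i $ l" C] by simp
      moreover have "e^2 = 1" using e by (simp add: power2_eq_1_iff abs_if split: if_splits)
      ultimately have "(h e l i)^2 \<le> C^2 / (C^2 * n)"
        using n by (simp only: h_def power_divide power_mult_distrib mult_1 real_sqrt_pow2 of_nat_0_le_iff)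
          (intro divide_right_mono; simp)
      then show ?thesis using C by simp
    qed
    have h1: "\<bar>h e l i\<bar> \<le> 1" if "i \<in> I" for i
    proof -
      have "1 / real n \<le> 1" using n by simp
      with h2[OF that] have "(h e l i)^2 \<le> 1" by simp
      then show ?thesis by (simp add: abs_square_le_1)
    qed
    have sum: "(\<Sum>i\<in>I. (h e l i)^2) \<le> 1"
    proof -
      have "(\<Sum>i\<in>I. (h e l i)^2) \<le> (\<Sum>i\<in>I. 1 / n)" using h2 by (rule sum_mono)
      also have "\<dots> = card I / n" by simp
      also have "\<dots> \<le> 1" using I n by simp
      finally show ?thesis .
    qed
    have Xh: "(\<Sum>i\<in>I. h e l i * (t i - sigma_fn (s i))) = e * X l t / (C * sqrt n)" for t
      unfolding X_def h_def sum_distrib_left sum_divide_distrib by (intro sum.cong) auto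
    have set_eq: "{t. r \<le> e * X l t} = {t. \<mu> \<le> (\<Sum>i\<in>I. h e l i * (t i - sigma_fn (s i)))}"
      unfolding Xh using pos by (auto simp: r_def \<mu>_def field_simps)
    have "(\<integral>\<^sup>+ t. indicator {t. r \<le> e * X l t} t * tilt_weight s I t \<partial>lebPi I) \<le> ennreal (exp ((\<Sum>i\<in>I. (h e l i)^2) - \<mu>))"
      unfolding set_eq by (rule tilt_weight_tail[OF I(1) h1])
    also have "\<dots> \<le> ennreal (exp (1 - \<mu>))" using sum by (intro ennreal_leI) simp
    also have "exp (1 - \<mu>) = 1 / (4 * CARD('m))" by (simp add: \<mu>_def exp_minus field_simps)
    finally show ?thesis .
  qed
  let ?B = "\<lambda>e l t. indicator {t. r \<le> e * X l t} t * tilt_weight s I t"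
  let ?G = "\<lambda>t. indicator {t. \<forall>l. \<bar>X l t\<bar> \<le> r} t * tilt_weight s I t"
  have "1 = (\<integral>\<^sup>+ t. tilt_weight s I t \<partial>lebPi I)"
    by (simp add: nn_integral_tilt_weight I)
  also have "\<dots> \<le> (\<integral>\<^sup>+ t. ?G t + (\<Sum>l\<in>UNIV. ?B 1 l t + ?B (-1) l t) \<partial>lebPi I)"
  proof (rule nn_integral_mono)
    fix t
    show "tilt_weight s I t \<le> ?G t + (\<Sum>l\<in>UNIV. ?B 1 l t + ?B (-1) l t)"
    proof (cases "\<forall>l. \<bar>X l t\<bar> \<le> r")
      case True then show ?thesis by (simp add: indicator_def)
    next
      case False
      then obtain l where l: "r < \<bar>X l t\<bar>" using not_le by blast
      have "tilt_weight s I t \<le> ?B 1 l t + ?B (-1) l t"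
        using l by (auto simp: indicator_def)
      also have "\<dots> \<le> (\<Sum>l\<in>UNIV. ?B 1 l t + ?B (-1) l t)"
        by (rule member_le_sum) auto
      finally show ?thesis by (simp add: add_increasing)
    qed
  qed
  also have "\<dots> = (\<integral>\<^sup>+ t. ?G t \<partial>lebPi I) + (\<Sum>l\<in>UNIV. (\<integral>\<^sup>+ t. ?B 1 l t \<partial>lebPi I) + (\<integral>\<^sup>+ t. ?B (-1) l t \<partial>lebPi I))"
  proof -
    have W[measurable]: "tilt_weight s I \<in> borel_measurable (lebPi I)"
      using I(1) by (rule measurable_tilt_weight) simp
    have *: "(\<lambda>t. indicator {t. P t} t * tilt_weight s I t) \<in> borel_measurable (lebPi I)"
      if [measurable]: "Measurable.pred (lebPi I) P" for P
      by measurable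
    show ?thesis
      by (subst nn_integral_add, (measurable)[2],
          subst nn_integral_sum, (measurable)[1],
          subst nn_integral_add, (measurable)[2], simp)
  qed
  also have "\<dots> \<le> (\<integral>\<^sup>+ t. ?G t \<partial>lebPi I) + (\<Sum>l\<in>(UNIV::'m set). ennreal (1 / (4 * CARD('m))) + ennreal (1 / (4 * CARD('m))))"
    by (intro add_left_mono sum_mono add_mono tail) auto
  also have "(\<Sum>l\<in>(UNIV::'m set). ennreal (1 / (4 * CARD('m))) + ennreal (1 / (4 * CARD('m)))) = ennreal (1/2)"
    by (simp add: ennreal_of_nat_eq_real_of_nat flip: ennreal_plus ennreal_mult')
  finally have "ennreal 1 - ennreal (1/2) \<le> (\<integral>\<^sup>+ t. ?G t \<partial>lebPi I)"
    by (simp add: ennreal_minus_le_iff add.commute)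
  then have "ennreal (1 / 2) \<le> (\<integral>\<^sup>+ t. ?G t \<partial>lebPi I)"
    by (subst (asm) ennreal_minus) (auto simp del: ennreal_half)
  then show ?thesis unfolding X_def .
qed

section \<open>Slices of the cube\<close>

text \<open>
  The \<open>m\<close> coordinates eliminated by the linear equations have unit coefficient vectors, so their values are
  the components of \<open>Y - (\<Sum>i\<in>I. t i *\<^sub>R v i)\<close>.
\<close>

definition slice :: "'i set \<Rightarrow> ('i \<Rightarrow> real ^ 'm) \<Rightarrow> real ^ 'm \<Rightarrow> ('i \<Rightarrow> real) set" where
  "slice I v Y = {t \<in> (\<Pi>\<^sub>E i\<in>I. {0..1}). \<forall>l. (Y - (\<Sum>i\<in>I. t i *\<^sub>R v i)) $ l \<in> {0..1}}"

lemma sets_slice [measurable]: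
  assumes "finite I" shows "slice I v Y \<in> sets (lebPi I)"
proof -
  have "(\<Pi>\<^sub>E i\<in>I. {0..1}) \<in> sets (lebPi I)"
    using assms by (intro sets_PiM_I_finite) auto
  moreover have "{t \<in> space (lebPi I). \<forall>l. Y $ l - (\<Sum>i\<in>I. t i * v i $ l) \<in> {0..1}} \<in> sets (lebPi I)"
    by measurable
  moreover have "slice I v Y = (\<Pi>\<^sub>E i\<in>I. {0..1}) \<inter> {t \<in> space (lebPi I). \<forall>l. Y $ l - (\<Sum>i\<in>I. t i * v i $ l) \<in> {0..1}}"
    by (auto simp: slice_def space_PiM)
  ultimately show ?thesis by auto
qed

text \<open>
  Given good coordinates in \<open>J\<close>, it suffices that each of the \<open>M\<close> steering coordinates for direction \<open>l\<close> lies in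
  a prescribed interval of length \<open>1 / M\<close>: then their sum lies in the required window of length 1.
\<close>

lemma steering_mass:
  fixes v :: "'i \<Rightarrow> real ^ 'm"
  assumes fin: "finite J" "finite R" "J \<inter> R = {}"
    and vR: "\<And>i. i \<in> R \<Longrightarrow> v i = axis (lab i) 1"
    and cardR: "\<And>l. card {i \<in> R. lab i = l} = M" and M: "1 \<le> M"
    and sR: "\<And>i. i \<in> R \<Longrightarrow> \<bar>s i\<bar> \<le> K"
    and [measurable]: "Measurable.pred (lebPi J) good"
    and q: "q \<le> (\<integral>\<^sup>+ x. indicator {x. good x} x * tilt_weight s J x \<partial>lebPi J)"
    and good: "\<And>x l. good x \<Longrightarrow> Y $ l - (\<Sum>i\<in>J. x i * v i $ l) \<in> {1..real M}"
  shows "q * ennreal ((exp (- 2 * K) / M) ^ card R) \<le>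
    (\<integral>\<^sup>+ t. indicator (slice (J \<union> R) v Y) t * tilt_weight s (J \<union> R) t \<partial>lebPi (J \<union> R))"
proof -
  define d where "d x l = Y $ l - (\<Sum>i\<in>J. x i * v i $ l)" for x l
  define f where "f t = indicator (slice (J \<union> R) v Y) t * tilt_weight s (J \<union> R) t" for t
  \<comment> \<open>\<open>d x l\<close> is what the steering coordinates labelled \<open>l\<close>
    still have to supply, up to an error in [0,1]. A good \<open>x\<close> has \<open>d x l\<close>
    between 1 and \<open>M\<close>, which keeps the prescribed intervals inside [0,1]. The constant
    \<open>exp (- 2 * K)\<close> is a lower bound for the tilted density there, so
    \<open>box\<close> minorises the weight of the steering coordinates.\<close>
  define box where "box x y = (\<Prod>i\<in>R. (\<lambda>u. ennreal (exp (- 2 * K)) * indicator {(d x (lab i) - 1) / M .. d x (lab i) / M} u) (y i))" for x y :: "'i \<Rightarrow> real"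
  have finJR: "finite (J \<union> R)" using fin by auto
  note sets_slice[OF finJR, measurable]
  have [measurable]: "tilt_weight s (J \<union> R) \<in> borel_measurable (lebPi (J \<union> R))" "tilt_weight s J \<in> borel_measurable (lebPi J)"
    using fin by (auto intro!: measurable_tilt_weight)
  have f[measurable]: "f \<in> borel_measurable (lebPi (J \<union> R))"
    unfolding f_def[abs_def] by measurable
  have ptw: "indicator {x. good x} x * tilt_weight s J x * box x y \<le> f (merge J R (x, y))"
    if x: "x \<in> space (lebPi J)" and y: "y \<in> space (lebPi R)" for x y
  proof (cases "good x \<and> (\<forall>i\<in>J. x i \<in> {0..1}) \<and> (\<forall>i\<in>R. y i \<in> {(d x (lab i) - 1) / M .. d x (lab i) / M})")
    case False
    then consider "\<not> good x" | i where "i \<in> J" "x i \<notin> {0..1}"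
      | i where "i \<in> R" "y i \<notin> {(d x (lab i) - 1) / M .. d x (lab i) / M}" by blast
    then have zero: "indicator {x. good x} x * tilt_weight s J x * box x y = 0"
    proof cases
      case 1 then show ?thesis by simp
    next
      case 2
      then have "tilt_weight s J x = 0"
        unfolding tilt_weight_def using fin by (intro prod_zero bexI[of _ i]) (auto simp: tilt_density_def)
      then show ?thesis by simp
    next
      case 3
      then have "box x y = 0"
        unfolding box_def using fin by (intro prod_zero bexI[of _ i]) auto
      then show ?thesis by simp
    qed
    show ?thesis unfolding zero by simp
  next
    case True
    have d: "1 \<le> d x l" "d x l \<le> M" for l using good[of x l] True by (auto simp: d_def)
    have y01: "y i \<in> {0..1}" if "i \<in> R" for i
    proof -
      have "0 \<le> (d x (lab i) - 1) / M" "d x (lab i) / M \<le> 1" using d[of "lab i"] M by auto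
      then show ?thesis using True that by fastforce
    qed
    let ?t = "merge J R (x, y)"
    have tJ: "?t i = x i" if "i \<in> J" for i using that by (simp add: merge_def)
    have tR: "?t i = y i" if "i \<in> R" for i using that fin by (auto simp: merge_def)
    have sumR: "(\<Sum>i\<in>R. y i * v i $ l) = (\<Sum>i\<in>{i\<in>R. lab i = l}. y i)" for l
      using fin(2) by (subst sum.inter_filter) (auto intro!: sum.cong simp: vR axis_def)
    have z: "(Y - (\<Sum>i\<in>J \<union> R. ?t i *\<^sub>R v i)) $ l \<in> {0..1}" for l
    proof -
      have "(Y - (\<Sum>i\<in>J \<union> R. ?t i *\<^sub>R v i)) $ l = d x l - (\<Sum>i\<in>{i\<in>R. lab i = l}. y i)"
        using fin by (simp add: sum.union_disjoint tJ tR d_def flip: sumR)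
      moreover have "(\<Sum>i\<in>{i\<in>R. lab i = l}. y i) \<le> of_nat (card {i\<in>R. lab i = l}) * (d x l / M)"
        using True by (intro sum_bounded_above) auto
      moreover have "of_nat (card {i\<in>R. lab i = l}) * ((d x l - 1) / M) \<le> (\<Sum>i\<in>{i\<in>R. lab i = l}. y i)"
        using True by (intro sum_bounded_below) auto
      ultimately show ?thesis using M by (simp add: cardR)
    qed
    have "?t \<in> (\<Pi>\<^sub>E i\<in>J \<union> R. {0..1})"
      using True y01 by (auto simp: PiE_iff tJ tR extensional_def merge_def)
    with z have slice: "?t \<in> slice (J \<union> R) v Y" by (simp add: slice_def)
    have "box x y \<le> tilt_weight s R y"
      unfolding box_def tilt_weight_def
    proof (rule prod_mono_ennreal)
      fix i assume i: "i \<in> R"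
      have "exp (- 2 * K) \<le> exp (- 2 * \<bar>s i\<bar>)" using sR[OF i] by simp
      also have "\<dots> \<le> tilt_density (s i) (y i)"
        using tilt_density_ge[OF y01[OF i]] y01[OF i] by (simp add: tilt_density_def)
      finally show "ennreal (exp (- 2 * K)) * indicator {(d x (lab i) - 1) / M .. d x (lab i) / M} (y i) \<le> ennreal (tilt_density (s i) (y i))"
        by (simp add: indicator_def ennreal_leI)
    qed
    then have "tilt_weight s J x * box x y \<le> tilt_weight s J x * tilt_weight s R y"
      by (intro mult_left_mono) auto
    also have "\<dots> = tilt_weight s (J \<union> R) ?t"
      using fin by (simp add: tilt_weight_def prod.union_disjoint tJ tR)
    finally show ?thesis using True slice by (simp add: f_def)
  qed
  have box: "(\<integral>\<^sup>+ y. box x y \<partial>lebPi R) = ennreal ((exp (- 2 * K) / M) ^ card R)" for x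
  proof -
    have "(\<integral>\<^sup>+ y. box x y \<partial>lebPi R) = (\<Prod>i\<in>R. \<integral>\<^sup>+ u. ennreal (exp (- 2 * K)) * indicator {(d x (lab i) - 1) / M .. d x (lab i) / M} u \<partial>lborel)"
      unfolding box_def by (rule lebPi.product_nn_integral_prod[OF fin(2)]) measurable
    also have "\<dots> = (\<Prod>i\<in>R. ennreal (exp (- 2 * K) / M))"
    proof (rule prod.cong[OF refl])
      fix i
      have "(d x (lab i) - 1) / M \<le> d x (lab i) / M" by (simp add: divide_right_mono)
      moreover have "d x (lab i) / M - (d x (lab i) - 1) / M = 1 / M" by (simp flip: diff_divide_distrib)
      ultimately show "(\<integral>\<^sup>+ u. ennreal (exp (- 2 * K)) * indicator {(d x (lab i) - 1) / M .. d x (lab i) / M} u \<partial>lborel) = ennreal (exp (- 2 * K) / M)"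
        by (subst nn_integral_cmult_indicator) (auto simp flip: ennreal_mult')
    qed
    finally show ?thesis by (simp add: ennreal_power)
  qed
  have "q * ennreal ((exp (- 2 * K) / M) ^ card R) \<le> (\<integral>\<^sup>+ x. indicator {x. good x} x * tilt_weight s J x \<partial>lebPi J) * ennreal ((exp (- 2 * K) / M) ^ card R)"
    by (intro mult_right_mono q) auto
  also have "\<dots> \<le> (\<integral>\<^sup>+ x. \<integral>\<^sup>+ y. f (merge J R (x, y)) \<partial>lebPi R \<partial>lebPi J)"
  proof -
    have "(\<integral>\<^sup>+ x. indicator {x. good x} x * tilt_weight s J x \<partial>lebPi J) * ennreal ((exp (- 2 * K) / M) ^ card R)
       = (\<integral>\<^sup>+ x. indicator {x. good x} x * tilt_weight s J x * ennreal ((exp (- 2 * K) / M) ^ card R) \<partial>lebPi J)"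
      by (intro nn_integral_multc[symmetric]) measurable
    also have "\<dots> \<le> (\<integral>\<^sup>+ x. \<integral>\<^sup>+ y. f (merge J R (x, y)) \<partial>lebPi R \<partial>lebPi J)"
    proof (rule nn_integral_mono)
      fix x assume x: "x \<in> space (lebPi J)"
      have [measurable]: "box x \<in> borel_measurable (lebPi R)"
        unfolding box_def by measurable
      have "indicator {x. good x} x * tilt_weight s J x * ennreal ((exp (- 2 * K) / M) ^ card R)
         = (\<integral>\<^sup>+ y. indicator {x. good x} x * tilt_weight s J x * box x y \<partial>lebPi R)"
        by (subst nn_integral_cmult) (simp_all add: box)
      also have "\<dots> \<le> (\<integral>\<^sup>+ y. f (merge J R (x, y)) \<partial>lebPi R)"
        by (intro nn_integral_mono ptw x)
      finally show "indicator {x. good x} x * tilt_weight s J x * ennreal ((exp (- 2 * K) / M) ^ card R)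
         \<le> (\<integral>\<^sup>+ y. f (merge J R (x, y)) \<partial>lebPi R)" .
    qed
    finally show ?thesis .
  qed
  also have "\<dots> = (\<integral>\<^sup>+ t. f t \<partial>lebPi (J \<union> R))"
    by (rule lebPi.product_nn_integral_fold[symmetric]) (use fin in auto)
  finally show ?thesis by (simp add: f_def)
qed


text \<open>
  On the slice the weight is constant up to a factor between \<open>exp (- K)\<close> and \<open>exp K\<close>, so the uniform mean
  of an exponential is controlled by its mean under the product weight; Jensen's inequality enters as
  the tangent line bound \<open>exp c * (1 + X - c) \<le> exp X\<close>.
\<close>

lemma slice_mean_deviation:
  fixes v :: "'i \<Rightarrow> real ^ 'm" and \<tau> :: "real ^ 'm" and h :: real
  assumes I: "finite I" and p: "0 < p"
    "ennreal p \<le> (\<integral>\<^sup>+ t. indicator (slice I v Y) t * tilt_weight (\<lambda>i. \<tau> \<bullet> v i) I t \<partial>lebPi I)"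
    and h: "0 < h" "h \<le> 1"
  defines "vol \<equiv> measure (lebPi I) (slice I v Y)"
  shows "0 < vol"
    and "h * (\<Sum>i\<in>I. \<bar>(\<integral>t. indicator (slice I v Y) t * t i \<partial>lebPi I) / vol - sigma_fn (\<tau> \<bullet> v i)\<bar>)
      \<le> 2 * (\<Sum>l\<in>UNIV. \<bar>\<tau> $ l\<bar>) + card I * h^2 - ln p"
proof -
  define S where "S = slice I v Y"
  define K where "K = (\<Sum>l\<in>UNIV. \<bar>\<tau> $ l\<bar>)"
  define W where "W = tilt_weight (\<lambda>i. \<tau> \<bullet> v i) I"
  define A where "A = exp (\<tau> \<bullet> Y) / (\<Prod>i\<in>I. tilt_mass (\<tau> \<bullet> v i))"
  let ?\<mu> = "lebPi I"
  have S[measurable]: "S \<in> sets ?\<mu>" unfolding S_def using I by (rule sets_slice)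
  have W[measurable]: "W \<in> borel_measurable ?\<mu>" unfolding W_def using I by (rule measurable_tilt_weight) simp
  have A: "0 < A" unfolding A_def using tilt_mass_pos by (intro divide_pos_pos prod_pos) auto
  have S01: "t i \<in> {0..1}" if "t \<in> S" "i \<in> I" for t i
    using that by (auto simp: S_def slice_def)
  have "emeasure ?\<mu> S \<le> emeasure ?\<mu> (\<Pi>\<^sub>E i\<in>I. {0..1})"
    using I by (intro emeasure_mono sets_PiM_I_finite) (auto simp: S_def slice_def)
  also have "\<dots> = 1" using I by (subst lebPi.emeasure_PiM) auto
  finally have fin: "emeasure ?\<mu> S < \<infinity>"
    by (auto simp: order_le_less_trans)
  then have vol: "emeasure ?\<mu> S = ennreal vol"
    unfolding vol_def S_def[symmetric] by (simp add: emeasure_eq_ennreal_measure)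
  \<comment> \<open>With \<open>z\<close> the vector of eliminated coordinates, the exponent equals
    \<tau> \<bullet> Y - \<tau> \<bullet> z. Only the second term varies on the slice, and it is at
    most \<open>K\<close> in absolute value because the entries of \<open>z\<close> lie in
    [0,1].\<close>
  have Wbd: "ennreal (A * exp (- K)) \<le> W t \<and> W t \<le> ennreal (A * exp K)" if t: "t \<in> S" for t
  proof -
    define z where "z = Y - (\<Sum>i\<in>I. t i *\<^sub>R v i)"
    have z: "z $ l \<in> {0..1}" for l using t by (auto simp: S_def slice_def z_def)
    have "\<bar>\<tau> \<bullet> z\<bar> \<le> (\<Sum>l\<in>UNIV. \<bar>\<tau> $ l * z $ l\<bar>)"
      unfolding inner_vec_def by (simp add: sum_abs)
    also have "\<dots> \<le> K"
      unfolding K_def using z by (intro sum_mono) (auto simp: abs_mult mult_left_le)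
    finally have zK: "- K \<le> \<tau> \<bullet> z" "\<tau> \<bullet> z \<le> K" by auto
    have "W t = ennreal (\<Prod>i\<in>I. tilt_density (\<tau> \<bullet> v i) (t i))"
      unfolding W_def tilt_weight_def by (rule prod_ennreal) (rule tilt_density_nonneg)
    also have "(\<Prod>i\<in>I. tilt_density (\<tau> \<bullet> v i) (t i)) = (\<Prod>i\<in>I. exp ((\<tau> \<bullet> v i) * t i) / tilt_mass (\<tau> \<bullet> v i))"
      using S01[OF t] by (intro prod.cong) (auto simp: tilt_density_def)
    also have "\<dots> = exp (\<Sum>i\<in>I. (\<tau> \<bullet> v i) * t i) / (\<Prod>i\<in>I. tilt_mass (\<tau> \<bullet> v i))"
      using I by (simp add: prod_dividef exp_sum)
    also have "(\<Sum>i\<in>I. (\<tau> \<bullet> v i) * t i) = \<tau> \<bullet> Y - \<tau> \<bullet> z"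
      by (simp add: z_def inner_diff_right inner_sum_right mult.commute)
    also have "exp (\<tau> \<bullet> Y - \<tau> \<bullet> z) / (\<Prod>i\<in>I. tilt_mass (\<tau> \<bullet> v i)) = A * exp (- (\<tau> \<bullet> z))"
      by (simp add: A_def exp_diff exp_minus divide_inverse)
    finally show ?thesis using zK A by (simp add: ennreal_leI mult_left_mono)
  qed
  \<comment> \<open>The lower bound on weighted mass becomes a lower bound on volume; in particular
    the slice is not null.\<close>
  have "ennreal p \<le> (\<integral>\<^sup>+ t. ennreal (A * exp K) * indicator S t \<partial>?\<mu>)"
    using p(2) unfolding S_def[symmetric] W_def[symmetric]
    by (rule order_trans) (auto intro!: nn_integral_mono simp: indicator_def Wbd)
  also have "\<dots> = ennreal (A * exp K * vol)"
    using A by (subst nn_integral_cmult_indicator) (auto simp: vol ennreal_mult' vol_def)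
  finally have pvol: "p \<le> A * exp K * vol"
    using A by (simp add: ennreal_le_iff vol_def)
  with p A show volpos: "0 < vol"
    by (metis exp_gt_zero linorder_not_le mult_pos_pos order_less_le_trans zero_less_mult_pos)
  define u where "u i = (\<integral>t. indicator S t * t i \<partial>?\<mu>) / vol" for i
  \<comment> \<open>The signs are chosen so that the uniform mean of the linear statistic
    \<open>X\<close> over the slice is exactly \<open>c\<close>, that is \<open>h\<close> times the
    total absolute deviation. The bound by \<open>h\<close>, hence by 1, admits the sub-Gaussian
    estimate.\<close>
  define \<epsilon> where "\<epsilon> i = h * sgn (u i - sigma_fn (\<tau> \<bullet> v i))" for i
  define X where "X t = (\<Sum>i\<in>I. \<epsilon> i * (t i - sigma_fn (\<tau> \<bullet> v i)))" for t
  define c where "c = h * (\<Sum>i\<in>I. \<bar>u i - sigma_fn (\<tau> \<bullet> v i)\<bar>)"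
  have X[measurable]: "X \<in> borel_measurable ?\<mu>" unfolding X_def[abs_def] by measurable
  have \<epsilon>: "\<bar>\<epsilon> i\<bar> \<le> h" for i using h by (auto simp: \<epsilon>_def abs_mult sgn_if)
  have int1: "integrable ?\<mu> (indicator S :: _ \<Rightarrow> real)" using fin by simp
  have int_i: "integrable ?\<mu> (\<lambda>t. indicator S t * t i)" if "i \<in> I" for i
  proof (rule Bochner_Integration.integrable_bound[OF int1])
    show "(\<lambda>t. indicator S t * t i) \<in> borel_measurable ?\<mu>" using that by measurable
    show "AE t in ?\<mu>. norm (indicator S t * t i) \<le> norm (indicator S t :: real)"
      using S01[OF _ that] by (intro AE_I2) (auto simp: indicator_def)
  qed
  have Xeq: "indicator S t * X t = (\<Sum>i\<in>I. \<epsilon> i * (indicator S t * t i) - \<epsilon> i * sigma_fn (\<tau> \<bullet> v i) * indicator S t)" for t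
    unfolding X_def sum_distrib_left by (intro sum.cong) (auto simp: algebra_simps)
  have intX: "integrable ?\<mu> (\<lambda>t. indicator S t * X t)"
    unfolding Xeq by (intro Bochner_Integration.integrable_sum Bochner_Integration.integrable_diff integrable_mult_right int1 int_i)
  have "(\<integral>t. indicator S t * X t \<partial>?\<mu>) = (\<Sum>i\<in>I. \<epsilon> i * (vol * u i) - \<epsilon> i * sigma_fn (\<tau> \<bullet> v i) * vol)"
    unfolding Xeq using int_i int1 volpos
    by (subst Bochner_Integration.integral_sum) (auto simp: u_def vol_def S_def[symmetric] intro!: sum.cong)
  also have "\<dots> = (\<Sum>i\<in>I. vol * (h * \<bar>u i - sigma_fn (\<tau> \<bullet> v i)\<bar>))"
    by (intro sum.cong refl) (simp add: \<epsilon>_def abs_sgn algebra_simps)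
  also have "\<dots> = c * vol" by (simp add: c_def sum_distrib_left mult_ac)
  finally have EX: "(\<integral>t. indicator S t * X t \<partial>?\<mu>) = c * vol" .
  define B where "B = exp K / A * exp (card I * h^2)"
  have B: "0 < B" using A by (simp add: B_def)
  have expX: "(\<integral>\<^sup>+ t. ennreal (indicator S t * exp (X t)) \<partial>?\<mu>) \<le> ennreal B"
  proof -
    have "(\<integral>\<^sup>+ t. ennreal (indicator S t * exp (X t)) \<partial>?\<mu>) \<le> (\<integral>\<^sup>+ t. ennreal (exp K / A) * (ennreal (exp (X t)) * W t) \<partial>?\<mu>)"
    proof (rule nn_integral_mono)
      fix t
      show "ennreal (indicator S t * exp (X t)) \<le> ennreal (exp K / A) * (ennreal (exp (X t)) * W t)"
      proof (cases "t \<in> S")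
        case True
        have "ennreal (exp (X t)) = ennreal (exp K / A) * (ennreal (exp (X t)) * ennreal (A * exp (- K)))"
          using A by (simp add: exp_minus flip: ennreal_mult')
        also have "\<dots> \<le> ennreal (exp K / A) * (ennreal (exp (X t)) * W t)"
          using Wbd[OF True] by (intro mult_left_mono) auto
        finally show ?thesis using True by simp
      qed simp
    qed
    also have "\<dots> = ennreal (exp K / A) * (\<integral>\<^sup>+ t. ennreal (exp (X t)) * W t \<partial>?\<mu>)"
      by (rule nn_integral_cmult) measurable
    also have "\<dots> \<le> ennreal (exp K / A) * ennreal (exp (\<Sum>i\<in>I. (\<epsilon> i)^2))"
      unfolding X_def W_def using \<epsilon> h by (intro mult_left_mono tilt_weight_mgf I) (auto intro: order_trans)
    also have "\<dots> \<le> ennreal (exp K / A) * ennreal (exp (card I * h^2))"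
    proof (intro mult_left_mono ennreal_leI)
      have "(\<epsilon> i)^2 \<le> h^2" for i using \<epsilon>[of i] h abs_le_square_iff[of "\<epsilon> i" h] by simp
      then have "(\<Sum>i\<in>I. (\<epsilon> i)^2) \<le> (\<Sum>i\<in>I. h^2)" by (intro sum_mono)
      then show "exp (\<Sum>i\<in>I. (\<epsilon> i)^2) \<le> exp (card I * h^2)" by simp
    qed simp
    also have "\<dots> = ennreal B" using A by (simp add: B_def flip: ennreal_mult')
    finally show ?thesis .
  qed
  have intE: "integrable ?\<mu> (\<lambda>t. indicator S t * exp (X t))"
  proof (rule integrableI_nonneg)
    show "(\<integral>\<^sup>+ t. ennreal (indicator S t * exp (X t)) \<partial>?\<mu>) < \<infinity>"
      using expX by (rule order_le_less_trans) simp
  qed auto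
  have "exp c * vol = (\<integral>t. exp c * ((1 - c) * indicator S t + indicator S t * X t) \<partial>?\<mu>)"
    using int1 intX by (simp add: EX vol_def S_def[symmetric]) (simp add: algebra_simps)
  also have "\<dots> \<le> (\<integral>t. indicator S t * exp (X t) \<partial>?\<mu>)"
  proof (rule integral_mono)
    fix t
    have "1 + (X t - c) \<le> exp (X t - c)" by (rule exp_ge_add_one_self)
    then have "exp c * (1 + (X t - c)) \<le> exp c * exp (X t - c)" by (intro mult_left_mono) auto
    then show "exp c * ((1 - c) * indicator S t + indicator S t * X t) \<le> indicator S t * exp (X t)"
      by (simp add: indicator_def algebra_simps flip: exp_add)
  qed (use int1 intX intE in auto)
  also have "\<dots> = enn2real (\<integral>\<^sup>+ t. ennreal (indicator S t * exp (X t)) \<partial>?\<mu>)"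
    by (intro integral_eq_nn_integral) auto
  also have "\<dots> \<le> B" using expX B by (intro enn2real_leI) auto
  finally have "exp c * vol \<le> B" .
  \<comment> \<open>The constant \<open>A\<close>, about which nothing is known but positivity,
    cancels between the lower bound on \<open>vol\<close> and the upper bound on
    \<open>exp c * vol\<close>. Each of them costs one factor \<open>exp K\<close>.\<close>
  have "p * exp c \<le> A * exp K * vol * exp c" using pvol by (intro mult_right_mono) auto
  also have "\<dots> = A * exp K * (exp c * vol)" by simp
  also have "\<dots> \<le> A * exp K * B" using \<open>exp c * vol \<le> B\<close> A by (intro mult_left_mono) auto
  also have "\<dots> = exp (2 * K + card I * h^2)" using A by (simp add: B_def mult_exp_exp)
  finally have "ln (p * exp c) \<le> ln (exp (2 * K + card I * h^2))" using p(1) by (subst ln_le_cancel_iff) auto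
  then have "ln p + c \<le> 2 * K + card I * h^2" using p(1) by (simp add: ln_mult)
  then show "h * (\<Sum>i\<in>I. \<bar>(\<integral>t. indicator (slice I v Y) t * t i \<partial>lebPi I) / vol - sigma_fn (\<tau> \<bullet> v i)\<bar>)
      \<le> 2 * (\<Sum>l\<in>UNIV. \<bar>\<tau> $ l\<bar>) + card I * h^2 - ln p"
    by (simp add: c_def u_def S_def K_def)
qed

text \<open>Each direction gets \<open>M\<close> of its unit-vector coordinates for steering; the
  others fluctuate by at most \<open>r\<close>, of order sqrt n, with weight at least 1/2. What then
  remains to be supplied in direction \<open>l\<close> is \<open>M * sigma_fn (\<tau> $ l)\<close>
  up to an error \<open>B + r\<close>. As \<open>sigma_fn (\<tau> $ l)\<close> keeps distance
  \<kappa> from 0 and 1, the condition on \<open>M * \<kappa>\<close> places this amount between 1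
  and \<open>M\<close>. The price is a factor \<open>exp (- 2 * K) / M\<close> for each steering
  coordinate.\<close>

lemma slice_mass_lower_bound:
  fixes v :: "'i \<Rightarrow> real ^ 'm" and \<tau> :: "real ^ 'm" and C B \<kappa> K :: real
  assumes I: "finite I" "card I \<le> n" and n: "1 \<le> n" and C: "1 \<le> C"
    and v: "\<And>i l. i \<in> I \<Longrightarrow> \<bar>v i $ l\<bar> \<le> C"
    and M: "1 \<le> M" "\<And>l. M \<le> card {i \<in> I. v i = axis l 1}"
    and B: "\<And>l. \<bar>((\<Sum>i\<in>I. sigma_fn (\<tau> \<bullet> v i) *\<^sub>R v i) - Y) $ l\<bar> \<le> B"
    and \<kappa>: "\<And>l. \<kappa> \<le> sigma_fn (\<tau> $ l) \<and> sigma_fn (\<tau> $ l) \<le> 1 - \<kappa>"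
    and M\<kappa>: "B + 1 + C * (1 + ln (4 * real CARD('m))) * sqrt n \<le> M * \<kappa>"
    and K: "K = (\<Sum>l\<in>UNIV. \<bar>\<tau> $ l\<bar>)"
  shows "ennreal (1 / 2 * (exp (- 2 * K) / M) ^ (CARD('m) * M)) \<le>
    (\<integral>\<^sup>+ t. indicator (slice I v Y) t * tilt_weight (\<lambda>i. \<tau> \<bullet> v i) I t \<partial>lebPi I)"
proof -
  define r where "r = C * (1 + ln (4 * real CARD('m))) * sqrt n"
  have "\<forall>l. \<exists>R. R \<subseteq> {i \<in> I. v i = axis l 1} \<and> card R = M"
  proof
    fix l
    obtain T where "T \<subseteq> {i \<in> I. v i = axis l 1}" "card T = M"
      using obtain_subset_with_card_n[OF M(2)[of l]] by auto
    then show "\<exists>R. R \<subseteq> {i \<in> I. v i = axis l 1} \<and> card R = M" by (intro exI[of _ T] conjI)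
  qed
  then obtain Q where Q': "\<forall>l. Q l \<subseteq> {i \<in> I. v i = axis l 1} \<and> card (Q l) = M"
    by (rule choice[THEN exE])
  then have Q: "\<And>l. Q l \<subseteq> {i \<in> I. v i = axis l 1}" "\<And>l. card (Q l) = M" by simp_all
  define R where "R = (\<Union>l. Q l)"
  define J where "J = I - R"
  define lab where "lab i = (SOME l. v i = axis l 1)" for i
  have axis_inj: "axis l (1::real) = (axis k 1 :: real ^ 'm) \<longleftrightarrow> l = k" for l k
    by (simp add: axis_eq_axis)
  have labQ: "lab i = l" if "i \<in> Q l" for i l
  proof -
    have "v i = axis l 1" using Q(1) that by blast
    then show ?thesis unfolding lab_def by (intro some_equality) (auto simp: axis_inj)
  qed
  have RI: "R \<subseteq> I" using Q(1) by (auto simp: R_def)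
  have IJR: "I = J \<union> R" "J \<inter> R = {}" "finite J" "finite R"
    using RI I(1) finite_subset[OF RI I(1)] by (auto simp: J_def)
  have vR: "v i = axis (lab i) 1" if i: "i \<in> R" for i
  proof -
    obtain l where l: "i \<in> Q l" using i by (auto simp: R_def)
    then have "v i = axis l 1" using Q(1)[of l] by blast
    then show ?thesis by (simp add: labQ[OF l])
  qed
  have Rl: "{i \<in> R. lab i = l} = Q l" for l
    unfolding R_def using labQ by blast
  have cardR: "card R = CARD('m) * M"
  proof -
    have "card R = (\<Sum>l\<in>UNIV. card (Q l))"
      unfolding R_def
    proof (rule card_UN_disjoint)
      show "\<forall>l\<in>UNIV. finite (Q l)" using IJR(4) by (auto simp: R_def)
      show "\<forall>l\<in>UNIV. \<forall>k\<in>UNIV. l \<noteq> k \<longrightarrow> Q l \<inter> Q k = {}" using labQ by blast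
    qed simp
    then show ?thesis by (simp add: Q)
  qed
  have sR: "\<bar>\<tau> \<bullet> v i\<bar> \<le> K" if "i \<in> R" for i
    unfolding vR[OF that] K using member_le_sum[of "lab i" UNIV "\<lambda>l. \<bar>\<tau> $ l\<bar>"]
    by (simp add: inner_axis)
  define good where "good x \<longleftrightarrow> (\<forall>l. \<bar>\<Sum>i\<in>J. (x i - sigma_fn (\<tau> \<bullet> v i)) * v i $ l\<bar> \<le> r)" for x :: "'i \<Rightarrow> real"
  have meas: "Measurable.pred (lebPi J) good"
    unfolding good_def[abs_def] by measurable
  have half: "ennreal (1 / 2) \<le> (\<integral>\<^sup>+ x. indicator {x. good x} x * tilt_weight (\<lambda>i. \<tau> \<bullet> v i) J x \<partial>lebPi J)"
    unfolding good_def r_def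
  proof (rule tilt_weight_concentration)
    have "card J \<le> card I" unfolding J_def by (rule card_mono[OF I(1)]) auto
    then show "card J \<le> n" using I(2) by simp
    show "\<bar>v i $ l\<bar> \<le> C" if "i \<in> J" for i l using that v by (auto simp: J_def)
  qed (use IJR(3) n C in auto)
  have bound: "Y $ l - (\<Sum>i\<in>J. x i * v i $ l) \<in> {1..real M}" if g: "good x" for x l
  proof -
    have sumR: "(\<Sum>i\<in>R. sigma_fn (\<tau> \<bullet> v i) * v i $ l) = M * sigma_fn (\<tau> $ l)"
    proof -
      have "sigma_fn (\<tau> \<bullet> v i) * v i $ l = (if lab i = l then sigma_fn (\<tau> $ l) else 0)" if "i \<in> R" for i
        unfolding vR[OF that] inner_axis by (auto simp: axis_def)
      then have "(\<Sum>i\<in>R. sigma_fn (\<tau> \<bullet> v i) * v i $ l) = (\<Sum>i\<in>{i\<in>R. lab i = l}. sigma_fn (\<tau> $ l))"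
        using IJR(4) by (subst sum.inter_filter) (auto intro!: sum.cong)
      then show ?thesis by (simp add: Rl Q)
    qed
    have "\<bar>(\<Sum>i\<in>J. sigma_fn (\<tau> \<bullet> v i) * v i $ l) + M * sigma_fn (\<tau> $ l) - Y $ l\<bar> \<le> B"
      using B[of l] unfolding IJR(1) using IJR(2-4) by (simp add: sum.union_disjoint sumR)
    moreover have "\<bar>(\<Sum>i\<in>J. x i * v i $ l) - (\<Sum>i\<in>J. sigma_fn (\<tau> \<bullet> v i) * v i $ l)\<bar> \<le> r"
      using g by (simp add: good_def left_diff_distrib sum_subtractf)
    moreover have "M * \<kappa> \<le> M * sigma_fn (\<tau> $ l)"
      using \<kappa>[of l] by (intro mult_left_mono) auto
    moreover have "M * sigma_fn (\<tau> $ l) \<le> M - M * \<kappa>"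
      using \<kappa>[of l] mult_left_mono[of "sigma_fn (\<tau> $ l)" "1 - \<kappa>" "real M"] by (simp add: algebra_simps)
    moreover have "B + 1 + r \<le> M * \<kappa>" using M\<kappa> by (simp add: r_def)
    ultimately have "1 \<le> Y $ l - (\<Sum>i\<in>J. x i * v i $ l)" "Y $ l - (\<Sum>i\<in>J. x i * v i $ l) \<le> M"
      by linarith+
    then show ?thesis by simp
  qed
  have "ennreal (1 / 2) * ennreal ((exp (- 2 * K) / M) ^ card R) \<le>
      (\<integral>\<^sup>+ t. indicator (slice I v Y) t * tilt_weight (\<lambda>i. \<tau> \<bullet> v i) I t \<partial>lebPi I)"
    unfolding IJR(1)
    by (rule steering_mass[OF IJR(3,4,2) vR _ M(1) sR meas half bound]) (simp_all add: Rl Q)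
  moreover have "ennreal (1 / 2) * ennreal ((exp (- 2 * K) / M) ^ card R) = ennreal (1 / 2 * (exp (- 2 * K) / M) ^ card R)"
    by (rule ennreal_mult'[symmetric]) simp
  ultimately show ?thesis by (simp only: cardR)
qed

text \<open>The threshold has to be uniform in the index set, the vectors and the right-hand side,
  since all of these change with the profile space. With \<open>M\<close> of order sqrt n, minus the
  logarithm of the mass is of order sqrt n * ln n.\<close>

lemma slice_asymptotics:
  fixes \<tau> :: "real ^ 'm" and C B \<rho> \<epsilon> :: real
  assumes C: "1 \<le> C" and B: "0 \<le> B" and \<rho>: "0 < \<rho>" and \<epsilon>: "0 < \<epsilon>"
  shows "\<exists>N. \<forall>n\<ge>N. \<forall>(I :: nat set) v Y. finite I \<longrightarrow> card I \<le> n \<longrightarrow>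
    (\<forall>i\<in>I. \<forall>l. \<bar>v i $ l\<bar> \<le> C) \<longrightarrow> (\<forall>l. \<rho> * n \<le> card {i \<in> I. v i = axis l 1}) \<longrightarrow>
    (\<forall>l. \<bar>((\<Sum>i\<in>I. sigma_fn (\<tau> \<bullet> v i) *\<^sub>R v i) - Y) $ l\<bar> \<le> B) \<longrightarrow>
    0 < measure (lebPi I) (slice I v Y) \<and>
    (\<Sum>i\<in>I. \<bar>(\<integral>t. indicator (slice I v Y) t * t i \<partial>lebPi I) / measure (lebPi I) (slice I v Y)
        - sigma_fn (\<tau> \<bullet> v i)\<bar>) \<le> \<epsilon> * n"
proof -
  define K where "K = (\<Sum>l\<in>UNIV. \<bar>\<tau> $ l\<bar>)"
  define r where "r = C * (1 + ln (4 * real CARD('m)))"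
  define \<kappa> where "\<kappa> = Min (range (\<lambda>l. min (sigma_fn (\<tau> $ l)) (1 - sigma_fn (\<tau> $ l))))"
  have \<kappa>: "0 < \<kappa>"
    unfolding \<kappa>_def using sigma_fn_bounds by (subst Min_gr_iff) auto
  have \<kappa>l: "\<kappa> \<le> sigma_fn (\<tau> $ l) \<and> sigma_fn (\<tau> $ l) \<le> 1 - \<kappa>" for l
  proof -
    have "\<kappa> \<le> min (sigma_fn (\<tau> $ l)) (1 - sigma_fn (\<tau> $ l))"
      unfolding \<kappa>_def by (intro Min_le) auto
    then show ?thesis by simp
  qed
  \<comment> \<open>A closed form dominating the integer \<open>M\<close> chosen below; the final 1
    absorbs the rounding up.\<close>
  define \<mu> where "\<mu> n = (B + 1 + r * sqrt n) / \<kappa> + 1" for n :: nat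
  \<comment> \<open>With h \<le> \<epsilon>/2, the quadratic cost \<open>n * h^2\<close> uses half
    of the allowance \<open>h * \<epsilon> * n\<close>; the other half is left for the logarithm of
    the mass and the constants.\<close>
  define h where "h = min 1 (\<epsilon> / 2)"
  have h: "0 < h" "h \<le> 1" "h \<le> \<epsilon> / 2" using \<epsilon> by (auto simp: h_def)
  have "1 \<le> real CARD('m)" by simp
  then have "0 \<le> ln (4 * real CARD('m))" by (intro ln_ge_zero) linarith
  then have r: "0 < r" unfolding r_def using C by (intro mult_pos_pos add_pos_nonneg) auto
  define m where "m = real CARD('m)"
  have m: "0 < m" by (simp add: m_def)
  \<comment> \<open>Sublinear growth guarantees that the at least \<open>\<rho> * n\<close>
    unit-vector coordinates of each direction suffice for steering.\<close>
  have "((\<lambda>n. \<mu> n / n) \<longlongrightarrow> 0) at_top"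
    unfolding \<mu>_def using r B \<kappa> by real_asymp
  then have ev1: "eventually (\<lambda>n. \<mu> n / n < \<rho>) at_top" using \<rho> by (rule order_tendstoD)
  have "((\<lambda>n. (2 * K + ln 2 + m * \<mu> n * (2 * K + ln (\<mu> n))) / n) \<longlongrightarrow> 0) at_top"
  proof -
    define a b where "a = r / \<kappa>" and "b = (B + 1) / \<kappa> + 1"
    have "0 < a" "0 < b" using r B \<kappa> by (auto simp: a_def b_def intro!: add_nonneg_pos)
    then have "((\<lambda>n. (2 * K + ln 2 + m * (a * sqrt (real n) + b) * (2 * K + ln (a * sqrt (real n) + b))) / n) \<longlongrightarrow> 0) at_top"
      using m by real_asymp
    moreover have "\<mu> n = a * sqrt n + b" for n
      by (simp add: \<mu>_def a_def b_def add_divide_distrib)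
    ultimately show ?thesis by simp
  qed
  then have ev2: "eventually (\<lambda>n. (2 * K + ln 2 + m * \<mu> n * (2 * K + ln (\<mu> n))) / n < h * \<epsilon> / 2) at_top"
    using h \<epsilon> by (intro order_tendstoD) auto
  obtain N0 where N0: "\<And>n. n \<ge> N0 \<Longrightarrow> \<mu> n / n < \<rho> \<and> (2 * K + ln 2 + m * \<mu> n * (2 * K + ln (\<mu> n))) / n < h * \<epsilon> / 2"
    using eventually_conj[OF ev1 ev2] by (auto simp: eventually_at_top_linorder)
  show ?thesis
  proof (intro exI[of _ "max N0 1"] allI impI)
    fix n :: nat and I :: "nat set" and v :: "nat \<Rightarrow> real ^ 'm" and Y :: "real ^ 'm"
    assume n: "n \<ge> max N0 1" and I: "finite I" "card I \<le> n"
      and v: "\<forall>i\<in>I. \<forall>l. \<bar>v i $ l\<bar> \<le> C" and \<rho>n: "\<forall>l. \<rho> * n \<le> card {i \<in> I. v i = axis l 1}"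
      and Bl: "\<forall>l. \<bar>((\<Sum>i\<in>I. sigma_fn (\<tau> \<bullet> v i) *\<^sub>R v i) - Y) $ l\<bar> \<le> B"
    define M where "M = nat \<lceil>(B + 1 + r * sqrt n) / \<kappa>\<rceil>"
    have pos: "0 < (B + 1 + r * sqrt n) / \<kappa>" using B r \<kappa> by (simp add: add_pos_nonneg)
    have M: "(B + 1 + r * sqrt n) / \<kappa> \<le> M" "M \<le> \<mu> n" "1 \<le> M"
      using pos unfolding M_def \<mu>_def by linarith+
    have n1: "1 \<le> n" "0 < real n" using n by auto
    have asym: "\<mu> n \<le> \<rho> * n" "2 * K + ln 2 + m * \<mu> n * (2 * K + ln (\<mu> n)) \<le> h * \<epsilon> / 2 * n"
      using N0[of n] n n1(2) by (simp_all add: divide_less_eq)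
    have Mcard: "M \<le> card {i \<in> I. v i = axis l 1}" for l
    proof -
      have "real M \<le> card {i \<in> I. v i = axis l 1}" using M(2) asym(1) \<rho>n by (meson order_trans)
      then show ?thesis by simp
    qed
    define p where "p = 1 / 2 * (exp (- 2 * K) / M) ^ (CARD('m) * M)"
    have p: "0 < p" using M(3) by (simp add: p_def)
    have mass: "ennreal p \<le> (\<integral>\<^sup>+ t. indicator (slice I v Y) t * tilt_weight (\<lambda>i. \<tau> \<bullet> v i) I t \<partial>lebPi I)"
      unfolding p_def
    proof (rule slice_mass_lower_bound[OF I n1(1) C _ M(3) Mcard _ \<kappa>l _ K_def])
      show "B + 1 + C * (1 + ln (4 * real CARD('m))) * sqrt n \<le> M * \<kappa>"
        using M(1) \<kappa> by (simp add: r_def pos_divide_le_eq)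
    qed (use v Bl in auto)
    have lnp: "- ln p = ln 2 + m * M * (2 * K + ln M)"
    proof -
      have "ln (exp (- 2 * K) / M) = - (2 * K + ln M)" using M(3) by (subst ln_div) auto
      then have "ln ((exp (- 2 * K) / M) ^ (CARD('m) * M)) = real (CARD('m) * M) * (- (2 * K + ln M))"
        using M(3) by (subst ln_realpow) auto
      moreover have "ln p = ln (1/2) + ln ((exp (- 2 * K) / M) ^ (CARD('m) * M))"
        unfolding p_def using M(3) by (intro ln_mult_pos) auto
      moreover have "ln (1/2 :: real) = - ln 2" by (simp add: ln_div)
      ultimately show ?thesis by (simp add: m_def algebra_simps)
    qed
    have K0: "0 \<le> K" by (simp add: K_def sum_nonneg)
    have "m * M * (2 * K + ln M) \<le> m * \<mu> n * (2 * K + ln (\<mu> n))"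
      using M m K0 by (intro mult_mono add_mono) auto
    then have lnp_le: "- ln p \<le> ln 2 + m * \<mu> n * (2 * K + ln (\<mu> n))" using lnp by simp
    note dev = slice_mean_deviation[OF I(1) p mass h(1,2)]
    let ?D = "\<Sum>i\<in>I. \<bar>(\<integral>t. indicator (slice I v Y) t * t i \<partial>lebPi I) / measure (lebPi I) (slice I v Y)
        - sigma_fn (\<tau> \<bullet> v i)\<bar>"
    have "h * ?D \<le> 2 * K + card I * h^2 - ln p"
      using dev(2) by (simp add: K_def)
    also have "\<dots> \<le> 2 * K + n * h^2 + (ln 2 + m * \<mu> n * (2 * K + ln (\<mu> n)))"
    proof -
      have "card I * h^2 \<le> n * h^2" using I(2) by (intro mult_right_mono) auto
      then show ?thesis using lnp_le by linarith
    qed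
    also have "\<dots> \<le> n * h^2 + h * \<epsilon> / 2 * n" using asym(2) by simp
    also have "\<dots> \<le> n * (h * (\<epsilon> / 2)) + h * \<epsilon> / 2 * n"
      unfolding power2_eq_square using h by (intro add_right_mono mult_left_mono) auto
    also have "\<dots> = h * (\<epsilon> * n)" by (simp add: field_simps)
    finally have "?D \<le> \<epsilon> * n" using h(1) by simp
    then show "0 < measure (lebPi I) (slice I v Y) \<and> ?D \<le> \<epsilon> * n" using dev(1) by simp
  qed
qed

section \<open>Independence of Lebesgue measure from the affine chart\<close>

lemma nn_integral_lebPi_translate:
  fixes a :: "'i \<Rightarrow> real"
  assumes I: "finite I" and f: "f \<in> borel_measurable (lebPi I)"
  shows "(\<integral>\<^sup>+ t. f (\<lambda>i\<in>I. a i + t i) \<partial>lebPi I) = (\<integral>\<^sup>+ t. f t \<partial>lebPi I)"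
proof -
  let ?T = "\<lambda>t. \<lambda>i\<in>I. a i + t i"
  have T[measurable]: "?T \<in> lebPi I \<rightarrow>\<^sub>M lebPi I" by measurable
  have "distr (lebPi I) (lebPi I) ?T = lebPi I"
  proof (rule lebPi.PiM_eqI[OF I])
    fix A :: "'i \<Rightarrow> real set" assume A: "\<And>i. i \<in> I \<Longrightarrow> A i \<in> sets lborel"
    have "?T -` (Pi\<^sub>E I A) \<inter> space (lebPi I) = (\<Pi>\<^sub>E i\<in>I. (+) (a i) -` A i)"
      by (auto simp: space_PiM PiE_iff)
    moreover have "Pi\<^sub>E I A \<in> sets (lebPi I)" using I A by (intro sets_PiM_I_finite) auto
    ultimately have "emeasure (distr (lebPi I) (lebPi I) ?T) (Pi\<^sub>E I A) = emeasure (lebPi I) (\<Pi>\<^sub>E i\<in>I. (+) (a i) -` A i)"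
      by (subst emeasure_distr) auto
    also have "\<dots> = (\<Prod>i\<in>I. emeasure lborel ((+) (a i) -` A i))"
    proof (rule lebPi.emeasure_PiM[OF I])
      show "(+) (a i) -` A i \<in> sets lborel" if "i \<in> I" for i
        using measurable_sets[of "(+) (a i)" borel borel "A i"] A[OF that] by simp
    qed
    also have "\<dots> = (\<Prod>i\<in>I. emeasure lborel (A i))"
    proof (rule prod.cong[OF refl])
      fix i assume "i \<in> I"
      have "emeasure lborel (A i) = emeasure (distr lborel borel ((+) (a i))) (A i)"
        by (simp add: lborel_distr_plus)
      also have "\<dots> = emeasure lborel ((+) (a i) -` A i)"
        using A[OF \<open>i \<in> I\<close>] by (subst emeasure_distr) auto
      finally show "emeasure lborel ((+) (a i) -` A i) = emeasure lborel (A i)" by simp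
    qed
    finally show "emeasure (distr (lebPi I) (lebPi I) ?T) (Pi\<^sub>E I A) = (\<Prod>i\<in>I. emeasure lborel (A i))" .
  qed simp
  then have "(\<integral>\<^sup>+ t. f t \<partial>lebPi I) = (\<integral>\<^sup>+ t. f t \<partial>distr (lebPi I) (lebPi I) ?T)" by simp
  also have "\<dots> = (\<integral>\<^sup>+ t. f (?T t) \<partial>lebPi I)" using f by (intro nn_integral_distr) auto
  finally show ?thesis by simp
qed

lemma span_frameE:
  assumes "inj_on b {..<k::nat}" "w \<in> span (b ` {..<k})"
  obtains a where "w = (\<Sum>i<k. a i *\<^sub>R b i)"
proof -
  from assms(2) obtain u where "w = (\<Sum>v\<in>b ` {..<k}. u v *\<^sub>R v)"
    by (auto simp: span_finite)
  then have "w = (\<Sum>i<k. u (b i) *\<^sub>R b i)" using assms(1) by (simp add: sum.reindex)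
  then show ?thesis by (rule that)
qed

lemma span_frameI: "(\<Sum>i<k::nat. a i *\<^sub>R b i) \<in> span (b ` {..<k})"
  by (intro span_sum span_scale span_base) auto

lemma measurable_affine_chart [measurable]:
  fixes p :: "'a::{real_normed_vector, second_countable_topology}"
  shows "affine_chart k p b \<in> borel_measurable (lebPi {..<k})"
  unfolding affine_chart_def[abs_def] by measurable

text \<open>A translation along the direction space shifts the coefficient vector, under which
  Lebesgue measure is invariant. The comparison of two charts rests on this invariance.\<close>

lemma nn_integral_chart_translate:
  fixes p :: "'a::{real_normed_vector, second_countable_topology}"
  assumes b: "inj_on b {..<k}" and w: "w \<in> span (b ` {..<k})" and f[measurable]: "f \<in> borel_measurable borel"
  shows "(\<integral>\<^sup>+ t. f (affine_chart k p b t + w) \<partial>lebPi {..<k}) = (\<integral>\<^sup>+ t. f (affine_chart k p b t) \<partial>lebPi {..<k})"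
proof -
  obtain a where a: "w = (\<Sum>i<k. a i *\<^sub>R b i)" using span_frameE[OF b w] .
  have "affine_chart k p b (\<lambda>i\<in>{..<k}. a i + t i) = affine_chart k p b t + w" for t
    by (simp add: affine_chart_def a scaleR_add_left sum.distrib)
  then show ?thesis
    using nn_integral_lebPi_translate[of "{..<k}" "\<lambda>t. f (affine_chart k p b t)" a] by simp
qed

text \<open>The usual uniqueness argument for Haar measure: one application of Fubini's theorem and three
  translations.\<close>

lemma nn_integral_chart_product:
  fixes p :: "'a::{real_normed_vector, second_countable_topology}"
  assumes F1: "affine_frame F k p b" and F2: "affine_frame F k' p' b'"
    and f[measurable]: "f \<in> borel_measurable borel" and g[measurable]: "g \<in> borel_measurable borel"
  shows "(\<integral>\<^sup>+ s. f (affine_chart k p b s) \<partial>lebPi {..<k}) * (\<integral>\<^sup>+ t. g (affine_chart k' p' b' t) \<partial>lebPi {..<k'}) =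
    (\<integral>\<^sup>+ s. g (p + p' - affine_chart k p b s) \<partial>lebPi {..<k}) * (\<integral>\<^sup>+ t. f (affine_chart k' p' b' t) \<partial>lebPi {..<k'})"
proof -
  let ?c = "affine_chart k p b" and ?c' = "affine_chart k' p' b'"
  let ?M = "lebPi {..<k}" and ?M' = "lebPi {..<k'}"
  define L where "L = (\<lambda>s. \<Sum>i<k. s i *\<^sub>R b i)"
  define L' where "L' = (\<lambda>s. \<Sum>i<k'. s i *\<^sub>R b' i)"
  have [measurable]: "L \<in> borel_measurable ?M" "L' \<in> borel_measurable ?M'"
    unfolding L_def L'_def by measurable
  interpret M: sigma_finite_measure ?M by (rule lebPi.sigma_finite) simp
  interpret M': sigma_finite_measure ?M' by (rule lebPi.sigma_finite) simp
  interpret MM: pair_sigma_finite ?M ?M' ..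
  have c: "?c s = p + L s" "?c' t = p' + L' t" for s t by (simp_all add: affine_chart_def L_def L'_def)
  have inj: "inj_on b {..<k}" "inj_on b' {..<k'}" using F1 F2 by (auto simp: affine_frame_def)
  have FF: "(+) p ` span (b ` {..<k}) = (+) p' ` span (b' ` {..<k'})"
    using F1 F2 by (simp add: affine_frame_def)
  have "p \<in> (+) p ` span (b ` {..<k})" using span_zero image_iff by fastforce
  then obtain w where w: "w \<in> span (b' ` {..<k'})" "p = p' + w" unfolding FF by auto
  have sub1: "x \<in> span (b' ` {..<k'})" if "x \<in> span (b ` {..<k})" for x
  proof -
    have "p + x \<in> (+) p' ` span (b' ` {..<k'})" using that unfolding FF[symmetric] by blast
    then obtain y where "y \<in> span (b' ` {..<k'})" "p + x = p' + y" by auto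
    then have "x = y - w" using w by (simp add: algebra_simps)
    then show ?thesis using \<open>y \<in> _\<close> w span_diff by blast
  qed
  have sub2: "x \<in> span (b ` {..<k})" if "x \<in> span (b' ` {..<k'})" for x
  proof -
    have "p' + (w + x) \<in> (+) p ` span (b ` {..<k})" using that w(1) span_add unfolding FF by blast
    then obtain y where "y \<in> span (b ` {..<k})" "p' + (w + x) = p + y" by auto
    then show ?thesis using w(2) by (simp add: algebra_simps)
  qed
  have LW: "L s \<in> span (b ` {..<k})" "L s \<in> span (b' ` {..<k'})" for s
    using span_frameI[where a = s and b = b and k = k] sub1 unfolding L_def by blast+
  have LW': "L' s \<in> span (b ` {..<k})" "L' s \<in> span (b' ` {..<k'})" for s
    using span_frameI[where a = s and b = b' and k = k'] sub2 unfolding L'_def by blast+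
  have "(\<integral>\<^sup>+ s. f (?c s) \<partial>?M) * (\<integral>\<^sup>+ t. g (?c' t) \<partial>?M') = (\<integral>\<^sup>+ s. f (?c s) * (\<integral>\<^sup>+ t. g (?c' t) \<partial>?M') \<partial>?M)"
    by (rule nn_integral_multc[symmetric]) measurable
  also have "\<dots> = (\<integral>\<^sup>+ s. f (?c s) * (\<integral>\<^sup>+ t. g (?c' t + - L s) \<partial>?M') \<partial>?M)"
    by (intro nn_integral_cong arg_cong2[where f = "(*)"] refl
        nn_integral_chart_translate[OF inj(2) span_neg[OF LW(2)] g, symmetric])
  also have "\<dots> = (\<integral>\<^sup>+ s. \<integral>\<^sup>+ t. f (?c s) * g (?c' t - L s) \<partial>?M' \<partial>?M)"
    by (intro nn_integral_cong, subst nn_integral_cmult) (simp_all, measurable)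
  also have "\<dots> = (\<integral>\<^sup>+ t. \<integral>\<^sup>+ s. f (?c s) * g (?c' t - L s) \<partial>?M \<partial>?M')"
    by (rule MM.Fubini'[symmetric]) measurable
  \<comment> \<open>Shifting \<open>s\<close> by \<open>L' t\<close> removes \<open>t\<close> from
    the argument of \<open>g\<close>, so that after exchanging the integrals again only
    \<open>f\<close> depends on \<open>t\<close>.\<close>
  also have "\<dots> = (\<integral>\<^sup>+ t. \<integral>\<^sup>+ s. f (?c s + L' t) * g (p + p' - ?c s) \<partial>?M \<partial>?M')"
  proof (rule nn_integral_cong)
    fix t
    have "(\<integral>\<^sup>+ s. (\<lambda>x. f x * g (?c' t + p - x)) (?c s + L' t) \<partial>?M) = (\<integral>\<^sup>+ s. (\<lambda>x. f x * g (?c' t + p - x)) (?c s) \<partial>?M)"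
      by (rule nn_integral_chart_translate[OF inj(1) LW'(1)]) measurable
    then show "(\<integral>\<^sup>+ s. f (?c s) * g (?c' t - L s) \<partial>?M) = (\<integral>\<^sup>+ s. f (?c s + L' t) * g (p + p' - ?c s) \<partial>?M)"
      by (simp add: c algebra_simps)
  qed
  also have "\<dots> = (\<integral>\<^sup>+ s. \<integral>\<^sup>+ t. f (?c s + L' t) * g (p + p' - ?c s) \<partial>?M' \<partial>?M)"
    by (rule MM.Fubini') measurable
  \<comment> \<open>For fixed \<open>s\<close> the argument of \<open>f\<close> is the second chart
    translated by \<open>w + L s\<close>, a vector of the common direction space; the inner integral
    is therefore the same for every \<open>s\<close>.\<close>
  also have "\<dots> = (\<integral>\<^sup>+ s. g (p + p' - ?c s) * (\<integral>\<^sup>+ t. f (?c' t) \<partial>?M') \<partial>?M)"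
  proof (rule nn_integral_cong)
    fix s
    have "(\<integral>\<^sup>+ t. f (?c' t + (w + L s)) \<partial>?M') = (\<integral>\<^sup>+ t. f (?c' t) \<partial>?M')"
      by (rule nn_integral_chart_translate[OF inj(2) span_add[OF w(1) LW(2)] f])
    moreover have "?c' t + (w + L s) = ?c s + L' t" for t
      unfolding c by (subst w(2)) (simp add: algebra_simps)
    ultimately have "(\<integral>\<^sup>+ t. f (?c s + L' t) \<partial>?M') = (\<integral>\<^sup>+ t. f (?c' t) \<partial>?M')" by simp
    then show "(\<integral>\<^sup>+ t. f (?c s + L' t) * g (p + p' - ?c s) \<partial>?M') = g (p + p' - ?c s) * (\<integral>\<^sup>+ t. f (?c' t) \<partial>?M')"
      by (subst nn_integral_multc) (simp_all add: mult.commute)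
  qed
  also have "\<dots> = (\<integral>\<^sup>+ s. g (p + p' - ?c s) \<partial>?M) * (\<integral>\<^sup>+ t. f (?c' t) \<partial>?M')"
    by (rule nn_integral_multc) measurable
  finally show ?thesis .
qed

lemma frame_coefficients_unique:
  assumes "affine_frame F k p b" "(\<Sum>i<k. s i *\<^sub>R b i) = (\<Sum>i<k. s' i *\<^sub>R b i)" "j < k"
  shows "s j = s' j"
proof (rule ccontr)
  assume ne: "s j \<noteq> s' j"
  have inj: "inj_on b {..<k}" and ind: "independent (b ` {..<k})" using assms(1) by (auto simp: affine_frame_def)
  define u where "u v = s (the_inv_into {..<k} b v) - s' (the_inv_into {..<k} b v)" for v
  have u: "u (b i) = s i - s' i" if "i < k" for i
    using that inj by (simp add: u_def the_inv_into_f_f)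
  have "(\<Sum>v\<in>b ` {..<k}. u v *\<^sub>R v) = (\<Sum>i<k. (s i - s' i) *\<^sub>R b i)"
    using inj by (simp add: sum.reindex u)
  also have "\<dots> = 0" using assms(2) by (simp add: scaleR_left_diff_distrib sum_subtractf)
  finally have "\<forall>v\<in>b ` {..<k}. u v = 0"
    using ind by (auto simp: dependent_finite)
  then show False using ne u[OF assms(3)] assms(3) by auto
qed

text \<open>\<open>affine_lebesgue\<close> is defined by a choice of frame, so a given chart
  describes it only up to a constant. Taking the unit cube of the given chart as the test set in the
  product formula yields that constant. The functionals \<open>u j\<close>, defined on the whole
  ambient space, read off the chart coordinates and make the cube \<open>B\<close> a Borel
  set.\<close>

lemma affine_lebesgue_chart:
  fixes p :: "'a::{real_normed_vector, second_countable_topology}"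
  assumes F: "affine_frame F k p b"
    and u[measurable]: "\<And>j. j < k \<Longrightarrow> u j \<in> borel_measurable borel"
    and u_chart: "\<And>t j. j < k \<Longrightarrow> u j (affine_chart k p b t) = t j"
  obtains c :: real where "0 < c" "sets (affine_lebesgue F) = sets borel"
    "\<And>f. f \<in> borel_measurable borel \<Longrightarrow>
      (\<integral>\<^sup>+ x. f x \<partial>affine_lebesgue F) = ennreal c * (\<integral>\<^sup>+ t. f (affine_chart k p b t) \<partial>lebPi {..<k})"
proof -
  have "\<exists>\<mu>. \<exists>k p b. affine_frame F k p b \<and> \<mu> = distr (lebPi {..<k}) borel (affine_chart k p b)"
    using F by blast
  from someI_ex[OF this] obtain k1 p1 b1 where F1: "affine_frame F k1 p1 b1"
    and \<mu>: "affine_lebesgue F = distr (lebPi {..<k1}) borel (affine_chart k1 p1 b1)"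
    unfolding affine_lebesgue_def by blast
  let ?c = "affine_chart k p b" and ?c1 = "affine_chart k1 p1 b1"
  have inj: "inj_on b {..<k}" "inj_on b1 {..<k1}" using F F1 by (auto simp: affine_frame_def)
  have F_eq: "F = (+) p ` span (b ` {..<k})" "F = (+) p1 ` span (b1 ` {..<k1})"
    using F F1 by (simp_all add: affine_frame_def)
  define B where "B = {x. \<forall>j\<in>{..<k}. u j x \<in> {0..1}}"
  have B[measurable]: "B \<in> sets borel" unfolding B_def by measurable
  define c where "c = (\<integral>\<^sup>+ s. indicator B (p1 + p - ?c1 s) \<partial>lebPi {..<k1})"
  have "(\<integral>\<^sup>+ t. indicator B (?c t) \<partial>lebPi {..<k}) = (\<integral>\<^sup>+ t. indicator (\<Pi>\<^sub>E i\<in>{..<k}. {0..1}) t \<partial>lebPi {..<k})"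
    by (intro nn_integral_cong) (auto simp: B_def u_chart indicator_def space_PiM PiE_iff)
  also have "\<dots> = 1"
    by (subst nn_integral_indicator) (auto simp: lebPi.emeasure_PiM intro!: sets_PiM_I_finite)
  finally have Bint: "(\<integral>\<^sup>+ t. indicator B (?c t) \<partial>lebPi {..<k}) = 1" .
  have scale: "(\<integral>\<^sup>+ s. f (?c1 s) \<partial>lebPi {..<k1}) = c * (\<integral>\<^sup>+ t. f (?c t) \<partial>lebPi {..<k})"
    if "f \<in> borel_measurable borel" for f :: "'a \<Rightarrow> ennreal"
    using nn_integral_chart_product[OF F1 F that, of "indicator B"] by (simp add: Bint c_def)
  have "c \<noteq> 0"
  proof
    assume "c = 0"
    then have "emeasure (lebPi {..<k1}) (space (lebPi {..<k1})) = 0" using scale[of "\<lambda>_. 1"] by simp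
    moreover have "emeasure (lebPi {..<k1}) (\<Pi>\<^sub>E i\<in>{..<k1}. {0..1}) \<le> emeasure (lebPi {..<k1}) (space (lebPi {..<k1}))"
      by (intro emeasure_mono) (auto simp: space_PiM)
    ultimately show False by (subst (asm) lebPi.emeasure_PiM) auto
  qed
  \<comment> \<open>The passage between the two frames is affine, with matrix \<open>A\<close> and
    shift \<open>d\<close>. The unit cube of the given chart thus corresponds to a bounded set of
    coefficients in the chosen one, contained in a box with half-sides \<open>R i\<close>.\<close>
  have "c \<noteq> \<infinity>"
  proof -
    have "\<exists>a. b j = (\<Sum>i<k1. a i *\<^sub>R b1 i)" if "j < k" for j
    proof -
      have "p + b j \<in> F" "p \<in> F" unfolding F_eq(1) using that by (auto simp: image_iff intro!: span_base exI[of _ 0] bexI[of _ 0] span_zero)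
      then obtain x y where "x \<in> span (b1 ` {..<k1})" "y \<in> span (b1 ` {..<k1})" "p + b j = p1 + x" "p = p1 + y"
        unfolding F_eq(2) by blast
      then have "b j = x - y" "x - y \<in> span (b1 ` {..<k1})" by (auto simp: algebra_simps intro: span_diff)
      then show ?thesis using span_frameE[OF inj(2)] by metis
    qed
    then have "\<forall>j\<in>{..<k}. \<exists>a. b j = (\<Sum>i<k1. a i *\<^sub>R b1 i)" by simp
    from bchoice[OF this] obtain A where A: "\<And>j. j < k \<Longrightarrow> b j = (\<Sum>i<k1. A j i *\<^sub>R b1 i)" by auto
    have "p \<in> F" unfolding F_eq(1) by (auto simp: image_iff intro!: bexI[of _ 0] span_zero)
    then obtain y where "y \<in> span (b1 ` {..<k1})" "p = p1 + y" unfolding F_eq(2) by blast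
    then obtain d where d: "p = p1 + (\<Sum>i<k1. d i *\<^sub>R b1 i)" using span_frameE[OF inj(2)] by metis
    define R where "R i = \<bar>d i\<bar> + (\<Sum>j<k. \<bar>A j i\<bar>)" for i
    have bounded: "\<bar>s i\<bar> \<le> R i" if s: "?c1 s \<in> B" and i: "i < k1" for s i
    proof -
      have "?c1 s \<in> F" unfolding F_eq(2) affine_chart_def by (intro imageI span_frameI)
      then obtain z where "z \<in> span (b ` {..<k})" "?c1 s = p + z" unfolding F_eq(1) by blast
      then obtain t where t: "?c1 s = ?c t" using span_frameE[OF inj(1)] unfolding affine_chart_def by metis
      have t01: "t j \<in> {0..1}" if "j < k" for j
        using s that unfolding t B_def by (auto simp: u_chart)
      have "(\<Sum>j<k. t j *\<^sub>R b j) = (\<Sum>j<k. \<Sum>i<k1. (t j * A j i) *\<^sub>R b1 i)"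
        by (intro sum.cong) (auto simp: A scaleR_sum_right)
      also have "\<dots> = (\<Sum>i<k1. (\<Sum>j<k. t j * A j i) *\<^sub>R b1 i)"
        by (subst sum.swap) (simp add: scaleR_sum_left)
      finally have "?c t = p1 + (\<Sum>i<k1. (d i + (\<Sum>j<k. t j * A j i)) *\<^sub>R b1 i)"
        by (simp add: affine_chart_def d scaleR_add_left sum.distrib)
      then have "(\<Sum>i<k1. s i *\<^sub>R b1 i) = (\<Sum>i<k1. (d i + (\<Sum>j<k. t j * A j i)) *\<^sub>R b1 i)"
        using t by (simp add: affine_chart_def)
      from frame_coefficients_unique[OF F1 this i] have "s i = d i + (\<Sum>j<k. t j * A j i)" .
      moreover have "\<bar>\<Sum>j<k. t j * A j i\<bar> \<le> (\<Sum>j<k. \<bar>A j i\<bar>)"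
        using t01 by (intro order_trans[OF sum_abs] sum_mono) (auto simp: abs_mult mult_left_le_one_le)
      ultimately show ?thesis by (simp add: R_def)
    qed
    \<comment> \<open>The scaling relation applied to \<open>B\<close> itself replaces the reflected
      argument in the definition of \<open>c\<close> by the chart.\<close>
    have "c = (\<integral>\<^sup>+ s. indicator B (?c1 s) \<partial>lebPi {..<k1})" using scale[of "indicator B"] Bint by simp
    also have "\<dots> \<le> (\<integral>\<^sup>+ s. indicator (\<Pi>\<^sub>E i\<in>{..<k1}. {- R i..R i}) s \<partial>lebPi {..<k1})"
      using bounded by (intro nn_integral_mono) (auto simp: indicator_def space_PiM PiE_iff abs_le_iff minus_le_iff)
    also have "\<dots> = (\<Prod>i<k1. emeasure lborel {- R i..R i})"
      by (subst nn_integral_indicator) (auto simp: lebPi.emeasure_PiM intro!: sets_PiM_I_finite)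
    also have "\<dots> = ennreal (\<Prod>i<k1. 2 * R i)"
    proof -
      have "0 \<le> R i" for i by (auto simp: R_def intro!: add_nonneg_nonneg sum_nonneg)
      then show ?thesis by (subst prod_ennreal[symmetric]) (auto intro!: prod.cong)
    qed
    also have "\<dots> < \<infinity>" by simp
    finally show ?thesis by simp
  qed
  show ?thesis
  proof (rule that[of "enn2real c"])
    show "0 < enn2real c" using \<open>c \<noteq> 0\<close> \<open>c \<noteq> \<infinity>\<close> by (simp add: enn2real_positive_iff top.not_eq_extremum zero_less_iff_neq_zero)
    show "sets (affine_lebesgue F) = sets borel" unfolding \<mu> by simp
    fix f :: "'a \<Rightarrow> ennreal" assume [measurable]: "f \<in> borel_measurable borel"
    show "(\<integral>\<^sup>+ x. f x \<partial>affine_lebesgue F) = ennreal (enn2real c) * (\<integral>\<^sup>+ t. f (?c t) \<partial>lebPi {..<k})"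
      unfolding \<mu> using \<open>c \<noteq> \<infinity>\<close> by (subst nn_integral_distr) (auto simp: scale top.not_eq_extremum)
  qed
qed

text \<open>Mass and first moment carry the same proportionality constant, which cancels in the
  quotient. Expanding the points of \<open>S\<close> in the finite family \<open>e\<close> reduces
  the vector-valued integral to real ones.\<close>

lemma centroid_chart:
  fixes p :: "'a::{real_normed_vector, second_countable_topology}" and e :: "'j \<Rightarrow> 'a"
  assumes F: "affine_frame F k p b"
    and u: "\<And>j. j < k \<Longrightarrow> u j \<in> borel_measurable borel"
    and u_chart: "\<And>t j. j < k \<Longrightarrow> u j (affine_chart k p b t) = t j"
    and S[measurable]: "S \<in> sets borel"
    and U[measurable]: "\<And>j. j \<in> A \<Longrightarrow> U j \<in> borel_measurable borel"
    and U01: "\<And>j x. x \<in> S \<Longrightarrow> j \<in> A \<Longrightarrow> U j x \<in> {0..1::real}"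
    and expand: "\<And>x. x \<in> S \<Longrightarrow> x = (\<Sum>j\<in>A. U j x *\<^sub>R e j)"
    and T[measurable]: "T \<in> sets (lebPi {..<k})"
    and ST: "\<And>t. t \<in> space (lebPi {..<k}) \<Longrightarrow> affine_chart k p b t \<in> S \<longleftrightarrow> t \<in> T"
    and Tpos: "0 < measure (lebPi {..<k}) T"
  shows "0 < measure (affine_lebesgue F) S"
    and "centroid F S = (\<Sum>j\<in>A. ((\<integral>t. indicator T t * U j (affine_chart k p b t) \<partial>lebPi {..<k}) / measure (lebPi {..<k}) T) *\<^sub>R e j)"
proof -
  let ?c = "affine_chart k p b" and ?M = "lebPi {..<k}"
  obtain c where c: "0 < c" and sets[measurable_cong]: "sets (affine_lebesgue F) = sets borel"
    and nn: "\<And>f. f \<in> borel_measurable borel \<Longrightarrow>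
      (\<integral>\<^sup>+ x. f x \<partial>affine_lebesgue F) = ennreal c * (\<integral>\<^sup>+ t. f (?c t) \<partial>?M)"
    using affine_lebesgue_chart[OF F u u_chart] by blast
  have fin: "emeasure ?M T < \<infinity>"
    using Tpos by (metis enn2real_top infinity_ennreal_def less_irrefl measure_def top.not_eq_extremum)
  have indic: "indicator S (?c t) = indicator T t" if "t \<in> space ?M" for t
    using ST[OF that] by (simp add: indicator_def)
  have "emeasure (affine_lebesgue F) S = (\<integral>\<^sup>+ x. indicator S x \<partial>affine_lebesgue F)"
    by (intro nn_integral_indicator[symmetric]) (simp add: sets)
  also have "\<dots> = ennreal c * (\<integral>\<^sup>+ t. indicator T t \<partial>?M)"
  proof -
    have "(\<integral>\<^sup>+ t. indicator S (?c t) \<partial>?M) = (\<integral>\<^sup>+ t. indicator T t \<partial>?M)"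
      by (intro nn_integral_cong indic)
    then show ?thesis by (subst nn) simp_all
  qed
  finally have em: "emeasure (affine_lebesgue F) S = ennreal c * emeasure ?M T" by simp
  then have meas: "measure (affine_lebesgue F) S = c * measure ?M T"
    using c by (simp add: measure_def enn2real_mult)
  then show "0 < measure (affine_lebesgue F) S" using c Tpos by simp
  have finS: "emeasure (affine_lebesgue F) S < \<infinity>" using fin unfolding em by (simp add: ennreal_mult_less_top)
  have ind01: "0 \<le> indicator S x * U j x" if "j \<in> A" for j x
    using U01[of x j] that by (auto simp: indicator_def)
  have int: "(\<integral>x. indicator S x * U j x \<partial>affine_lebesgue F) = c * (\<integral>t. indicator T t * U j (?c t) \<partial>?M)" if j: "j \<in> A" for j
  proof -
    note [measurable] = U[OF j]
    have "(\<integral>x. indicator S x * U j x \<partial>affine_lebesgue F) = enn2real (\<integral>\<^sup>+ x. ennreal (indicator S x * U j x) \<partial>affine_lebesgue F)"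
      using ind01[OF j] by (intro integral_eq_nn_integral) auto
    also have "\<dots> = enn2real (ennreal c * (\<integral>\<^sup>+ t. ennreal (indicator T t * U j (?c t)) \<partial>?M))"
      by (subst nn) (auto intro!: arg_cong2[where f = "(*)"] arg_cong[where f = enn2real] nn_integral_cong simp: indic)
    also have "\<dots> = c * enn2real (\<integral>\<^sup>+ t. ennreal (indicator T t * U j (?c t)) \<partial>?M)"
      using c by (simp add: enn2real_mult)
    also have "enn2real (\<integral>\<^sup>+ t. ennreal (indicator T t * U j (?c t)) \<partial>?M) = (\<integral>t. indicator T t * U j (?c t) \<partial>?M)"
      using ind01[OF j] indic by (intro integral_eq_nn_integral[symmetric]) (auto intro!: AE_I2 simp flip: indic)
    finally show ?thesis .
  qed
  have intable: "integrable (affine_lebesgue F) (\<lambda>x. indicator S x * U j x)" if j: "j \<in> A" for j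
  proof (rule Bochner_Integration.integrable_bound)
    note [measurable] = U[OF j]
    show "integrable (affine_lebesgue F) (indicator S :: 'a \<Rightarrow> real)" using finS by (simp add: sets)
    show "(\<lambda>x. indicator S x * U j x) \<in> borel_measurable (affine_lebesgue F)" by measurable
    show "AE x in affine_lebesgue F. norm (indicator S x * U j x) \<le> norm (indicator S x :: real)"
      using U01 j by (intro AE_I2) (auto simp: indicator_def)
  qed
  have "indicator S x *\<^sub>R x = (\<Sum>j\<in>A. (indicator S x * U j x) *\<^sub>R e j)" for x
    using expand[of x] by (auto simp: indicator_def)
  then have "(\<integral>x\<in>S. x \<partial>affine_lebesgue F) = (\<integral>x. (\<Sum>j\<in>A. (indicator S x * U j x) *\<^sub>R e j) \<partial>affine_lebesgue F)"
    unfolding set_lebesgue_integral_def by simp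
  also have "\<dots> = (\<Sum>j\<in>A. (c * (\<integral>t. indicator T t * U j (?c t) \<partial>?M)) *\<^sub>R e j)"
    using intable by (subst Bochner_Integration.integral_sum) (auto simp: int intro!: sum.cong)
  finally show "centroid F S = (\<Sum>j\<in>A. ((\<integral>t. indicator T t * U j (?c t) \<partial>?M) / measure ?M T) *\<^sub>R e j)"
    unfolding centroid_def meas using c by (simp add: scaleR_sum_right)
qed

section \<open>The saddlepoint equation\<close>

lemma prob_space_unit_leb: "prob_space unit_leb"
  by (rule prob_spaceI) (simp add: emeasure_restrict_space)

interpretation unit_leb: prob_space unit_leb
  by (rule prob_space_unit_leb)

lemma ln_tilt_mass_lipschitz: "\<bar>ln (tilt_mass s) - ln (tilt_mass s')\<bar> \<le> \<bar>s - s'\<bar>"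
proof -
  have *: "ln (tilt_mass s) \<le> ln (tilt_mass s') + \<bar>s - s'\<bar>" for s s'
  proof -
    have "exp (s * t) \<le> exp \<bar>s - s'\<bar> * exp (s' * t)" if "t \<in> {0..1}" for t
    proof -
      have "(s - s') * t \<le> \<bar>s - s'\<bar>"
        using that mult_mono[of "s - s'" "\<bar>s - s'\<bar>" t 1] by simp
      then show ?thesis by (simp add: algebra_simps flip: exp_add)
    qed
    then have "tilt_mass s \<le> integral {0..1} (\<lambda>t. exp \<bar>s - s'\<bar> * exp (s' * t))"
      unfolding tilt_mass_def by (intro integral_le integrable_continuous_interval continuous_intros)
    also have "\<dots> = exp \<bar>s - s'\<bar> * tilt_mass s'" by (simp add: tilt_mass_def)
    finally have "ln (tilt_mass s) \<le> ln (exp \<bar>s - s'\<bar> * tilt_mass s')"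
      using tilt_mass_pos by (subst ln_le_cancel_iff) auto
    then show ?thesis using tilt_mass_pos[of s'] by (simp add: ln_mult)
  qed
  show ?thesis using *[of s s'] *[of s' s] by (simp add: abs_minus_commute)
qed

lemma tilt_mass_0: "tilt_mass 0 = 1"
  by (simp add: tilt_mass_def)

lemma abs_ln_tilt_mass_le: "\<bar>ln (tilt_mass s)\<bar> \<le> \<bar>s\<bar>"
  using ln_tilt_mass_lipschitz[of s 0] by (simp add: tilt_mass_0)

lemma measurable_ln_tilt_mass [measurable]: "(\<lambda>s. ln (tilt_mass s)) \<in> borel_measurable borel"
  using tilt_mass_pos
  by (intro borel_measurable_continuous_onI continuous_on_ln continuous_on_tilt_mass) (simp add: less_imp_neq[symmetric])

text \<open>Interiority of \<open>y0\<close> is encoded as a ball of attainable moments; its radius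
  becomes the growth rate of the potential.\<close>

locale moment_problem =
  fixes w :: "real \<Rightarrow> real ^ 'm" and y0 :: "real ^ 'm" and C \<delta> :: real
  assumes w[measurable]: "w \<in> borel_measurable unit_leb"
    and wC: "\<And>x. x \<in> {0..1} \<Longrightarrow> norm (w x) \<le> C" and C1: "1 \<le> C" and \<delta>: "0 < \<delta>"
    and feasible: "\<And>y. y \<in> cball y0 \<delta> \<Longrightarrow> \<exists>f. integrable unit_leb f \<and>
      (AE x in unit_leb. 0 \<le> f x \<and> f x \<le> 1) \<and> (\<integral>x. f x *\<^sub>R w x \<partial>unit_leb) = y"
begin

lemma integrable_bounded:
  fixes f :: "real \<Rightarrow> 'b::{banach, second_countable_topology}"
  assumes "f \<in> borel_measurable unit_leb" "\<And>x. x \<in> {0..1} \<Longrightarrow> norm (f x) \<le> B"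
  shows "integrable unit_leb f"
  using assms by (intro unit_leb.integrable_const_bound[where B = B]) auto

lemma inner_w_le: "x \<in> {0..1} \<Longrightarrow> \<bar>\<tau> \<bullet> w x\<bar> \<le> norm \<tau> * C"
  using wC[of x] by (intro order_trans[OF Cauchy_Schwarz_ineq2] mult_left_mono) auto

lemma integrable_sigma_w [simp]: "integrable unit_leb (\<lambda>x. sigma_fn (\<tau> \<bullet> w x) *\<^sub>R w x)"
proof (rule integrable_bounded)
  show "norm (sigma_fn (\<tau> \<bullet> w x) *\<^sub>R w x) \<le> 1 * C" if "x \<in> {0..1}" for x
    unfolding norm_scaleR using wC[OF that] sigma_fn_bounds[of "\<tau> \<bullet> w x"] by (intro mult_mono) auto
qed measurable

lemma integrable_ln_tilt [simp]: "integrable unit_leb (\<lambda>x. ln (tilt_mass (\<tau> \<bullet> w x)))"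
  by (rule integrable_bounded[where B = "norm \<tau> * C"])
     (measurable, use abs_ln_tilt_mass_le inner_w_le in \<open>auto intro: order_trans\<close>)

lemma integrable_test_w:
  assumes "integrable unit_leb f" "AE x in unit_leb. 0 \<le> f x \<and> f x \<le> 1"
  shows "integrable unit_leb (\<lambda>x. f x *\<^sub>R w x)"
proof (rule unit_leb.integrable_const_bound[where B = C])
  show "AE x in unit_leb. norm (f x *\<^sub>R w x) \<le> C"
    using assms(2) AE_space
  proof eventually_elim
    case (elim x)
    then have "\<bar>f x\<bar> * norm (w x) \<le> 1 * C" using wC[of x] by (intro mult_mono) auto
    then show ?case by simp
  qed
qed (use assms(1) in measurable)

text \<open>Such a vector is orthogonal to every attainable moment, and these fill a ball around
  \<open>y0\<close>.\<close>

lemma inner_w_AE_zero: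
  assumes "AE x in unit_leb. a \<bullet> w x = 0" shows "a = 0"
proof (rule ccontr)
  assume a: "a \<noteq> 0"
  have "a \<bullet> y = 0" if y: "y \<in> cball y0 \<delta>" for y
  proof -
    obtain f where f: "integrable unit_leb f" "AE x in unit_leb. 0 \<le> f x \<and> f x \<le> 1" "(\<integral>x. f x *\<^sub>R w x \<partial>unit_leb) = y"
      using feasible[OF y] by blast
    have "a \<bullet> y = (\<integral>x. a \<bullet> (f x *\<^sub>R w x) \<partial>unit_leb)"
      unfolding f(3)[symmetric] by (rule integral_inner_right[symmetric]) (rule integrable_test_w[OF f(1,2)])
    also have "\<dots> = (\<integral>x. 0 \<partial>unit_leb)"
      using f(1) assms by (intro integral_cong_AE) (measurable, auto elim!: eventually_mono)
    finally show ?thesis by simp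
  qed
  from this[of "y0 + (\<delta> / norm a) *\<^sub>R a"] this[of y0] show False
    using a \<delta> by (simp add: dist_norm inner_add_right)
qed

text \<open>Pairing the difference of the two equations with the difference of the parameters gives
  the integral of a product that is nonnegative by monotonicity of \<open>sigma_fn\<close>. Its
  vanishing makes the two exponents agree almost everywhere.\<close>

lemma saddlepoint_unique:
  assumes "(\<integral>x. sigma_fn (\<tau> \<bullet> w x) *\<^sub>R w x \<partial>unit_leb) = y0" "(\<integral>x. sigma_fn (\<tau>' \<bullet> w x) *\<^sub>R w x \<partial>unit_leb) = y0"
  shows "\<tau> = \<tau>'"
proof -
  let ?d = "\<lambda>x. (\<tau> \<bullet> w x - \<tau>' \<bullet> w x) * (sigma_fn (\<tau> \<bullet> w x) - sigma_fn (\<tau>' \<bullet> w x))"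
  have d_eq: "?d x = (\<tau> - \<tau>') \<bullet> (sigma_fn (\<tau> \<bullet> w x) *\<^sub>R w x - sigma_fn (\<tau>' \<bullet> w x) *\<^sub>R w x)" for x
    by (simp add: algebra_simps inner_diff_left inner_diff_right)
  have nonneg: "0 \<le> ?d x" for x
    using sigma_fn_monotone[of "\<tau> \<bullet> w x" "\<tau>' \<bullet> w x"] by (cases "\<tau> \<bullet> w x = \<tau>' \<bullet> w x") auto
  have "integrable unit_leb ?d" unfolding d_eq by simp
  moreover have "(\<integral>x. ?d x \<partial>unit_leb) = 0"
    unfolding d_eq by (subst integral_inner_right) (simp_all add: assms)
  ultimately have "AE x in unit_leb. ?d x = 0"
    using integral_nonneg_eq_0_iff_AE[of unit_leb ?d] nonneg by simp
  then have "AE x in unit_leb. (\<tau> - \<tau>') \<bullet> w x = 0"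
  proof eventually_elim
    case (elim x)
    then show ?case using sigma_fn_monotone[of "\<tau> \<bullet> w x" "\<tau>' \<bullet> w x"]
      by (cases "\<tau> \<bullet> w x = \<tau>' \<bullet> w x") (simp_all add: inner_diff_left)
  qed
  then show ?thesis using inner_w_AE_zero by fastforce
qed

text \<open>The gradient of the potential at \<open>\<tau>\<close> is the defect of the saddlepoint equation.\<close>

definition potential :: "real ^ 'm \<Rightarrow> real" where
  "potential \<tau> = (\<integral>x. ln (tilt_mass (\<tau> \<bullet> w x)) \<partial>unit_leb) - \<tau> \<bullet> y0"

lemma continuous_on_potential: "continuous_on UNIV potential"
proof -
  have "dist (potential \<tau>) (potential \<tau>') \<le> (C + norm y0) * dist \<tau> \<tau>'" for \<tau> \<tau>'
  proof -
    have "\<bar>(\<integral>x. ln (tilt_mass (\<tau> \<bullet> w x)) \<partial>unit_leb) - (\<integral>x. ln (tilt_mass (\<tau>' \<bullet> w x)) \<partial>unit_leb)\<bar> =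
        \<bar>\<integral>x. ln (tilt_mass (\<tau> \<bullet> w x)) - ln (tilt_mass (\<tau>' \<bullet> w x)) \<partial>unit_leb\<bar>" by simp
    also have "\<dots> \<le> (\<integral>x. \<bar>ln (tilt_mass (\<tau> \<bullet> w x)) - ln (tilt_mass (\<tau>' \<bullet> w x))\<bar> \<partial>unit_leb)"
      by (rule integral_abs_bound)
    also have "\<dots> \<le> (\<integral>x. norm (\<tau> - \<tau>') * C \<partial>unit_leb)"
    proof (rule integral_mono)
      fix x assume "x \<in> space unit_leb"
      then have "\<bar>(\<tau> - \<tau>') \<bullet> w x\<bar> \<le> norm (\<tau> - \<tau>') * C" by (intro inner_w_le) simp
      then show "\<bar>ln (tilt_mass (\<tau> \<bullet> w x)) - ln (tilt_mass (\<tau>' \<bullet> w x))\<bar> \<le> norm (\<tau> - \<tau>') * C"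
        using ln_tilt_mass_lipschitz by (rule_tac order_trans) (auto simp: inner_diff_left)
    qed auto
    also have "\<dots> = norm (\<tau> - \<tau>') * C" by (simp add: unit_leb.prob_space[simplified])
    finally have 1: "\<bar>(\<integral>x. ln (tilt_mass (\<tau> \<bullet> w x)) \<partial>unit_leb) - (\<integral>x. ln (tilt_mass (\<tau>' \<bullet> w x)) \<partial>unit_leb)\<bar> \<le> norm (\<tau> - \<tau>') * C" .
    have 2: "\<bar>\<tau> \<bullet> y0 - \<tau>' \<bullet> y0\<bar> \<le> norm (\<tau> - \<tau>') * norm y0"
      using Cauchy_Schwarz_ineq2[of "\<tau> - \<tau>'" y0] by (simp add: inner_diff_left)
    show ?thesis using 1 2 unfolding potential_def dist_norm real_norm_def by (simp add: algebra_simps abs_le_iff)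
  qed
  then have "(C + norm y0)-lipschitz_on UNIV potential"
    using C1 by (intro lipschitz_onI) auto
  then show ?thesis by (rule lipschitz_on_continuous_on)
qed

text \<open>A test function attaining the moment \<open>y0\<close> moved by \<delta> in the
  direction of \<tau> shows that the integral of the positive part of \<tau> \<bullet> w exceeds
  \<tau> \<bullet> y0 by at least \<delta> times the norm of \<tau>. The log-mass falls short of
  this positive part by at most \<open>d * C * norm \<tau> - ln d\<close>.\<close>

lemma potential_coercive:
  assumes d: "0 < d" "d \<le> 1"
  shows "ln d + (\<delta> - d * C) * norm \<tau> \<le> potential \<tau>"
proof (cases "\<tau> = 0")
  case True then show ?thesis using d by (simp add: potential_def tilt_mass_0)
next
  case False
  have "y0 + (\<delta> / norm \<tau>) *\<^sub>R \<tau> \<in> cball y0 \<delta>" using False \<delta> by (simp add: dist_norm)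
  then obtain f where f: "integrable unit_leb f" "AE x in unit_leb. 0 \<le> f x \<and> f x \<le> 1"
    "(\<integral>x. f x *\<^sub>R w x \<partial>unit_leb) = y0 + (\<delta> / norm \<tau>) *\<^sub>R \<tau>"
    using feasible by blast
  have int_max: "integrable unit_leb (\<lambda>x. max (\<tau> \<bullet> w x) 0)"
    by (rule integrable_bounded[where B = "norm \<tau> * C"])
       (measurable, use inner_w_le C1 in \<open>fastforce simp: abs_le_iff max_def\<close>)
  have "\<tau> \<bullet> y0 + \<delta> * norm \<tau> = \<tau> \<bullet> (\<integral>x. f x *\<^sub>R w x \<partial>unit_leb)"
    using False unfolding f(3) by (simp add: inner_add_right dot_square_norm power2_eq_square)
  also have "\<dots> = (\<integral>x. \<tau> \<bullet> (f x *\<^sub>R w x) \<partial>unit_leb)"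
    by (rule integral_inner_right[symmetric]) (rule integrable_test_w[OF f(1,2)])
  also have "\<dots> \<le> (\<integral>x. max (\<tau> \<bullet> w x) 0 \<partial>unit_leb)"
  proof (rule integral_mono_AE)
    show "integrable unit_leb (\<lambda>x. \<tau> \<bullet> (f x *\<^sub>R w x))"
      using integrable_test_w[OF f(1,2)] by (rule integrable_inner_right)
    show "AE x in unit_leb. \<tau> \<bullet> f x *\<^sub>R w x \<le> max (\<tau> \<bullet> w x) 0"
      using f(2)
    proof eventually_elim
      case (elim x)
      then have "f x * (\<tau> \<bullet> w x) \<le> f x * max (\<tau> \<bullet> w x) 0" "f x * max (\<tau> \<bullet> w x) 0 \<le> 1 * max (\<tau> \<bullet> w x) 0"
        by - (rule mult_left_mono mult_right_mono; simp)+
      then show ?case by simp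
    qed
  qed (rule int_max)
  finally have 1: "\<tau> \<bullet> y0 + \<delta> * norm \<tau> \<le> (\<integral>x. max (\<tau> \<bullet> w x) 0 \<partial>unit_leb)" .
  have "(\<integral>x. max (\<tau> \<bullet> w x) 0 \<partial>unit_leb) + (ln d - d * (norm \<tau> * C)) =
      (\<integral>x. max (\<tau> \<bullet> w x) 0 + (ln d - d * (norm \<tau> * C)) \<partial>unit_leb)"
    using int_max by (simp add: unit_leb.prob_space[simplified])
  also have "\<dots> \<le> (\<integral>x. ln (tilt_mass (\<tau> \<bullet> w x)) \<partial>unit_leb)"
  proof (rule integral_mono)
    fix x assume "x \<in> space unit_leb"
    then have "d * \<bar>\<tau> \<bullet> w x\<bar> \<le> d * (norm \<tau> * C)" using d by (intro mult_left_mono inner_w_le) auto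
    then show "max (\<tau> \<bullet> w x) 0 + (ln d - d * (norm \<tau> * C)) \<le> ln (tilt_mass (\<tau> \<bullet> w x))"
      using ln_tilt_mass_ge[OF d, of "\<tau> \<bullet> w x"] by simp
  qed (use int_max in auto)
  finally show ?thesis using 1 by (simp add: potential_def algebra_simps)
qed

text \<open>A one-sided quadratic bound in place of differentiability: it already produces a descent
  step wherever the saddlepoint defect is nonzero.\<close>

lemma potential_step:
  assumes "norm e * C \<le> 1"
  shows "potential (\<tau> + e) \<le> potential \<tau> + e \<bullet> ((\<integral>x. sigma_fn (\<tau> \<bullet> w x) *\<^sub>R w x \<partial>unit_leb) - y0) + (norm e * C)^2"
proof -
  have "(\<integral>x. ln (tilt_mass ((\<tau> + e) \<bullet> w x)) \<partial>unit_leb) \<le>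
      (\<integral>x. ln (tilt_mass (\<tau> \<bullet> w x)) + e \<bullet> (sigma_fn (\<tau> \<bullet> w x) *\<^sub>R w x) + (norm e * C)^2 \<partial>unit_leb)"
  proof (rule integral_mono)
    fix x assume "x \<in> space unit_leb"
    then have le: "\<bar>e \<bullet> w x\<bar> \<le> norm e * C" by (intro inner_w_le) simp
    then have "(e \<bullet> w x)^2 \<le> (norm e * C)^2"
      by (metis abs_ge_zero power2_abs power_mono)
    then show "ln (tilt_mass ((\<tau> + e) \<bullet> w x)) \<le> ln (tilt_mass (\<tau> \<bullet> w x)) + e \<bullet> (sigma_fn (\<tau> \<bullet> w x) *\<^sub>R w x) + (norm e * C)^2"
      using ln_tilt_mass_shift_le[of "e \<bullet> w x" "\<tau> \<bullet> w x"] le assms by (simp add: inner_add_left mult.commute)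
  qed (rule integrable_ln_tilt, intro Bochner_Integration.integrable_add integrable_inner_right
      integrable_ln_tilt integrable_sigma_w unit_leb.integrable_const)
  also have "\<dots> = (\<integral>x. ln (tilt_mass (\<tau> \<bullet> w x)) \<partial>unit_leb) + e \<bullet> (\<integral>x. sigma_fn (\<tau> \<bullet> w x) *\<^sub>R w x \<partial>unit_leb) + (norm e * C)^2"
  proof -
    define X where "X x = e \<bullet> (sigma_fn (\<tau> \<bullet> w x) *\<^sub>R w x)" for x
    have "integrable unit_leb X"
      unfolding X_def by (intro integrable_inner_right integrable_sigma_w)
    moreover have "(\<integral>x. X x \<partial>unit_leb) = e \<bullet> (\<integral>x. sigma_fn (\<tau> \<bullet> w x) *\<^sub>R w x \<partial>unit_leb)"
      unfolding X_def by (intro integral_inner_right integrable_sigma_w)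
    ultimately show ?thesis
      unfolding X_def[symmetric] by (simp add: unit_leb.prob_space[simplified])
  qed
  finally show ?thesis by (simp add: potential_def inner_add_left inner_diff_right)
qed

lemma saddlepoint_exists: "\<exists>\<tau>. (\<integral>x. sigma_fn (\<tau> \<bullet> w x) *\<^sub>R w x \<partial>unit_leb) = y0"
proof -
  \<comment> \<open>Small enough that the coercivity rate \<open>\<delta> - d * C\<close> is still
    at least \<open>\<delta> / 2\<close>.\<close>
  define d where "d = min 1 (\<delta> / (2 * C))"
  have d: "0 < d" "d \<le> 1" using \<delta> C1 by (auto simp: d_def)
  have "d * C \<le> \<delta> / (2 * C) * C" using C1 by (intro mult_right_mono) (auto simp: d_def)
  then have dC: "\<delta> / 2 \<le> \<delta> - d * C" using C1 by simp
  \<comment> \<open>Outside this radius the coercive bound is at least 0, the value of the potential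
    at the origin; a minimum over the ball is then global.\<close>
  define \<rho> where "\<rho> = - ln d * 2 / \<delta>"
  have "ln d \<le> 0" using d by simp
  then have \<rho>: "0 \<le> \<rho>" unfolding \<rho>_def using \<delta> by (intro divide_nonneg_pos) auto
  obtain \<tau> where \<tau>: "\<tau> \<in> cball 0 \<rho>" "\<And>t. t \<in> cball 0 \<rho> \<Longrightarrow> potential \<tau> \<le> potential t"
    using continuous_attains_inf[of "cball 0 \<rho>" potential] continuous_on_subset[OF continuous_on_potential] \<rho> by auto
  have min: "potential \<tau> \<le> potential t" for t
  proof (cases "t \<in> cball 0 \<rho>")
    case True then show ?thesis by (rule \<tau>(2))
  next
    case False
    then have "\<rho> \<le> norm t" by simp
    then have "\<delta> / 2 * \<rho> \<le> \<delta> / 2 * norm t" using \<delta> by (intro mult_left_mono) auto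
    also have "\<dots> \<le> (\<delta> - d * C) * norm t" using dC by (intro mult_right_mono) auto
    finally have "0 \<le> ln d + (\<delta> - d * C) * norm t" using \<delta> by (simp add: \<rho>_def)
    then have "0 \<le> potential t" using potential_coercive[OF d, of t] by simp
    moreover have "potential \<tau> \<le> potential 0" using \<rho> by (intro \<tau>(2)) simp
    moreover have "potential 0 = 0" by (simp add: potential_def tilt_mass_0)
    ultimately show ?thesis by simp
  qed
  define g where "g = (\<integral>x. sigma_fn (\<tau> \<bullet> w x) *\<^sub>R w x \<partial>unit_leb) - y0"
  have "g = 0"
  proof (rule ccontr)
    assume g: "g \<noteq> 0"
    \<comment> \<open>A gradient step short enough to be admissible in \<open>potential_step\<close>
      and with \<open>t * C^2 < 1\<close>, so that the linear decrease beats the quadratic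
      error.\<close>
    define t where "t = 1 / (2 * C^2 * (1 + norm g))"
    have t: "0 < t" unfolding t_def using C1 by (intro divide_pos_pos mult_pos_pos add_pos_nonneg) auto
    have gpos: "0 < norm g" "0 < 1 + norm g" using g by (auto intro: add_pos_nonneg)
    have tC: "t * C^2 < 1" using C1 gpos by (simp add: t_def divide_simps add_pos_nonneg)
    have "norm g * C \<le> (1 + norm g) * C" using C1 by (intro mult_right_mono) auto
    also have "\<dots> \<le> 2 * C^2 * (1 + norm g)"
    proof -
      have "C * 1 \<le> (2 * C) * C" using C1 by (intro mult_mono) auto
      then have "C \<le> 2 * C^2" by (simp add: power2_eq_square)
      then show ?thesis using gpos by (simp add: mult.commute[of "1 + norm g"] mult_right_mono)
    qed
    finally have "norm (- t *\<^sub>R g) * C \<le> 1" using C1 gpos by (simp add: t_def divide_simps)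
    from potential_step[OF this, of \<tau>] min[of "\<tau> + - t *\<^sub>R g"]
    have "0 \<le> (- t *\<^sub>R g) \<bullet> g + (norm (- t *\<^sub>R g) * C)^2" unfolding g_def by linarith
    also have "\<dots> = t * (norm g)^2 * (t * C^2 - 1)"
      using t by (simp add: dot_square_norm power_mult_distrib algebra_simps power2_eq_square)
    finally have "0 \<le> t * (norm g)^2 * (t * C^2 - 1)" .
    moreover have "0 < t * (norm g)^2" using t g by simp
    ultimately show False using tC by (simp only: zero_le_mult_iff) simp
  qed
  then show ?thesis by (auto simp: g_def intro!: exI[of _ \<tau>])
qed

end

section \<open>Step functions and coordinates of the profile spaces\<close>

lemma step_function_breakpoints:
  assumes "step_function w"
  obtains N :: "real set" where "finite N"
    "\<And>a b. {a<..<b} \<subseteq> {0..1} \<Longrightarrow> N \<inter> {a<..<b} = {} \<Longrightarrow> \<exists>c. \<forall>x\<in>{a<..<b}. w x = c"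
proof -
  from assms obtain \<I> where \<I>: "finite \<I>" "partition_on {0..1} \<I>"
    and J: "\<And>J. J \<in> \<I> \<Longrightarrow> is_interval J \<and> w constant_on J"
    unfolding step_function_def by blast
  \<comment> \<open>The end points of the pieces. An open interval that meets a piece and avoids its
    infimum and supremum lies between them, hence inside the piece.\<close>
  define N where "N = Inf ` \<I> \<union> Sup ` \<I>"
  show ?thesis
  proof (rule that)
    show "finite N" using \<I>(1) by (simp add: N_def)
    fix a b :: real assume sub: "{a<..<b} \<subseteq> {0..1}" and N: "N \<inter> {a<..<b} = {}"
    show "\<exists>c. \<forall>x\<in>{a<..<b}. w x = c"
    proof (cases "{a<..<b} = {}")
      case False
      then obtain x where x: "x \<in> {a<..<b}" by blast
      have "x \<in> \<Union>\<I>" using x sub unfolding partition_onD1[OF \<I>(2), symmetric] by blast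
      then obtain J where JI: "J \<in> \<I>" "x \<in> J" by blast
      have J01: "J \<subseteq> {0..1}" unfolding partition_onD1[OF \<I>(2)] using JI(1) by blast
      have bdd: "bdd_below J" "bdd_above J"
        using J01 by (meson bdd_below_Icc bdd_below_mono, meson bdd_above_Icc bdd_above_mono)
      have "Inf J \<le> x" "x \<le> Sup J" using bdd JI(2) by (auto intro: cInf_lower cSup_upper)
      moreover have "Inf J \<notin> {a<..<b}" "Sup J \<notin> {a<..<b}" using N JI(1) by (auto simp: N_def)
      ultimately have le: "Inf J \<le> a" "b \<le> Sup J" using x by auto
      have "y \<in> J" if y: "y \<in> {a<..<b}" for y
      proof -
        have "J \<noteq> {}" "Inf J < y" "y < Sup J" using JI(2) y le by auto
        then obtain u v where "u \<in> J" "u < y" "v \<in> J" "y < v"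
          using cInf_lessD[of J y] less_cSupD[of J y] by blast
        then have "u \<in> J" "u \<le> y" "v \<in> J" "y \<le> v" by simp_all
        moreover have "is_interval J" using J[OF JI(1)] by simp
        ultimately show ?thesis unfolding is_interval_1 by blast
      qed
      then show ?thesis using J[OF JI(1)] unfolding constant_on_def by blast
    qed auto
  qed
qed

lemma step_function_finite_range:
  assumes "step_function w" shows "finite (w ` {0..1})"
proof -
  from assms obtain \<I> where \<I>: "finite \<I>" "partition_on {0..1} \<I>"
    and J: "\<And>J. J \<in> \<I> \<Longrightarrow> is_interval J \<and> w constant_on J"
    unfolding step_function_def by blast
  have "w ` {0..1} = (\<Union>J\<in>\<I>. w ` J)" using partition_onD1[OF \<I>(2)] by blast
  moreover have "finite (w ` J)" if JI: "J \<in> \<I>" for J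
  proof -
    obtain c where "\<forall>x\<in>J. w x = c" using J[OF JI] by (auto simp: constant_on_def)
    then have "w ` J \<subseteq> {c}" by auto
    then show ?thesis by (rule finite_subset) simp
  qed
  ultimately show ?thesis using \<I>(1) by simp
qed

lemma step_function_bounded:
  fixes w :: "real \<Rightarrow> 'b::real_normed_vector"
  assumes "step_function w"
  obtains C where "1 \<le> C" "\<And>x. x \<in> {0..1} \<Longrightarrow> norm (w x) \<le> C"
proof -
  have "bounded (w ` {0..1})" using step_function_finite_range[OF assms] by (rule finite_imp_bounded)
  then obtain B where B: "\<forall>y\<in>w ` {0..1}. norm y \<le> B" unfolding bounded_iff by blast
  then have "norm (w x) \<le> max 1 B" if "x \<in> {0..1}" for x
    using that by (simp add: max.coboundedI2)
  then show ?thesis using that[of "max 1 B"] by simp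
qed

lemma step_function_measurable:
  fixes w :: "real \<Rightarrow> 'b::real_normed_vector"
  assumes "step_function w" shows "w \<in> borel_measurable unit_leb"
proof (rule measurableI)
  fix A :: "'b set" assume "A \<in> sets borel"
  from assms obtain \<I> where \<I>: "finite \<I>" "partition_on {0..1} \<I>"
    and J: "\<And>J. J \<in> \<I> \<Longrightarrow> is_interval J \<and> w constant_on J"
    unfolding step_function_def by blast
  have "w -` A \<inter> {0..1} = \<Union>{J \<in> \<I>. \<exists>x\<in>J. w x \<in> A}"
    using partition_onD1[OF \<I>(2)] J by (fastforce simp: constant_on_def)
  also have "\<dots> \<in> sets lebesgue"
  proof (rule sets.finite_Union)
    show "{J \<in> \<I>. \<exists>x\<in>J. w x \<in> A} \<subseteq> sets lebesgue"
    proof safe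
      fix K assume K: "K \<in> \<I>"
      show "K \<in> sets lebesgue"
        using real_interval_borel_measurable[of K] J[OF K] by simp
    qed
  qed (use \<I>(1) in auto)
  finally show "w -` A \<inter> space unit_leb \<in> sets unit_leb"
    by (simp add: sets_restrict_space_iff)
qed simp

text \<open>Common form of the moment operator and of the coordinate functionals, so that linearity
  and continuity are proved once.\<close>

definition pairing :: "(real \<Rightarrow> 'b::{banach, second_countable_topology}) \<Rightarrow> L1 \<Rightarrow> 'b" where
  "pairing h F = (\<integral>x. L1_rep F x *\<^sub>R h x \<partial>unit_leb)"

lemma Lambda_eq_pairing: "Lambda w = pairing w"
  by (simp add: Lambda_def pairing_def fun_eq_iff)

lemma integrable_pairing:
  fixes h :: "real \<Rightarrow> 'b::{banach, second_countable_topology}"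
  assumes [measurable]: "h \<in> borel_measurable unit_leb" and "\<And>x. x \<in> {0..1} \<Longrightarrow> norm (h x) \<le> B" and f: "integrable unit_leb f"
  shows "integrable unit_leb (\<lambda>x. f x *\<^sub>R h x)"
proof (rule Bochner_Integration.integrable_bound)
  show "integrable unit_leb (\<lambda>x. B * \<bar>f x\<bar>)" using f by simp
  show "(\<lambda>x. f x *\<^sub>R h x) \<in> borel_measurable unit_leb" using f by measurable
  show "AE x in unit_leb. norm (f x *\<^sub>R h x) \<le> norm (B * \<bar>f x\<bar>)"
  proof (rule AE_I2)
    fix x assume "x \<in> space unit_leb"
    then have "norm (h x) \<le> B" using assms(2) by simp
    then have "norm (h x) \<le> \<bar>B\<bar>" by simp
    then show "norm (f x *\<^sub>R h x) \<le> norm (B * \<bar>f x\<bar>)"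
      by (simp add: abs_mult mult.commute[of "\<bar>B\<bar>"] mult_left_mono)
  qed
qed

lemma pairing_L1_of:
  fixes h :: "real \<Rightarrow> 'b::{banach, second_countable_topology}"
  assumes [measurable]: "h \<in> borel_measurable unit_leb" and f: "integrable unit_leb f"
  shows "pairing h (L1_of f) = (\<integral>x. f x *\<^sub>R h x \<partial>unit_leb)"
  unfolding pairing_def
proof (rule integral_cong_AE)
  show "AE x in unit_leb. L1_rep (L1_of f) x *\<^sub>R h x = f x *\<^sub>R h x"
    using L1_rep_of[OF f] by eventually_elim simp
  have [measurable]: "f \<in> borel_measurable unit_leb" "L1_rep (L1_of f) \<in> borel_measurable unit_leb"
    using f borel_measurable_integrable by auto
  show "(\<lambda>x. L1_rep (L1_of f) x *\<^sub>R h x) \<in> borel_measurable unit_leb" "(\<lambda>x. f x *\<^sub>R h x) \<in> borel_measurable unit_leb"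
    by measurable
qed

lemma bounded_linear_pairing:
  fixes h :: "real \<Rightarrow> 'b::{banach, second_countable_topology}"
  assumes h: "h \<in> borel_measurable unit_leb" and B: "\<And>x. x \<in> {0..1} \<Longrightarrow> norm (h x) \<le> B"
  shows "bounded_linear (pairing h)"
proof (rule bounded_linear_intro[where K = B])
  have int: "integrable unit_leb (\<lambda>x. f x *\<^sub>R h x)" if "integrable unit_leb f" for f
    using integrable_pairing[OF h _ that] B by blast
  show "pairing h (F + G) = pairing h F + pairing h G" for F G
  proof -
    obtain f where f: "integrable unit_leb f" "F = L1_of f" by (rule L1_cases)
    obtain g where g: "integrable unit_leb g" "G = L1_of g" by (rule L1_cases)
    show ?thesis
      using f(1) g(1) int[OF f(1)] int[OF g(1)]
      by (simp add: f(2) g(2) L1_of_add[symmetric] pairing_L1_of[OF h] scaleR_add_left)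
  qed
  show "pairing h (r *\<^sub>R F) = r *\<^sub>R pairing h F" for r F
  proof -
    obtain f where f: "integrable unit_leb f" "F = L1_of f" by (rule L1_cases)
    show ?thesis using f(1) by (simp add: f(2) L1_of_scaleR[symmetric] pairing_L1_of[OF h] flip: scaleR_scaleR)
  qed
  show "norm (pairing h F) \<le> norm F * B" for F
  proof -
    have "norm (pairing h F) \<le> (\<integral>x. norm (L1_rep F x *\<^sub>R h x) \<partial>unit_leb)"
      unfolding pairing_def by (rule integral_norm_bound)
    also have "\<dots> \<le> (\<integral>x. \<bar>L1_rep F x\<bar> * B \<partial>unit_leb)"
      using int[OF integrable_L1_rep[of F]] B
      by (intro integral_mono integrable_norm integrable_mult_left integrable_abs) (auto intro!: mult_left_mono)
    also have "\<dots> = norm (L1_of (L1_rep F)) * B"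
      by (subst norm_L1_of) auto
    finally show ?thesis by simp
  qed
qed

section \<open>Cells and coordinate functionals\<close>

definition cell :: "nat \<Rightarrow> nat \<Rightarrow> real set" where
  "cell n j = {real j / real n .. (real j + 1) / real n}"

definition cell_L1 :: "nat \<Rightarrow> nat \<Rightarrow> L1" where
  "cell_L1 n j = L1_of (indicator (cell n j))"

definition cell_avg :: "nat \<Rightarrow> nat \<Rightarrow> (real \<Rightarrow> 'b::{banach, second_countable_topology}) \<Rightarrow> 'b" where
  "cell_avg n j h = real n *\<^sub>R (\<integral>x. indicator (cell n j) x *\<^sub>R h x \<partial>unit_leb)"

text \<open>The coefficient on a cell is recovered as a mean over it. This makes it a continuous,
  hence Borel, functional on all of L^1 and not just on the profile space.\<close>

definition coord :: "nat \<Rightarrow> nat \<Rightarrow> L1 \<Rightarrow> real" where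
  "coord n j = pairing (\<lambda>x. real n * indicator (cell n j) x)"

text \<open>Passes from cells numbered from 1 to cells numbered from 0, matching sums over
  \<open>{..<n}\<close>.\<close>

lemma profile_space_eq: "profile_space n = span (cell_L1 n ` {..<n})"
proof -
  have "(\<lambda>j. L1_of (indicator {(real j - 1) / real n .. real j / real n})) ` {1..n} = cell_L1 n ` {..<n}"
    unfolding image_Suc_lessThan[symmetric] image_image by (simp add: cell_L1_def cell_def add.commute)
  then show ?thesis by (simp add: profile_space_def)
qed

lemma cell_measurable [measurable, simp]: "cell n j \<in> sets borel" "cell n j \<in> sets lebesgue"
  by (simp_all add: cell_def)

lemma cell_subset: "j < n \<Longrightarrow> cell n j \<subseteq> {0..1}"
  by (auto simp: cell_def field_simps)

lemma indicator_cell_measurable [measurable]: "(indicator (cell n j) :: real \<Rightarrow> real) \<in> borel_measurable unit_leb"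
  by (rule borel_measurable_integrable[OF integrable_unit_indicator]) simp

lemma integral_cell: "j < n \<Longrightarrow> (\<integral>x. indicator (cell n j) x \<partial>unit_leb) = 1 / real n"
  by (subst integral_unit_indicator)
     (simp_all add: Int_absorb2 cell_subset, simp add: cell_def divide_right_mono add_divide_distrib)

text \<open>Closed cells overlap only at the grid points, a finite set. Off it, the indicators
  reduce any sum over cells to a single term.\<close>

lemma AE_cell_partition:
  assumes "1 \<le> n"
  shows "AE x in unit_leb. \<exists>j<n. x \<in> {real j / n <..< (real j + 1) / n} \<and> (\<forall>i<n. indicator (cell n i) x = (if i = j then 1 else 0 :: real))"
proof (rule AE_unit_lebI[of "(\<lambda>j. real j / n) ` {..n}"])
  fix x :: real assume x: "x \<in> {0..1}" "x \<notin> (\<lambda>j. real j / n) ` {..n}"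
  define j where "j = nat \<lfloor>n * x\<rfloor>"
  have jx: "real j \<le> n * x" "n * x < real j + 1" using x by (auto simp: j_def)
  have "n * x \<le> real n * 1" using x by (intro mult_left_mono) auto
  then have "j \<le> n" using jx by linarith
  then have "x \<noteq> real j / n" "x \<noteq> real n / n" using x(2) by auto
  then have ne: "n * x \<noteq> real j" "x \<noteq> 1" using assms by (auto simp: field_simps)
  have nx: "n * x < n" using ne(2) x assms by simp
  have j: "j < n" using jx nx by linarith
  have "(x \<in> cell n i) = (i = j)" for i
  proof -
    have "x \<in> cell n i \<longleftrightarrow> real i \<le> n * x \<and> n * x \<le> real i + 1"
      using assms by (auto simp: cell_def field_simps)
    also have "\<dots> \<longleftrightarrow> i = j"
    proof
      assume i: "real i \<le> n * x \<and> n * x \<le> real i + 1"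
      have "i \<le> j" using i jx by linarith
      show "i = j"
      proof (rule ccontr)
        assume "i \<noteq> j"
        then have "real i + 1 \<le> real j" using \<open>i \<le> j\<close> by linarith
        then show False using i jx ne(1) by linarith
      qed
    qed (use jx in auto)
    finally show ?thesis .
  qed
  moreover have "x \<in> {real j / n <..< (real j + 1) / n}"
    using jx ne(1) assms by (auto simp: field_simps)
  ultimately show "\<exists>j<n. x \<in> {real j / n <..< (real j + 1) / n} \<and> (\<forall>i<n. indicator (cell n i) x = (if i = j then 1 else 0 :: real))"
    using j by (intro exI[of _ j]) (auto simp: indicator_def)
qed simp

lemma bounded_linear_coord: "bounded_linear (coord n j)"
  unfolding coord_def by (rule bounded_linear_pairing[where B = "real n"], measurable, simp add: indicator_def)

lemma measurable_coord [measurable]: "coord n j \<in> borel_measurable borel"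
  by (intro borel_measurable_continuous_onI linear_continuous_on bounded_linear_coord)

lemma coord_L1_of: "integrable unit_leb f \<Longrightarrow> coord n j (L1_of f) = real n * (\<integral>x. indicator (cell n j) x * f x \<partial>unit_leb)"
proof -
  assume f: "integrable unit_leb f"
  have "coord n j (L1_of f) = (\<integral>x. f x *\<^sub>R (real n * indicator (cell n j) x) \<partial>unit_leb)"
    unfolding coord_def by (rule pairing_L1_of[OF _ f]) measurable
  also have "\<dots> = (\<integral>x. real n * (indicator (cell n j) x * f x) \<partial>unit_leb)"
    by (intro Bochner_Integration.integral_cong) auto
  finally show ?thesis by (simp only: integral_mult_right_zero)
qed

lemma coord_eq: "coord n j F = real n * (\<integral>x. indicator (cell n j) x * L1_rep F x \<partial>unit_leb)"
  using coord_L1_of[OF integrable_L1_rep[of F]] by simp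

lemma coord_cell_L1:
  assumes "i < n" "j < n" shows "coord n j (cell_L1 n i) = (if i = j then 1 else 0)"
proof -
  have n: "1 \<le> n" using assms by simp
  have "coord n j (cell_L1 n i) = real n * (\<integral>x. indicator (cell n j) x * indicator (cell n i) x \<partial>unit_leb)"
    unfolding cell_L1_def by (rule coord_L1_of) simp
  also have "(\<integral>x. indicator (cell n j) x * indicator (cell n i) x \<partial>unit_leb) =
      (\<integral>x. (if i = j then 1 else 0) * indicator (cell n j) x \<partial>unit_leb :: real)"
  proof (rule integral_cong_AE)
    show "AE x in unit_leb. indicator (cell n j) x * indicator (cell n i) x = (if i = j then 1 else 0) * (indicator (cell n j) x :: real)"
      using AE_cell_partition[OF n]
    proof eventually_elim
      case (elim x)
      then obtain l where "\<forall>i<n. indicator (cell n i) x = (if i = l then 1 else 0 :: real)" by blast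
      then show ?case using assms by simp
    qed
  qed measurable
  also have "\<dots> = (if i = j then 1 else 0) * (1 / n)"
    unfolding integral_mult_right_zero using assms by (simp only: integral_cell)
  finally show ?thesis using n by auto
qed

lemma coord_sum:
  assumes "i < n" shows "coord n i (\<Sum>j<n. a j *\<^sub>R cell_L1 n j) = a i"
proof -
  interpret bounded_linear "coord n i" by (rule bounded_linear_coord)
  have "coord n i (\<Sum>j<n. a j *\<^sub>R cell_L1 n j) = (\<Sum>j<n. a j * (if j = i then 1 else 0))"
    using assms by (simp add: sum scaleR coord_cell_L1)
  also have "\<dots> = (\<Sum>j<n. if j = i then a j else 0)" by (intro sum.cong) auto
  finally show ?thesis using assms by simp
qed

lemma dual_basis_independent:
  assumes lin: "\<And>i. i < k \<Longrightarrow> linear (u i :: 'a::real_vector \<Rightarrow> real)"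
    and dual: "\<And>i j. i < k \<Longrightarrow> j < k \<Longrightarrow> u i (b j) = (if i = j then 1 else 0)"
  shows "inj_on b {..<k::nat}" and "independent (b ` {..<k})"
proof -
  show inj: "inj_on b {..<k}"
  proof (rule inj_onI)
    fix i j assume ij: "i \<in> {..<k}" "j \<in> {..<k}" "b i = b j"
    have "u i (b i) = u i (b j)" by (simp only: ij(3))
    then show "i = j" using ij dual[of i i] dual[of i j] by (simp split: if_splits)
  qed
  have "\<forall>v\<in>b ` {..<k}. a v = 0" if a: "(\<Sum>v\<in>b ` {..<k}. a v *\<^sub>R v) = 0" for a
  proof -
    have sum0: "(\<Sum>j<k. a (b j) *\<^sub>R b j) = 0" using a inj by (simp add: sum.reindex)
    have "a (b i) = 0" if i: "i < k" for i
    proof -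
      interpret linear "u i" by (rule lin[OF i])
      have "0 = u i (\<Sum>j<k. a (b j) *\<^sub>R b j)" by (simp only: sum0 zero)
      also have "\<dots> = (\<Sum>j<k. a (b j) * (if i = j then 1 else 0))"
        using i by (simp add: sum scale dual)
      also have "\<dots> = (\<Sum>j<k. if j = i then a (b j) else 0)" by (intro sum.cong) auto
      also have "\<dots> = a (b i)" using i by simp
      finally show ?thesis by simp
    qed
    then show ?thesis by auto
  qed
  then show "independent (b ` {..<k})" by (auto simp: dependent_finite)
qed

lemma inj_cell_L1: "inj_on (cell_L1 n) {..<n}"
  and independent_cell_L1: "independent (cell_L1 n ` {..<n})"
  by (rule dual_basis_independent[where u = "coord n"];
      simp add: bounded_linear.linear bounded_linear_coord coord_cell_L1)+

lemma profile_space_expand: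
  assumes "F \<in> profile_space n" shows "F = (\<Sum>j<n. coord n j F *\<^sub>R cell_L1 n j)"
proof -
  obtain a where a: "F = (\<Sum>j<n. a j *\<^sub>R cell_L1 n j)"
    using assms span_frameE[OF inj_cell_L1] unfolding profile_space_eq by blast
  have "coord n j F = a j" if "j < n" for j unfolding a by (rule coord_sum[OF that])
  then have "(\<Sum>j<n. coord n j F *\<^sub>R cell_L1 n j) = (\<Sum>j<n. a j *\<^sub>R cell_L1 n j)" by (intro sum.cong) auto
  then show ?thesis by (simp only: a[symmetric])
qed

lemma sum_in_profile_space: "(\<Sum>j<n. a j *\<^sub>R cell_L1 n j) \<in> profile_space n"
  unfolding profile_space_eq by (rule span_frameI)

text \<open>A dimension count. It lets a statement about all large \<open>n\<close> serve as an
  eventual statement along the net ordered by inclusion.\<close>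

lemma profile_space_mono_le:
  assumes "profile_space n \<subseteq> profile_space m" shows "n \<le> m"
proof -
  have "cell_L1 n ` {..<n} \<subseteq> span (cell_L1 m ` {..<m})"
    using assms span_superset[of "cell_L1 n ` {..<n}"] unfolding profile_space_eq by (rule order_trans[rotated])
  then have "card (cell_L1 n ` {..<n}) \<le> card (cell_L1 m ` {..<m})"
    using independent_span_bound[of "cell_L1 m ` {..<m}" "cell_L1 n ` {..<n}"] independent_cell_L1 by simp
  then show ?thesis by (simp add: card_image inj_cell_L1)
qed

section \<open>Cell averages, counting of cells and errors in L^1\<close>

lemma integral_cell_const:
  fixes h :: "real \<Rightarrow> 'b::{banach, second_countable_topology}"
  assumes [measurable]: "h \<in> borel_measurable unit_leb" and j: "j < n"
    and c: "\<And>x. x \<in> {real j / n <..< (real j + 1) / n} \<Longrightarrow> h x = c"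
  shows "(\<integral>x. indicator (cell n j) x *\<^sub>R h x \<partial>unit_leb) = (1 / n) *\<^sub>R c"
proof -
  have "(\<integral>x. indicator (cell n j) x *\<^sub>R h x \<partial>unit_leb) = (\<integral>x. indicator (cell n j) x *\<^sub>R c \<partial>unit_leb)"
  proof (rule integral_cong_AE)
    show "AE x in unit_leb. indicator (cell n j) x *\<^sub>R h x = indicator (cell n j) x *\<^sub>R c"
    proof (rule AE_unit_lebI[of "{real j / n, (real j + 1) / n}"])
      fix x assume "x \<notin> {real j / n, (real j + 1) / n}"
      then show "indicator (cell n j) x *\<^sub>R h x = indicator (cell n j) x *\<^sub>R c"
        using c[of x] by (auto simp: indicator_def cell_def)
    qed simp
  qed measurable
  also have "\<dots> = (\<integral>x. indicator (cell n j) x \<partial>unit_leb) *\<^sub>R c"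
    by (rule integral_scaleR_left) simp
  finally show ?thesis by (simp only: integral_cell[OF j])
qed

lemma cell_avg_const:
  fixes h :: "real \<Rightarrow> 'b::{banach, second_countable_topology}"
  assumes "h \<in> borel_measurable unit_leb" "j < n"
    and "\<And>x. x \<in> {real j / n <..< (real j + 1) / n} \<Longrightarrow> h x = c"
  shows "cell_avg n j h = c"
  unfolding cell_avg_def using integral_cell_const[OF assms] assms(2) by simp

lemma open_cell_subset: "j < n \<Longrightarrow> {real j / n <..< (real j + 1) / n} \<subseteq> {0..1}"
proof
  fix x assume "j < n" "x \<in> {real j / n <..< (real j + 1) / n}"
  then have "x \<in> cell n j" by (auto simp: cell_def)
  then show "x \<in> {0..1}" using cell_subset[OF \<open>j < n\<close>] by blast
qed

lemma norm_cell_avg_le: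
  fixes h :: "real \<Rightarrow> 'b::{banach, second_countable_topology}"
  assumes [measurable]: "h \<in> borel_measurable unit_leb" and B: "\<And>x. x \<in> {0..1} \<Longrightarrow> norm (h x) \<le> B" and j: "j < n"
  shows "norm (cell_avg n j h) \<le> B"
proof -
  have int: "integrable unit_leb (\<lambda>x. indicator (cell n j) x *\<^sub>R h x)"
    by (rule integrable_pairing[OF _ B]) simp_all
  have "norm (\<integral>x. indicator (cell n j) x *\<^sub>R h x \<partial>unit_leb) \<le> (\<integral>x. norm (indicator (cell n j) x *\<^sub>R h x) \<partial>unit_leb)"
    by (rule integral_norm_bound)
  also have "\<dots> \<le> (\<integral>x. B * indicator (cell n j) x \<partial>unit_leb)"
  proof (intro integral_mono integrable_norm integrable_mult_right int integrable_unit_indicator cell_measurable)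
    fix x assume "x \<in> space unit_leb"
    then show "norm (indicator (cell n j) x *\<^sub>R h x) \<le> B * indicator (cell n j) x"
      using B by (auto simp: indicator_def)
  qed
  also have "\<dots> = B * (1 / n)" using j by (simp only: integral_mult_right_zero integral_cell)
  finally show ?thesis using j by (simp add: cell_avg_def field_simps)
qed

lemma sum_cell_avg:
  fixes h :: "real \<Rightarrow> 'b::{banach, second_countable_topology}"
  assumes [measurable]: "h \<in> borel_measurable unit_leb" and B: "\<And>x. x \<in> {0..1} \<Longrightarrow> norm (h x) \<le> B" and n: "1 \<le> n"
  shows "(\<Sum>j<n. cell_avg n j h) = real n *\<^sub>R (\<integral>x. h x \<partial>unit_leb)"
proof -
  have int: "integrable unit_leb (\<lambda>x. indicator (cell n j) x *\<^sub>R h x)" for j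
    by (rule integrable_pairing[OF _ B]) simp_all
  have "(\<integral>x. h x \<partial>unit_leb) = (\<integral>x. (\<Sum>j<n. indicator (cell n j) x *\<^sub>R h x) \<partial>unit_leb)"
  proof (rule integral_cong_AE)
    show "AE x in unit_leb. h x = (\<Sum>j<n. indicator (cell n j) x *\<^sub>R h x)"
      using AE_cell_partition[OF n]
    proof eventually_elim
      case (elim x)
      then obtain l where l: "l < n" "\<And>i. i < n \<Longrightarrow> indicator (cell n i) x = (if i = l then 1 else 0 :: real)" by blast
      have "(\<Sum>j<n. indicator (cell n j) x *\<^sub>R h x) = (\<Sum>j<n. if j = l then h x else 0)"
        using l(2) by (intro sum.cong) auto
      then show ?case using l(1) by simp
    qed
  qed measurable
  also have "\<dots> = (\<Sum>j<n. (\<integral>x. indicator (cell n j) x *\<^sub>R h x \<partial>unit_leb))"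
    using int by (rule Bochner_Integration.integral_sum)
  finally show ?thesis by (simp add: cell_avg_def scaleR_sum_right)
qed

text \<open>The open cells are disjoint: a point \<open>x\<close> can lie only in the one with index
  \<lfloor>n * x\<rfloor>.\<close>

lemma card_cells_meeting:
  fixes N :: "real set"
  assumes "finite N" shows "card {j. j < n \<and> N \<inter> {real j / n <..< (real j + 1) / n} \<noteq> {}} \<le> card N"
proof -
  have "{j. j < n \<and> N \<inter> {real j / n <..< (real j + 1) / n} \<noteq> {}} \<subseteq> (\<lambda>x. nat \<lfloor>n * x\<rfloor>) ` N"
  proof
    fix j assume "j \<in> {j. j < n \<and> N \<inter> {real j / n <..< (real j + 1) / n} \<noteq> {}}"
    then obtain x where "j < n" "x \<in> N" and x: "x \<in> {real j / n <..< (real j + 1) / n}" by blast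
    then have "real j < n * x" "n * x < real j + 1" by (auto simp: field_simps)
    then have "\<lfloor>n * x\<rfloor> = int j" by linarith
    then show "j \<in> (\<lambda>x. nat \<lfloor>n * x\<rfloor>) ` N" using \<open>x \<in> N\<close> by (intro image_eqI[of _ _ x]) auto
  qed
  then have "card {j. j < n \<and> N \<inter> {real j / n <..< (real j + 1) / n} \<noteq> {}} \<le> card ((\<lambda>x. nat \<lfloor>n * x\<rfloor>) ` N)"
    using assms by (intro card_mono) auto
  also have "\<dots> \<le> card N" by (rule card_image_le[OF assms])
  finally show ?thesis .
qed

text \<open>The loss of 2 comes from rounding the two end points to the grid.\<close>

lemma card_cells_within:
  fixes a b :: real and n :: nat
  assumes ab: "a < b" "0 \<le> a" "b \<le> 1"
  shows "(b - a) * n - 2 \<le> card {j. j < n \<and> {real j / n <..< (real j + 1) / n} \<subseteq> {a<..<b}}"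
proof (cases "n = 0")
  case False
  have sub: "{nat \<lceil>a * n\<rceil>..<nat \<lfloor>b * n\<rfloor>} \<subseteq> {j. j < n \<and> {real j / n <..< (real j + 1) / n} \<subseteq> {a<..<b}}"
  proof
    fix j assume j: "j \<in> {nat \<lceil>a * n\<rceil>..<nat \<lfloor>b * n\<rfloor>}"
    then have 1: "a * n \<le> j" "real j + 1 \<le> b * n" by auto linarith+
    have "b * n \<le> 1 * real n" using ab by (intro mult_right_mono) auto
    then have "j < n" using 1 by linarith
    moreover have "a \<le> real j / n" "(real j + 1) / n \<le> b" using 1 False by (auto simp: field_simps)
    ultimately show "j \<in> {j. j < n \<and> {real j / n <..< (real j + 1) / n} \<subseteq> {a<..<b}}" by auto
  qed
  have "0 \<le> a * n" "0 \<le> b * n" using ab by auto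
  then have "(b - a) * n - 2 \<le> real (nat \<lfloor>b * n\<rfloor> - nat \<lceil>a * n\<rceil>)"
    by (simp add: left_diff_distrib) linarith
  also have "\<dots> \<le> card {j. j < n \<and> {real j / n <..< (real j + 1) / n} \<subseteq> {a<..<b}}"
    using card_mono[OF _ sub] by simp
  finally show ?thesis .
qed simp

lemma L1_of_cell_sum:
  "(\<Sum>j<n. a j *\<^sub>R cell_L1 n j) = L1_of (\<lambda>x. \<Sum>j<n. a j * indicator (cell n j) x)"
proof -
  have "(\<Sum>j<k. a j *\<^sub>R cell_L1 n j) = L1_of (\<lambda>x. \<Sum>j<k. a j * indicator (cell n j) x) \<and>
    integrable unit_leb (\<lambda>x. \<Sum>j<k. a j * indicator (cell n j) x)" for k
  proof (induction k)
    case 0 then show ?case by (simp add: L1_of_zero)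
  next
    case (Suc k)
    have int: "integrable unit_leb (\<lambda>x. a k * indicator (cell n k) x)" by simp
    then show ?case
      using Suc L1_of_add[OF conjunct2[OF Suc] int] L1_of_scaleR[of "indicator (cell n k)" "a k"]
      by (simp add: cell_L1_def)
  qed
  then show ?thesis by simp
qed

lemma norm_diff_cell_sum_le:
  assumes f: "integrable unit_leb f" and n: "1 \<le> n"
  shows "norm (L1_of f - (\<Sum>j<n. a j *\<^sub>R cell_L1 n j)) \<le> (\<Sum>j<n. \<integral>x. indicator (cell n j) x * \<bar>f x - a j\<bar> \<partial>unit_leb)"
proof -
  let ?g = "\<lambda>x. \<Sum>j<n. a j * indicator (cell n j) x"
  have g: "integrable unit_leb ?g" by (intro Bochner_Integration.integrable_sum integrable_mult_right integrable_unit_indicator) simp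
  have int: "integrable unit_leb (\<lambda>x. indicator (cell n j) x * \<bar>f x - a j\<bar>)" for j
  proof -
    have "integrable unit_leb (\<lambda>x. \<bar>f x - a j\<bar> *\<^sub>R (indicator (cell n j) x :: real))"
      by (rule integrable_pairing[where B = 1, OF indicator_cell_measurable]) (use f in \<open>auto simp: indicator_def\<close>)
    then show ?thesis by (simp add: mult.commute)
  qed
  have "norm (L1_of f - (\<Sum>j<n. a j *\<^sub>R cell_L1 n j)) = (\<integral>x. \<bar>f x - ?g x\<bar> \<partial>unit_leb)"
    unfolding L1_of_cell_sum using f g by (subst L1_of_diff[symmetric]) (auto simp: norm_L1_of)
  also have "\<dots> = (\<integral>x. (\<Sum>j<n. indicator (cell n j) x * \<bar>f x - a j\<bar>) \<partial>unit_leb)"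
  proof (rule integral_cong_AE)
    show "AE x in unit_leb. \<bar>f x - ?g x\<bar> = (\<Sum>j<n. indicator (cell n j) x * \<bar>f x - a j\<bar>)"
      using AE_cell_partition[OF n]
    proof eventually_elim
      case (elim x)
      then obtain l where l: "l < n" "\<And>i. i < n \<Longrightarrow> indicator (cell n i) x = (if i = l then 1 else 0 :: real)" by blast
      have "(\<Sum>j<n. indicator (cell n j) x * \<bar>f x - a j\<bar>) = (\<Sum>j<n. if j = l then \<bar>f x - a l\<bar> else 0)"
        using l(2) by (intro sum.cong) auto
      moreover have "?g x = (\<Sum>j<n. if j = l then a l else 0)"
        using l(2) by (intro sum.cong) auto
      ultimately show ?case using l(1) by simp
    qed
    show "(\<lambda>x. \<bar>f x - ?g x\<bar>) \<in> borel_measurable unit_leb"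
      using f g by (intro borel_measurable_integrable integrable_abs Bochner_Integration.integrable_diff)
    show "(\<lambda>x. \<Sum>j<n. indicator (cell n j) x * \<bar>f x - a j\<bar>) \<in> borel_measurable unit_leb"
      using int by (intro borel_measurable_integrable Bochner_Integration.integrable_sum)
  qed
  also have "\<dots> = (\<Sum>j<n. \<integral>x. indicator (cell n j) x * \<bar>f x - a j\<bar> \<partial>unit_leb)"
    using int by (rule Bochner_Integration.integral_sum)
  finally show ?thesis by simp
qed

lemma cell_sum_in_Q_infty:
  assumes n: "1 \<le> n"
  shows "(\<Sum>j<n. a j *\<^sub>R cell_L1 n j) \<in> Q_infty \<longleftrightarrow> (\<forall>j<n. a j \<in> {0..1})"
proof
  let ?F = "\<Sum>j<n. a j *\<^sub>R cell_L1 n j"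
  let ?g = "\<lambda>x. \<Sum>j<n. a j * indicator (cell n j) x"
  have g: "integrable unit_leb ?g" by (intro Bochner_Integration.integrable_sum integrable_mult_right integrable_unit_indicator) simp
  show "?F \<in> Q_infty" if a: "\<forall>j<n. a j \<in> {0..1}"
    unfolding Q_infty_def mem_Collect_eq L1_of_cell_sum
    using AE_cell_partition[OF n] L1_rep_of[OF g]
  proof eventually_elim
    case (elim x)
    then obtain l where l: "l < n" "\<And>i. i < n \<Longrightarrow> indicator (cell n i) x = (if i = l then 1 else 0 :: real)" by blast
    have "?g x = (\<Sum>j<n. if j = l then a l else 0)" using l(2) by (intro sum.cong) auto
    then have "?g x = a l" using l(1) by simp
    then show ?case using elim(2) a l(1) by simp
  qed
  show "\<forall>j<n. a j \<in> {0..1}" if F: "?F \<in> Q_infty"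
  proof (intro allI impI)
    fix j assume j: "j < n"
    have F': "AE x in unit_leb. 0 \<le> L1_rep ?F x \<and> L1_rep ?F x \<le> 1" using F by (simp add: Q_infty_def)
    have aj: "a j = real n * (\<integral>x. indicator (cell n j) x * L1_rep ?F x \<partial>unit_leb)"
      using coord_sum[OF j, of a] by (simp add: coord_eq)
    have "0 \<le> (\<integral>x. indicator (cell n j) x * L1_rep ?F x \<partial>unit_leb)"
      using F' by (intro integral_nonneg_AE) (auto elim!: eventually_mono)
    moreover have "(\<integral>x. indicator (cell n j) x * L1_rep ?F x \<partial>unit_leb) \<le> (\<integral>x. indicator (cell n j) x \<partial>unit_leb)"
    proof (rule integral_mono_AE)
      have "integrable unit_leb (\<lambda>x. L1_rep ?F x *\<^sub>R (indicator (cell n j) x :: real))"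
        by (rule integrable_pairing[where B = 1, OF indicator_cell_measurable]) (auto simp: indicator_def)
      then show "integrable unit_leb (\<lambda>x. indicator (cell n j) x * L1_rep ?F x)" by (simp add: mult.commute)
      show "AE x in unit_leb. indicator (cell n j) x * L1_rep ?F x \<le> indicator (cell n j) x"
        using F' by eventually_elim (auto simp: indicator_def)
    qed simp
    ultimately show "a j \<in> {0..1}" unfolding aj integral_cell[OF j] using j by (simp add: field_simps)
  qed
qed

text \<open>With cells of length 1/n, the constraint on the coefficients reads: their combination of
  the cell averages equals \<open>n *\<^sub>R y0\<close>.\<close>

lemma Lambda_cell_sum:
  fixes w :: "real \<Rightarrow> real ^ 'm"
  assumes w: "w \<in> borel_measurable unit_leb" and B: "\<And>x. x \<in> {0..1} \<Longrightarrow> norm (w x) \<le> B" and n: "1 \<le> n"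
  shows "Lambda w (\<Sum>j<n. a j *\<^sub>R cell_L1 n j) = (1 / n) *\<^sub>R (\<Sum>j<n. a j *\<^sub>R cell_avg n j w)"
proof -
  interpret bounded_linear "pairing w" by (rule bounded_linear_pairing[OF w B])
  have "pairing w (cell_L1 n j) = (1 / n) *\<^sub>R cell_avg n j w" for j
    unfolding cell_L1_def by (subst pairing_L1_of[OF w]) (use n in \<open>simp_all add: cell_avg_def\<close>)
  then show ?thesis
    by (simp add: Lambda_eq_pairing sum scaleR scaleR_sum_right mult.commute)
qed

section \<open>The fibre in a profile space\<close>

text \<open>
  On the cell \<open>J l\<close> the mean of \<open>w\<close> is the \<open>l\<close>-th unit vector, so the constraint determines the values on the
  cells \<open>J l\<close> from those on the \<open>k\<close> other cells, which \<open>e\<close> enumerates.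
\<close>

locale profile_frame =
  fixes w :: "real \<Rightarrow> real ^ 'm" and y0 :: "real ^ 'm" and C :: real and n k :: nat and J :: "'m \<Rightarrow> nat" and e :: "nat \<Rightarrow> nat"
  assumes w: "w \<in> borel_measurable unit_leb" and wC: "\<And>x. x \<in> {0..1} \<Longrightarrow> norm (w x) \<le> C"
    and n: "1 \<le> n" and J: "\<And>l. J l < n" and steer: "\<And>l. cell_avg n (J l) w = axis l 1"
    and e: "bij_betw e {..<k} ({..<n} - range J)"
begin

definition v :: "nat \<Rightarrow> real ^ 'm" where "v j = cell_avg n j w"

definition residual :: "(nat \<Rightarrow> real) \<Rightarrow> real ^ 'm" where
  "residual t = real n *\<^sub>R y0 - (\<Sum>i<k. t i *\<^sub>R v (e i))"

definition base_point :: L1 where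
  "base_point = (\<Sum>l\<in>UNIV. (real n *\<^sub>R y0) $ l *\<^sub>R cell_L1 n (J l))"

text \<open>Raising a free cell by 1 changes the moment by a multiple of \<open>v (e i)\<close>; the
  subtracted combination of the cells \<open>J l\<close>, with unit-vector averages, undoes exactly
  this.\<close>

definition direction :: "nat \<Rightarrow> L1" where
  "direction i = cell_L1 n (e i) - (\<Sum>l\<in>UNIV. v (e i) $ l *\<^sub>R cell_L1 n (J l))"

abbreviation chart :: "(nat \<Rightarrow> real) \<Rightarrow> L1" where
  "chart \<equiv> affine_chart k base_point direction"

definition height :: "(nat \<Rightarrow> real) \<Rightarrow> nat \<Rightarrow> real" where
  "height t j = (if j \<in> range J then residual t $ (inv J j) else t (inv_into {..<k} e j))"

lemma inj_J: "inj J"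
proof (rule injI)
  fix l l' assume "J l = J l'"
  then have "axis l (1::real) = axis l' 1" using steer[of l] steer[of l'] by simp
  then show "l = l'" by (simp add: axis_eq_axis)
qed

lemma e_less: "i < k \<Longrightarrow> e i < n" and e_free: "i < k \<Longrightarrow> e i \<notin> range J" and inj_e: "inj_on e {..<k}"
  using e by (auto simp: bij_betw_def)

lemma height_J: "height t (J l) = residual t $ l"
  by (simp add: height_def inj_J)

lemma height_e: "i < k \<Longrightarrow> height t (e i) = t i"
  using e_free[of i] inj_e by (simp add: height_def)

lemma sum_split: "(\<Sum>j<n. g j) = (\<Sum>i<k. g (e i)) + (\<Sum>l\<in>UNIV. g (J l))"
proof -
  have "(\<Sum>j<n. g j) = (\<Sum>j\<in>{..<n} - range J. g j) + (\<Sum>j\<in>range J. g j)"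
    using J by (intro sum.subset_diff) auto
  also have "(\<Sum>j\<in>{..<n} - range J. g j) = (\<Sum>i<k. g (e i))"
    using sum.reindex_bij_betw[OF e, of g] by simp
  also have "(\<Sum>j\<in>range J. g j) = (\<Sum>l\<in>UNIV. g (J l))"
    using inj_J by (simp add: sum.reindex)
  finally show ?thesis .
qed

lemma cell_cases:
  assumes "j < n" obtains i where "i < k" "j = e i" | l where "j = J l"
proof -
  have "j \<in> e ` {..<k} \<or> j \<in> range J" using assms e unfolding bij_betw_def by blast
  then show ?thesis using that by blast
qed

lemma chart_eq: "chart t = (\<Sum>j<n. height t j *\<^sub>R cell_L1 n j)"
proof -
  have "(\<Sum>j<n. height t j *\<^sub>R cell_L1 n j) = (\<Sum>i<k. t i *\<^sub>R cell_L1 n (e i)) + (\<Sum>l\<in>UNIV. residual t $ l *\<^sub>R cell_L1 n (J l))"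
    unfolding sum_split by (simp add: height_e height_J)
  moreover have "(\<Sum>l\<in>UNIV. residual t $ l *\<^sub>R cell_L1 n (J l)) =
      base_point - (\<Sum>i<k. t i *\<^sub>R (\<Sum>l\<in>UNIV. v (e i) $ l *\<^sub>R cell_L1 n (J l)))"
  proof -
    have "(\<Sum>i<k. t i *\<^sub>R (\<Sum>l\<in>UNIV. v (e i) $ l *\<^sub>R cell_L1 n (J l))) =
        (\<Sum>i<k. \<Sum>l\<in>UNIV. (t i * v (e i) $ l) *\<^sub>R cell_L1 n (J l))"
      by (simp add: scaleR_sum_right)
    also have "\<dots> = (\<Sum>l\<in>UNIV. (\<Sum>i<k. t i * v (e i) $ l) *\<^sub>R cell_L1 n (J l))"
      by (subst sum.swap) (simp add: scaleR_sum_left)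
    finally show ?thesis
      by (simp add: base_point_def residual_def scaleR_diff_left sum_subtractf)
  qed
  ultimately show ?thesis
    by (simp add: affine_chart_def direction_def scaleR_diff_right sum_subtractf)
qed

lemma coord_chart: "j < n \<Longrightarrow> coord n j (chart t) = height t j"
  unfolding chart_eq by (rule coord_sum)

lemma sum_axis: "(\<Sum>l\<in>UNIV. a l *\<^sub>R axis l (1::real)) = (\<chi> l. a l)"
  by (simp add: vec_eq_iff axis_def if_distrib cong: if_cong)

lemma Lambda_cells: "Lambda w (\<Sum>j<n. a j *\<^sub>R cell_L1 n j) =
    (1 / n) *\<^sub>R ((\<Sum>i<k. a (e i) *\<^sub>R v (e i)) + (\<chi> l. a (J l)))"
  using Lambda_cell_sum[OF w wC n, of a] unfolding sum_split
  by (simp add: v_def steer sum_axis)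

text \<open>The coordinates on the free cells are dual to the directions, which gives independence.
  Conversely, the constraint forces the coefficients on the cells \<open>J l\<close> to be the
  residual, so a point of the fibre is the chart value at its own free coordinates.\<close>

lemma affine_frame_fibre: "affine_frame (profile_space n \<inter> Lambda w -` {y0}) k base_point direction"
  unfolding affine_frame_def
proof (intro conjI)
  have coord_J: "coord n (e i) (cell_L1 n (J l)) = 0" if "i < k" for i l
  proof -
    have "J l \<noteq> e i" using e_free[OF that] rangeI[of J l] by (intro notI) simp
    then show ?thesis by (simp add: coord_cell_L1[OF J e_less[OF that]])
  qed
  have "coord n (e i) (direction j) = (if i = j then 1 else 0)" if "i < k" "j < k" for i j
  proof -
    interpret bounded_linear "coord n (e i)" by (rule bounded_linear_coord)
    have "coord n (e i) (cell_L1 n (e j)) = (if i = j then 1 else 0)"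
      using inj_onD[OF inj_e, of i j] that by (auto simp: coord_cell_L1[OF e_less e_less])
    then show ?thesis using that(1) by (simp add: direction_def diff sum scaleR coord_J)
  qed
  from dual_basis_independent[of k "\<lambda>i. coord n (e i)", OF bounded_linear.linear[OF bounded_linear_coord] this]
  show inj: "inj_on direction {..<k}" and "independent (direction ` {..<k})" by blast+
  show "profile_space n \<inter> Lambda w -` {y0} = (+) base_point ` span (direction ` {..<k})"
  proof (intro subset_antisym subsetI)
    fix x assume "x \<in> (+) base_point ` span (direction ` {..<k})"
    then obtain z where "z \<in> span (direction ` {..<k})" "x = base_point + z" by blast
    moreover obtain t where "z = (\<Sum>i<k. t i *\<^sub>R direction i)"
      using span_frameE[OF inj \<open>z \<in> _\<close>] .
    ultimately have x: "x = chart t" by (simp add: affine_chart_def)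
    have "Lambda w x = (1 / n) *\<^sub>R ((\<Sum>i<k. t i *\<^sub>R v (e i)) + (\<chi> l. residual t $ l))"
      unfolding x chart_eq Lambda_cells by (simp add: height_e height_J)
    also have "(\<chi> l. residual t $ l) = residual t" by (simp add: vec_eq_iff)
    also have "(1 / n) *\<^sub>R ((\<Sum>i<k. t i *\<^sub>R v (e i)) + residual t) = y0"
      using n by (simp add: residual_def)
    finally show "x \<in> profile_space n \<inter> Lambda w -` {y0}"
      using sum_in_profile_space x chart_eq by simp
  next
    fix x assume x: "x \<in> profile_space n \<inter> Lambda w -` {y0}"
    define c where "c j = coord n j x" for j
    have xc: "x = (\<Sum>j<n. c j *\<^sub>R cell_L1 n j)" using profile_space_expand[of x n] x by (simp add: c_def)
    have "(1 / n) *\<^sub>R ((\<Sum>i<k. c (e i) *\<^sub>R v (e i)) + (\<chi> l. c (J l))) = y0"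
      using x unfolding Lambda_cells[symmetric] xc[symmetric] by simp
    then have "real n *\<^sub>R y0 = real n *\<^sub>R ((1 / n) *\<^sub>R ((\<Sum>i<k. c (e i) *\<^sub>R v (e i)) + (\<chi> l. c (J l))))" by simp
    then have "real n *\<^sub>R y0 = (\<Sum>i<k. c (e i) *\<^sub>R v (e i)) + (\<chi> l. c (J l))" using n by simp
    then have res: "residual (\<lambda>i. c (e i)) = (\<chi> l. c (J l))" by (simp add: residual_def)
    have "height (\<lambda>i. c (e i)) j = c j" if "j < n" for j
      using that by (cases rule: cell_cases) (simp_all add: height_e height_J res)
    then have "x = chart (\<lambda>i. c (e i))" unfolding chart_eq by (subst xc) simp
    then show "x \<in> (+) base_point ` span (direction ` {..<k})"
      by (simp add: affine_chart_def span_frameI)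
  qed
qed

abbreviation params :: "(nat \<Rightarrow> real) set" where
  "params \<equiv> slice {..<k} (\<lambda>i. v (e i)) (real n *\<^sub>R y0)"

lemma chart_in_Q: "chart t \<in> Q_infty \<longleftrightarrow> (\<forall>i<k. t i \<in> {0..1}) \<and> (\<forall>l. residual t $ l \<in> {0..1})"
proof -
  have "(\<forall>j<n. height t j \<in> {0..1}) \<longleftrightarrow> (\<forall>i<k. height t (e i) \<in> {0..1}) \<and> (\<forall>l. height t (J l) \<in> {0..1})"
  proof (intro iffI conjI allI impI)
    fix j assume *: "(\<forall>i<k. height t (e i) \<in> {0..1}) \<and> (\<forall>l. height t (J l) \<in> {0..1})" "j < n"
    from \<open>j < n\<close> show "height t j \<in> {0..1}" by (cases rule: cell_cases) (use * in auto)
  qed (use e_less J in blast)+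
  then show ?thesis
    unfolding chart_eq cell_sum_in_Q_infty[OF n] by (simp add: height_e height_J)
qed

lemma measurable_Lambda [measurable]: "Lambda w \<in> borel_measurable borel"
  unfolding Lambda_eq_pairing
  by (intro borel_measurable_continuous_onI linear_continuous_on bounded_linear_pairing[OF w wC])

lemma fibre_in_Q_iff: "x \<in> profile_space n \<Longrightarrow> x \<in> Q_infty \<longleftrightarrow> (\<forall>j<n. coord n j x \<in> {0..1})"
  using cell_sum_in_Q_infty[OF n, of "\<lambda>j. coord n j x"] profile_space_expand[of x n] by simp

lemma sets_fibre: "profile_space n \<inter> (Lambda w -` {y0} \<inter> Q_infty) \<in> sets borel"
proof -
  \<comment> \<open>Describes the profile space as the fixed points of the coordinate projection, a
    Borel condition on the ambient space.\<close>
  have "x \<in> profile_space n \<longleftrightarrow> norm (x - (\<Sum>j<n. coord n j x *\<^sub>R cell_L1 n j)) = 0" for x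
    using profile_space_expand[of x n] sum_in_profile_space[of "\<lambda>j. coord n j x" n] by auto
  then have "profile_space n \<inter> (Lambda w -` {y0} \<inter> Q_infty) =
    {x \<in> space borel. norm (x - (\<Sum>j<n. coord n j x *\<^sub>R cell_L1 n j)) = 0 \<and> Lambda w x = y0 \<and> (\<forall>j\<in>{..<n}. coord n j x \<in> {0..1})}"
    using fibre_in_Q_iff by auto
  also have "\<dots> \<in> sets borel" by measurable
  finally show ?thesis .
qed

definition mean :: "nat \<Rightarrow> real" where
  "mean j = (\<integral>t. indicator params t * height t j \<partial>lebPi {..<k}) / measure (lebPi {..<k}) params"

lemma centroid_fibre:
  assumes pos: "0 < measure (lebPi {..<k}) params"
  shows "0 < measure (affine_lebesgue (profile_space n \<inter> Lambda w -` {y0})) (profile_space n \<inter> (Lambda w -` {y0} \<inter> Q_infty))"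
    and "centroid (profile_space n \<inter> Lambda w -` {y0}) (profile_space n \<inter> (Lambda w -` {y0} \<inter> Q_infty)) =
      (\<Sum>j<n. mean j *\<^sub>R cell_L1 n j)"
proof -
  let ?F = "profile_space n \<inter> Lambda w -` {y0}" and ?S = "profile_space n \<inter> (Lambda w -` {y0} \<inter> Q_infty)"
  have chart_F: "chart t \<in> ?F" for t
  proof -
    have "?F = (+) base_point ` span (direction ` {..<k})"
      using affine_frame_fibre by (simp add: affine_frame_def)
    then show ?thesis unfolding affine_chart_def by (simp only: imageI span_frameI)
  qed
  have ST: "chart t \<in> ?S \<longleftrightarrow> t \<in> params" if "t \<in> space (lebPi {..<k})" for t
    using chart_F[of t] chart_in_Q[of t] that
    by (auto simp: slice_def residual_def space_PiM PiE_iff)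
  have u: "coord n (e j) (chart t) = t j" if "j < k" for j t
    using that by (simp add: coord_chart e_less height_e)
  have S01: "coord n j x \<in> {0..1}" if "x \<in> ?S" "j \<in> {..<n}" for j x
    using that fibre_in_Q_iff by auto
  have expand: "x = (\<Sum>j<n. coord n j x *\<^sub>R cell_L1 n j)" if "x \<in> ?S" for x
    using that by (intro profile_space_expand) auto
  note * = centroid_chart[where u = "\<lambda>j. coord n (e j)" and A = "{..<n}" and U = "coord n" and e = "cell_L1 n",
      OF affine_frame_fibre measurable_coord u sets_fibre measurable_coord S01 expand sets_slice[OF finite_lessThan] ST pos]
  show "0 < measure (affine_lebesgue ?F) ?S" by (rule *(1))
  have "centroid ?F ?S = (\<Sum>j<n. ((\<integral>t. indicator params t * coord n j (chart t) \<partial>lebPi {..<k}) / measure (lebPi {..<k}) params) *\<^sub>R cell_L1 n j)"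
    by (rule *(2))
  then show "centroid ?F ?S = (\<Sum>j<n. mean j *\<^sub>R cell_L1 n j)"
    by (simp add: mean_def coord_chart)
qed

lemma mean_e: "i < k \<Longrightarrow> mean (e i) = (\<integral>t. indicator params t * t i \<partial>lebPi {..<k}) / measure (lebPi {..<k}) params"
  by (simp add: mean_def height_e)

lemma height_01:
  assumes "t \<in> params" "j < n" shows "height t j \<in> {0..1}"
  using assms(2)
proof (cases rule: cell_cases)
  case (1 i) then show ?thesis using assms(1) by (auto simp: height_e slice_def PiE_iff)
next
  case (2 l) then show ?thesis using assms(1) unfolding 2 height_J by (simp add: slice_def residual_def)
qed

lemma mean_01:
  assumes pos: "0 < measure (lebPi {..<k}) params" and j: "j < n"
  shows "mean j \<in> {0..1}"
proof -
  have fin: "emeasure (lebPi {..<k}) params < \<infinity>"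
    using pos by (metis enn2real_top infinity_ennreal_def less_irrefl measure_def top.not_eq_extremum)
  have int: "integrable (lebPi {..<k}) (indicator params :: _ \<Rightarrow> real)"
    using fin by (simp add: sets_slice)
  have "(\<integral>t. indicator params t * height t j \<partial>lebPi {..<k}) \<le> (\<integral>t. indicator params t \<partial>lebPi {..<k})"
    using height_01[OF _ j] by (intro integral_mono' int) (auto simp: indicator_def)
  also have "\<dots> = measure (lebPi {..<k}) params" by (simp add: slice_def space_PiM Int_absorb2 PiE_iff subset_eq)
  finally have "(\<integral>t. indicator params t * height t j \<partial>lebPi {..<k}) \<le> measure (lebPi {..<k}) params" .
  moreover have "0 \<le> (\<integral>t. indicator params t * height t j \<partial>lebPi {..<k})"
    using height_01[OF _ j] by (intro Bochner_Integration.integral_nonneg) (auto simp: indicator_def)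
  ultimately show ?thesis using pos by (simp add: mean_def)
qed

end

section \<open>Convergence of the centroids\<close>

text \<open>Every profile space above \<open>profile_space n1\<close> has index at least
  \<open>n1\<close>, so ordinary convergence in \<open>n\<close> yields convergence of the net.
  Cofinality holds because each index has arbitrarily large multiples.\<close>

lemma has_filtration_centroidI:
  assumes "\<And>\<epsilon>. 0 < \<epsilon> \<Longrightarrow> \<exists>n0. \<forall>n\<ge>n0. 0 < measure (affine_lebesgue (profile_space n \<inter> F)) (profile_space n \<inter> A) \<and>
    dist (centroid (profile_space n \<inter> F) (profile_space n \<inter> A)) c < \<epsilon>"
  shows "has_filtration_centroid profile_filtration F A c"
proof -
  define I where "I = {V \<in> profile_filtration. measure (affine_lebesgue (V \<inter> F)) (V \<inter> A) > 0}"
  have "\<exists>W\<in>I. V \<subseteq> W" if V: "V \<in> profile_filtration" for V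
  proof -
    obtain n where n: "1 \<le> n" "V = profile_space n" using V by (auto simp: profile_filtration_def)
    obtain n0 where n0: "\<forall>n\<ge>n0. 0 < measure (affine_lebesgue (profile_space n \<inter> F)) (profile_space n \<inter> A)"
      using assms[of 1] by auto
    \<comment> \<open>A multiple of \<open>n\<close> beyond \<open>n0\<close>; the maximum with 1
      keeps it positive when \<open>n0\<close> is 0.\<close>
    define k where "k = n * max n0 1"
    have "n0 \<le> k" unfolding k_def using n(1) mult_le_mono[of 1 n "n0" "max n0 1"] by simp
    moreover have "1 \<le> k" using n(1) by (simp add: k_def)
    ultimately have "profile_space k \<in> I" using n0 by (auto simp: I_def profile_filtration_def)
    moreover have "V \<subseteq> profile_space k"
      unfolding n(2) k_def by (rule profile_space_dvd[OF n(1)]) simp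
    ultimately show ?thesis by blast
  qed
  moreover have "((\<lambda>V. centroid (V \<inter> F) (V \<inter> A)) \<longlongrightarrow> c) (directed_filter I)"
  proof (rule tendstoI)
    fix \<epsilon> :: real assume "0 < \<epsilon>"
    then obtain n0 where n0: "\<forall>n\<ge>n0. 0 < measure (affine_lebesgue (profile_space n \<inter> F)) (profile_space n \<inter> A) \<and>
        dist (centroid (profile_space n \<inter> F) (profile_space n \<inter> A)) c < \<epsilon>"
      using assms by blast
    define n1 where "n1 = max n0 1"
    have V: "profile_space n1 \<in> I" using n0 by (auto simp: I_def profile_filtration_def n1_def)
    show "\<forall>\<^sub>F V in directed_filter I. dist (centroid (V \<inter> F) (V \<inter> A)) c < \<epsilon>"
      unfolding directed_filter_def
    proof (rule eventually_INF1[OF V], unfold eventually_principal, safe)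
      fix W assume W: "W \<in> I" "profile_space n1 \<subseteq> W"
      then obtain n where n: "W = profile_space n" by (auto simp: I_def profile_filtration_def)
      then have "n1 \<le> n" using W(2) profile_space_mono_le by simp
      then show "dist (centroid (W \<inter> F) (W \<inter> A)) c < \<epsilon>" using n0 by (simp add: n n1_def)
    qed
  qed
  ultimately show ?thesis
    unfolding has_filtration_centroid_def I_def[symmetric] Let_def
    using directed_filtration_profile by blast
qed

text \<open>The normal form reached by the change of basis. Each unit vector is the value of
  \<open>w\<close> on a whole interval, hence on a positive proportion of the cells up to a bounded
  loss; these supply the steering cells and the eliminated ones.\<close>

locale axis_step =
  fixes w :: "real \<Rightarrow> real ^ 'm" and C :: real and N :: "real set"
  assumes w[measurable]: "w \<in> borel_measurable unit_leb"
    and wC: "\<And>x. x \<in> {0..1} \<Longrightarrow> norm (w x) \<le> C" and C1: "1 \<le> C"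
    and N: "finite N"
    and const: "\<And>a b. {a<..<b} \<subseteq> {0..1} \<Longrightarrow> N \<inter> {a<..<b} = {} \<Longrightarrow> \<exists>c. \<forall>x\<in>{a<..<b}. w x = c"
    and axes: "\<And>l. \<exists>a b. 0 \<le> a \<and> a < b \<and> b \<le> 1 \<and> (\<forall>x\<in>{a<..<b}. w x = axis l 1)"
begin

definition bad :: "nat \<Rightarrow> nat set" where
  "bad n = {j. j < n \<and> N \<inter> {real j / n <..< (real j + 1) / n} \<noteq> {}}"

lemma finite_bad: "finite (bad n)" by (simp add: bad_def)

lemma card_bad: "card (bad n) \<le> card N"
  unfolding bad_def by (rule card_cells_meeting[OF N])

lemma good_cell:
  assumes "j < n" "j \<notin> bad n" "x \<in> {real j / n <..< (real j + 1) / n}"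
  shows "w x = cell_avg n j w"
proof -
  have "N \<inter> {real j / n <..< (real j + 1) / n} = {}" using assms(1,2) by (simp add: bad_def)
  from const[OF open_cell_subset[OF assms(1)] this]
  obtain c where c: "\<And>x. x \<in> {real j / n <..< (real j + 1) / n} \<Longrightarrow> w x = c" by blast
  show ?thesis using cell_avg_const[OF w assms(1) c] c[OF assms(3)] by simp
qed

lemma integrable_sigma: "integrable unit_leb (\<lambda>x. sigma_fn (\<tau> \<bullet> w x))"
  using sigma_fn_bounds by (intro unit_leb.integrable_const_bound[where B = 1]) (auto simp: abs_le_iff less_imp_le intro: order_trans[of _ 0])

lemma norm_sigma_le: "norm (u :: real ^ 'm) \<le> C \<Longrightarrow> norm (sigma_fn s *\<^sub>R u) \<le> C"
  using sigma_fn_bounds[of s] C1 mult_mono[of "\<bar>sigma_fn s\<bar>" 1 "norm u" C] by simp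

text \<open>By the saddlepoint equation the averages of the integrand over all cells sum to exactly
  \<open>n *\<^sub>R y0\<close>. On a cell without breakpoints the summand is such an average; each
  of the at most \<open>card N\<close> other cells costs at most \<open>2 * C\<close>.\<close>

lemma saddle_defect:
  assumes \<tau>: "(\<integral>x. sigma_fn (\<tau> \<bullet> w x) *\<^sub>R w x \<partial>unit_leb) = y0" and n: "1 \<le> n"
  shows "norm ((\<Sum>j<n. sigma_fn (\<tau> \<bullet> cell_avg n j w) *\<^sub>R cell_avg n j w) - real n *\<^sub>R y0) \<le> 2 * C * card N"
proof -
  define h where "h x = sigma_fn (\<tau> \<bullet> w x) *\<^sub>R w x" for x
  define g where "g j = sigma_fn (\<tau> \<bullet> cell_avg n j w) *\<^sub>R cell_avg n j w" for j
  have h: "h \<in> borel_measurable unit_leb" unfolding h_def by measurable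
  have hC: "norm (h x) \<le> C" if "x \<in> {0..1}" for x
    unfolding h_def by (rule norm_sigma_le[OF wC[OF that]])
  have gC: "norm (g j) \<le> C" if "j < n" for j
    unfolding g_def by (rule norm_sigma_le[OF norm_cell_avg_le[OF w wC that]])
  have good: "g j = cell_avg n j h" if "j < n" "j \<notin> bad n" for j
    unfolding g_def by (rule cell_avg_const[OF h that(1), symmetric]) (simp add: h_def good_cell[OF that])
  have "(\<integral>x. h x \<partial>unit_leb) = y0" using \<tau> by (simp add: h_def)
  then have "(\<Sum>j<n. g j) - real n *\<^sub>R y0 = (\<Sum>j<n. g j - cell_avg n j h)"
    using sum_cell_avg[OF h hC n] by (simp add: sum_subtractf)
  also have "norm \<dots> \<le> (\<Sum>j<n. if j \<in> bad n then 2 * C else 0)"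
  proof (rule sum_norm_le)
    fix j assume "j \<in> {..<n}"
    then have j: "j < n" by simp
    show "norm (g j - cell_avg n j h) \<le> (if j \<in> bad n then 2 * C else 0)"
      using good[OF j] gC[OF j] norm_cell_avg_le[OF h hC j] norm_triangle_ineq4[of "g j" "cell_avg n j h"] by auto
  qed
  also have "\<dots> = (\<Sum>j\<in>{j\<in>{..<n}. j \<in> bad n}. 2 * C)"
    by (rule sum.inter_filter[symmetric]) simp
  also have "{j\<in>{..<n}. j \<in> bad n} = bad n" by (auto simp: bad_def)
  also have "(\<Sum>j\<in>bad n. 2 * C) \<le> 2 * C * card N"
    using card_bad[of n] C1 by (simp add: mult.commute mult_right_mono)
  finally show ?thesis by (simp add: g_def)
qed

text \<open>On free cells without breakpoints the limit function is constant and the error is the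
  deviation itself. Cells with a breakpoint and the eliminated cells get the trivial bound 1/n
  each.\<close>

lemma centroid_error:
  assumes P: "profile_frame w C n k J e"
    and a: "\<And>j. j < n \<Longrightarrow> a j \<in> {0..1}"
  shows "norm ((\<Sum>j<n. a j *\<^sub>R cell_L1 n j) - L1_of (\<lambda>x. sigma_fn (\<tau> \<bullet> w x))) \<le>
    (1 / n) * ((\<Sum>i<k. \<bar>a (e i) - sigma_fn (\<tau> \<bullet> cell_avg n (e i) w)\<bar>) + card N + CARD('m))"
proof -
  \<comment> \<open>The value 0 is a placeholder for the moment; only the enumeration of the cells
    is drawn from the locale here.\<close>
  interpret P: profile_frame w 0 C n k J e by (rule P)
  let ?f = "\<lambda>x. sigma_fn (\<tau> \<bullet> w x)"
  define T where "T j = (\<integral>x. indicator (cell n j) x * \<bar>?f x - a j\<bar> \<partial>unit_leb)" for j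
  have f01: "0 \<le> ?f x" "?f x \<le> 1" for x using sigma_fn_bounds by (auto simp: less_imp_le)
  have T_le: "T j \<le> 1 / n" if j: "j < n" for j
  proof -
    have int: "integrable unit_leb (\<lambda>x. indicator (cell n j) x * \<bar>?f x - a j\<bar>)"
    proof -
      have "integrable unit_leb (\<lambda>x. \<bar>?f x - a j\<bar> *\<^sub>R (indicator (cell n j) x :: real))"
        by (rule integrable_pairing[where B = 1, OF indicator_cell_measurable]) (use integrable_sigma in \<open>auto simp: indicator_def\<close>)
      then show ?thesis by (simp add: mult.commute)
    qed
    have "T j \<le> (\<integral>x. indicator (cell n j) x \<partial>unit_leb)"
      unfolding T_def
    proof (rule integral_mono[OF int])
      fix x
      have "\<bar>?f x - a j\<bar> \<le> 1" using f01[of x] a[OF j] by (simp add: abs_le_iff)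
      then show "indicator (cell n j) x * \<bar>?f x - a j\<bar> \<le> indicator (cell n j) x" by (simp add: indicator_def)
    qed simp
    then show ?thesis by (simp only: integral_cell[OF j])
  qed
  have T_good: "T j = 1 / n * \<bar>a j - sigma_fn (\<tau> \<bullet> cell_avg n j w)\<bar>" if j: "j < n" "j \<notin> bad n" for j
  proof -
    have "(\<lambda>x. \<bar>?f x - a j\<bar>) \<in> borel_measurable unit_leb" by measurable
    from integral_cell_const[OF this j(1), of "\<bar>sigma_fn (\<tau> \<bullet> cell_avg n j w) - a j\<bar>"]
    show ?thesis unfolding T_def using good_cell[OF j] by (simp add: abs_minus_commute)
  qed
  define \<beta> where "\<beta> j = (if j \<in> bad n then 1 else \<bar>a j - sigma_fn (\<tau> \<bullet> cell_avg n j w)\<bar>)" for j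
  have "norm ((\<Sum>j<n. a j *\<^sub>R cell_L1 n j) - L1_of ?f) \<le> (\<Sum>j<n. T j)"
    unfolding T_def norm_minus_commute[of "\<Sum>j<n. a j *\<^sub>R cell_L1 n j"]
    by (rule norm_diff_cell_sum_le[OF integrable_sigma P.n])
  also have "\<dots> = (\<Sum>i<k. T (e i)) + (\<Sum>l\<in>UNIV. T (J l))" by (rule P.sum_split)
  also have "\<dots> \<le> (\<Sum>i<k. 1 / n * (\<bar>a (e i) - sigma_fn (\<tau> \<bullet> cell_avg n (e i) w)\<bar> + of_bool (e i \<in> bad n))) + (\<Sum>l\<in>(UNIV :: 'm set). 1 / n)"
  proof (intro add_mono sum_mono T_le P.J)
    fix i assume "i \<in> {..<k}"
    then have i: "e i < n" using P.e_less by simp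
    show "T (e i) \<le> 1 / n * (\<bar>a (e i) - sigma_fn (\<tau> \<bullet> cell_avg n (e i) w)\<bar> + of_bool (e i \<in> bad n))"
    proof (cases "e i \<in> bad n")
      case True
      have "T (e i) \<le> 1 / n * 1" using T_le[OF i] by simp
      also have "\<dots> \<le> 1 / n * (\<bar>a (e i) - sigma_fn (\<tau> \<bullet> cell_avg n (e i) w)\<bar> + of_bool (e i \<in> bad n))"
        using True by (intro mult_left_mono) auto
      finally show ?thesis .
    next
      case False then show ?thesis using T_good[OF i False] by simp
    qed
  qed
  also have "\<dots> = (1 / n) * ((\<Sum>i<k. \<bar>a (e i) - sigma_fn (\<tau> \<bullet> cell_avg n (e i) w)\<bar>) + (\<Sum>i<k. of_bool (e i \<in> bad n)) + CARD('m))"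
    by (simp add: sum_distrib_left[symmetric] sum.distrib distrib_left divide_inverse mult.commute)
  also have "\<dots> \<le> (1 / n) * ((\<Sum>i<k. \<bar>a (e i) - sigma_fn (\<tau> \<bullet> cell_avg n (e i) w)\<bar>) + card N + CARD('m))"
  proof (intro mult_left_mono add_mono order_refl)
    have "(\<Sum>i<k. of_bool (e i \<in> bad n) :: real) = (\<Sum>i<k. if e i \<in> bad n then 1 else 0)"
      by (intro sum.cong) auto
    also have "\<dots> = (\<Sum>i\<in>{i\<in>{..<k}. e i \<in> bad n}. 1)"
      by (rule sum.inter_filter[symmetric]) simp
    also have "\<dots> = card {i\<in>{..<k}. e i \<in> bad n}" by simp
    also have "card {i\<in>{..<k}. e i \<in> bad n} \<le> card (bad n)"
      using finite_bad by (intro card_inj_on_le[of e]) (auto intro: inj_on_subset[OF P.inj_e])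
    also have "\<dots> \<le> card N" by (rule card_bad)
    finally show "(\<Sum>i<k. of_bool (e i \<in> bad n) :: real) \<le> card N" by simp
  qed simp
  finally show ?thesis .
qed

lemma axis_cells:
  "\<exists>r>0. \<forall>n. r * real n - 2 \<le> card {j. j < n \<and> cell_avg n j w = axis l 1}"
proof -
  obtain a b where ab: "0 \<le> a" "a < b" "b \<le> 1" and wl: "\<forall>x\<in>{a<..<b}. w x = axis l 1"
    using axes by blast
  have "(b - a) * real n - 2 \<le> card {j. j < n \<and> cell_avg n j w = axis l 1}" for n
  proof -
    have "(b - a) * real n - 2 \<le> card {j. j < n \<and> {real j / n <..< (real j + 1) / n} \<subseteq> {a<..<b}}"
      using ab by (intro card_cells_within) auto
    also have "\<dots> \<le> card {j. j < n \<and> cell_avg n j w = axis l 1}"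
    proof (intro of_nat_mono card_mono subsetI)
      fix j assume j: "j \<in> {j. j < n \<and> {real j / n <..< (real j + 1) / n} \<subseteq> {a<..<b}}"
      then have "cell_avg n j w = axis l 1" using wl by (intro cell_avg_const[OF w]) auto
      then show "j \<in> {j. j < n \<and> cell_avg n j w = axis l 1}" using j by simp
    qed simp
    finally show ?thesis .
  qed
  then show ?thesis using ab by (intro exI[of _ "b - a"]) simp
qed

lemma centroid_limit:
  assumes \<tau>: "(\<integral>x. sigma_fn (\<tau> \<bullet> w x) *\<^sub>R w x \<partial>unit_leb) = y0" and \<epsilon>: "0 < \<epsilon>"
  shows "\<exists>n0. \<forall>n\<ge>n0.
    0 < measure (affine_lebesgue (profile_space n \<inter> Lambda w -` {y0})) (profile_space n \<inter> (Lambda w -` {y0} \<inter> Q_infty)) \<and>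
    dist (centroid (profile_space n \<inter> Lambda w -` {y0}) (profile_space n \<inter> (Lambda w -` {y0} \<inter> Q_infty)))
      (L1_of (\<lambda>x. sigma_fn (\<tau> \<bullet> w x))) < \<epsilon>"
proof -
  have "\<forall>l. \<exists>r>0. \<forall>n. r * real n - 2 \<le> card {j. j < n \<and> cell_avg n j w = axis l 1}"
    using axis_cells by blast
  then obtain r where r': "\<forall>l. 0 < r l \<and> (\<forall>n. r l * real n - 2 \<le> card {j. j < n \<and> cell_avg n j w = axis l 1})"
    by (rule choice[THEN exE])
  \<comment> \<open>Half of the guaranteed density of cells; the other half pays for the boundary
    loss 2 and for the eliminated cells.\<close>
  define \<rho> where "\<rho> = Min (range r) / 2"
  define m where "m = real CARD('m)"
  \<comment> \<open>The defect over all cells, plus at most \<open>C\<close> for each of the m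
    eliminated cells, which are absent from the sum over the free ones.\<close>
  define B where "B = 2 * C * card N + m * C"
  have \<rho>: "0 < \<rho>" unfolding \<rho>_def using r' by (simp add: Min_gr_iff)
  have cells: "2 * \<rho> * n - 2 \<le> card {j. j < n \<and> cell_avg n j w = axis l 1}" for n l
  proof -
    have "2 * \<rho> \<le> r l" by (simp add: \<rho>_def)
    then have "2 * \<rho> * n \<le> r l * n" by (intro mult_right_mono) auto
    then show ?thesis using r'[rule_format, of l] by (meson diff_right_mono order_trans)
  qed
  have B0: "0 \<le> B" using C1 by (simp add: B_def m_def)
  have \<epsilon>2: "0 < \<epsilon> / 2" using \<epsilon> by simp
  from slice_asymptotics[OF C1 B0 \<rho> \<epsilon>2, of \<tau>]
  obtain N0 where N0: "\<forall>n\<ge>N0. \<forall>(I :: nat set) v Y. finite I \<longrightarrow> card I \<le> n \<longrightarrow>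
      (\<forall>i\<in>I. \<forall>l. \<bar>v i $ l\<bar> \<le> C) \<longrightarrow> (\<forall>l. \<rho> * n \<le> card {i \<in> I. v i = axis l 1}) \<longrightarrow>
      (\<forall>l. \<bar>((\<Sum>i\<in>I. sigma_fn (\<tau> \<bullet> v i) *\<^sub>R v i) - Y) $ l\<bar> \<le> B) \<longrightarrow>
      0 < measure (lebPi I) (slice I v Y) \<and>
      (\<Sum>i\<in>I. \<bar>(\<integral>t. indicator (slice I v Y) t * t i \<partial>lebPi I) / measure (lebPi I) (slice I v Y)
        - sigma_fn (\<tau> \<bullet> v i)\<bar>) \<le> \<epsilon> / 2 * n"
    by (rule exE)
  \<comment> \<open>The third entry leaves at least \<open>\<rho> * n\<close> steering cells per
    direction after elimination; the last makes the contribution of bad and eliminated cells smaller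
    than \<epsilon>/2.\<close>
  define n0 where "n0 = Max {N0, 1, nat \<lceil>(2 + m) / \<rho>\<rceil>, Suc (nat \<lceil>2 * (card N + m) / \<epsilon>\<rceil>)}"
  show ?thesis
  proof (intro exI[of _ n0] allI impI)
    fix n assume "n0 \<le> n"
    then have n: "N0 \<le> n" "1 \<le> n" "(2 + m) / \<rho> \<le> n" "2 * (card N + m) / \<epsilon> < n"
      unfolding n0_def by auto linarith+
    have m0: "0 < m" by (simp add: m_def)
    have \<rho>n: "2 + m \<le> \<rho> * n" using n(3) \<rho> by (simp add: pos_divide_le_eq mult.commute)
    have "\<forall>l. \<exists>j. j < n \<and> cell_avg n j w = axis l 1"
    proof
      fix l
      have "0 < real (card {j. j < n \<and> cell_avg n j w = axis l 1})"
        using cells[of n l] \<rho>n m0 by linarith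
      then have "{j. j < n \<and> cell_avg n j w = axis l 1} \<noteq> {}" by (auto simp: card_gt_0_iff)
      then show "\<exists>j. j < n \<and> cell_avg n j w = axis l 1" by blast
    qed
    then obtain J where J: "\<forall>l. J l < n \<and> cell_avg n (J l) w = axis l 1"
      by (rule choice[THEN exE])
    define k where "k = card ({..<n} - range J)"
    obtain e where e: "bij_betw e {0..<k} ({..<n} - range J)"
      unfolding k_def using ex_bij_betw_nat_finite[of "{..<n} - range J"] by auto
    have PF: "profile_frame w C n k J e"
      using J e n(2) by unfold_locales (auto simp: w wC atLeast0LessThan)
    interpret P: profile_frame w y0 C n k J e by (rule PF)
    have kn: "k \<le> n" unfolding k_def using card_mono[of "{..<n}" "{..<n} - range J"] by simp
    have vC: "norm (cell_avg n j w) \<le> C" if "j < n" for j by (rule norm_cell_avg_le[OF w wC that])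
    have comp: "\<bar>P.v (e i) $ l\<bar> \<le> C" if "i < k" for i l
      using component_le_norm_cart[of "P.v (e i)" l] vC[OF P.e_less[OF that]] by (simp add: P.v_def)
    have free: "\<rho> * n \<le> card {i \<in> {..<k}. P.v (e i) = axis l 1}" for l
    proof -
      let ?A = "{i \<in> {..<k}. P.v (e i) = axis l 1}"
      have "{j. j < n \<and> cell_avg n j w = axis l 1} \<subseteq> e ` ?A \<union> range J"
      proof
        fix j assume j: "j \<in> {j. j < n \<and> cell_avg n j w = axis l 1}"
        then have "j < n" by simp
        then show "j \<in> e ` ?A \<union> range J"
          by (cases rule: P.cell_cases) (use j in \<open>auto simp: P.v_def\<close>)
      qed
      then have "card {j. j < n \<and> cell_avg n j w = axis l 1} \<le> card (e ` ?A \<union> range J)"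
        by (intro card_mono) auto
      also have "\<dots> \<le> card (e ` ?A) + card (range J)" by (rule card_Un_le)
      also have "\<dots> \<le> card ?A + CARD('m)" by (intro add_mono card_image_le) auto
      finally have "real (card {j. j < n \<and> cell_avg n j w = axis l 1}) \<le> card ?A + m"
        unfolding m_def by linarith
      then show ?thesis using cells[of n l] \<rho>n by linarith
    qed
    define g where "g j = sigma_fn (\<tau> \<bullet> cell_avg n j w) *\<^sub>R cell_avg n j w" for j
    have defect: "\<bar>((\<Sum>i<k. sigma_fn (\<tau> \<bullet> P.v (e i)) *\<^sub>R P.v (e i)) - real n *\<^sub>R y0) $ l\<bar> \<le> B" for l
    proof -
      have "(\<Sum>i<k. g (e i)) - real n *\<^sub>R y0 = ((\<Sum>j<n. g j) - real n *\<^sub>R y0) - (\<Sum>l\<in>UNIV. g (J l))"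
        unfolding P.sum_split by simp
      also have "norm \<dots> \<le> norm ((\<Sum>j<n. g j) - real n *\<^sub>R y0) + norm (\<Sum>l\<in>UNIV. g (J l))"
        by (rule norm_triangle_ineq4)
      also have "\<dots> \<le> 2 * C * card N + (\<Sum>l\<in>(UNIV::'m set). C)"
        using saddle_defect[OF \<tau> n(2)] J unfolding g_def
        by (intro add_mono sum_norm_le norm_sigma_le vC) auto
      also have "\<dots> = B" by (simp add: B_def m_def)
      finally have "norm ((\<Sum>i<k. g (e i)) - real n *\<^sub>R y0) \<le> B" .
      then show ?thesis
        using component_le_norm_cart[of "(\<Sum>i<k. g (e i)) - real n *\<^sub>R y0" l] by (simp add: g_def P.v_def)
    qed
    have main: "0 < measure (lebPi {..<k}) P.params \<and>
        (\<Sum>i<k. \<bar>(\<integral>t. indicator P.params t * t i \<partial>lebPi {..<k}) / measure (lebPi {..<k}) P.params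
          - sigma_fn (\<tau> \<bullet> P.v (e i))\<bar>) \<le> \<epsilon> / 2 * n"
      using N0[rule_format, OF n(1) finite_lessThan, of k "\<lambda>i. P.v (e i)" "real n *\<^sub>R y0"] kn comp free defect by simp
    then have pos: "0 < measure (lebPi {..<k}) P.params" by simp
    have sum_le: "(\<Sum>i<k. \<bar>P.mean (e i) - sigma_fn (\<tau> \<bullet> cell_avg n (e i) w)\<bar>) \<le> \<epsilon> / 2 * n"
      using main by (simp add: P.mean_e P.v_def)
    have "dist (\<Sum>j<n. P.mean j *\<^sub>R cell_L1 n j) (L1_of (\<lambda>x. sigma_fn (\<tau> \<bullet> w x)))
        \<le> (1 / n) * ((\<Sum>i<k. \<bar>P.mean (e i) - sigma_fn (\<tau> \<bullet> cell_avg n (e i) w)\<bar>) + card N + CARD('m))"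
      unfolding dist_norm by (rule centroid_error[OF PF P.mean_01[OF pos]])
    also have "\<dots> \<le> (1 / n) * (\<epsilon> / 2 * n + card N + m)"
      using sum_le by (intro mult_left_mono) (auto simp: m_def)
    also have "\<dots> < (1 / n) * (\<epsilon> / 2 * n + \<epsilon> / 2 * n)"
      using n(2,4) \<epsilon> by (intro mult_strict_left_mono) (auto simp: field_simps)
    also have "\<dots> = \<epsilon>" using n(2) by (simp add: field_simps)
    finally show "0 < measure (affine_lebesgue (profile_space n \<inter> Lambda w -` {y0})) (profile_space n \<inter> (Lambda w -` {y0} \<inter> Q_infty)) \<and>
      dist (centroid (profile_space n \<inter> Lambda w -` {y0}) (profile_space n \<inter> (Lambda w -` {y0} \<inter> Q_infty)))
        (L1_of (\<lambda>x. sigma_fn (\<tau> \<bullet> w x))) < \<epsilon>"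
      using P.centroid_fibre[OF pos] by simp
  qed
qed

end

text \<open>Otherwise some nonzero vector is orthogonal to all values taken on intervals. Every
  point other than a breakpoint, 0 or 1 has a neighbourhood inside the unit interval on which
  \<open>w\<close> is constant, so the vector is orthogonal to \<open>w\<close> almost
  everywhere.\<close>

lemma (in moment_problem) interval_values_span:
  assumes N: "finite N"
    and const: "\<And>a b. {a<..<b} \<subseteq> {0..1} \<Longrightarrow> N \<inter> {a<..<b} = {} \<Longrightarrow> \<exists>c. \<forall>x\<in>{a<..<b}. w x = c"
  shows "span {u. \<exists>a b. 0 \<le> a \<and> a < b \<and> b \<le> 1 \<and> (\<forall>x\<in>{a<..<b}. w x = u)} = UNIV"
proof (rule ccontr)
  let ?U = "{u. \<exists>a b. 0 \<le> a \<and> a < b \<and> b \<le> 1 \<and> (\<forall>x\<in>{a<..<b}. w x = u)}"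
  assume "span ?U \<noteq> UNIV"
  then obtain a where a: "a \<noteq> 0" "\<forall>x\<in>span ?U. a \<bullet> x = 0"
    using span_not_UNIV_orthogonal[of ?U] by blast
  have "AE x in unit_leb. a \<bullet> w x = 0"
  proof (rule AE_unit_lebI[of "N \<union> {0, 1}"])
    show "finite (N \<union> {0, 1})" using N by simp
    fix x :: real assume x: "x \<in> {0..1}" "x \<notin> N \<union> {0, 1}"
    have "open ({0<..<1} - N)" using N by (intro open_Diff finite_imp_closed) auto
    moreover have "x \<in> {0<..<1} - N" using x by auto
    ultimately obtain r where r: "0 < r" "ball x r \<subseteq> {0<..<1} - N"
      by (rule openE)
    then have sub: "{x - r<..<x + r} \<subseteq> {0<..<1} - N" by (simp add: ball_eq_greaterThanLessThan)
    then have sub01: "{x - r<..<x + r} \<subseteq> {0..1}" "N \<inter> {x - r<..<x + r} = {}" by auto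
    obtain c where c: "\<forall>y\<in>{x - r<..<x + r}. w y = c" using const[OF sub01] by blast
    have "y \<in> {0<..<1}" if "y \<in> {x - r<..<x + r}" for y using that sub by blast
    from this[of 0] this[of 1] have "\<not> x < r" "\<not> 1 < x + r" using x r(1) by auto
    then have "0 \<le> x - r" "x + r \<le> 1" by simp_all
    then have "c \<in> ?U" unfolding mem_Collect_eq using c r(1)
      by (intro exI[of _ "x - r"] exI[of _ "x + r"] conjI) auto
    then have "a \<bullet> c = 0" by (intro a(2)[rule_format] span_base)
    then show "a \<bullet> w x = 0" using c r(1) by simp
  qed
  then show False using inner_w_AE_zero a(1) by blast
qed

text \<open>A basis can be selected from \<open>U\<close> itself; \<open>M\<close> sends the unit
  vectors to it and \<open>L\<close> is the inverse.\<close>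

lemma basis_change:
  fixes U :: "(real ^ 'm) set"
  assumes "span U = UNIV"
  shows "\<exists>(L :: real ^ 'm \<Rightarrow> real ^ 'm) M. linear L \<and> linear M \<and> (\<forall>x. L (M x) = x) \<and> (\<forall>x. M (L x) = x) \<and> (\<forall>l. M (axis l 1) \<in> U)"
proof -
  obtain B where B: "B \<subseteq> U" "independent B" "U \<subseteq> span B"
    using maximal_independent_subset by blast
  have spanB: "span B = UNIV"
    using assms span_mono[OF B(3)] by (simp add: span_span top.extremum_unique)
  have finB: "finite B" using B(2) independent_bound by blast
  have "card B = dim (UNIV :: (real ^ 'm) set)"
    using basis_card_eq_dim[of B UNIV] B(2) spanB by auto
  then have "card B = CARD('m)" by (simp add: DIM_cart)
  then obtain \<beta> where \<beta>: "bij_betw \<beta> (UNIV :: 'm set) B"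
    using finite_same_card_bij[of "UNIV :: 'm set" B] finB by auto
  have inj: "inj \<beta>" and \<beta>B: "\<beta> l \<in> B" and surj: "\<And>b. b \<in> B \<Longrightarrow> \<exists>l. b = \<beta> l" for l
    using \<beta> unfolding bij_betw_def by (auto)
  obtain L where L: "linear L" "\<forall>b\<in>B. L b = axis (inv \<beta> b) (1::real)"
    using linear_independent_extend[OF B(2), of "\<lambda>b. axis (inv \<beta> b) 1"] by blast
  define M where "M x = (\<Sum>l\<in>UNIV. x $ l *\<^sub>R \<beta> l)" for x :: "real ^ 'm"
  have M: "linear M"
    by (rule linearI) (simp_all add: M_def scaleR_add_left sum.distrib scaleR_sum_right)
  have L\<beta>: "L (\<beta> l) = axis l 1" for l using L(2) \<beta>B[of l] inj by simp
  have LM: "L (M x) = x" for x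
  proof -
    have "L (M x) = (\<Sum>l\<in>UNIV. x $ l *\<^sub>R axis l 1)"
      by (simp add: M_def linear_sum[OF L(1)] linear_scale[OF L(1)] L\<beta>)
    also have "\<dots> = x" by (simp add: vec_eq_iff axis_def if_distrib cong: if_cong)
    finally show ?thesis .
  qed
  have M_axis: "M (axis l 1) = \<beta> l" for l
    by (simp add: M_def axis_def if_distrib if_distribR cong: if_cong)
  have inv_L: "M (L x) = x" for x
  proof -
    have "linear (\<lambda>x. M (L x))" using linear_compose[OF L(1) M] by (simp add: comp_def)
    moreover have "M (L b) = b" if b: "b \<in> B" for b
    proof -
      obtain l where "b = \<beta> l" using surj[OF b] by blast
      then show ?thesis by (simp add: L\<beta> M_axis)
    qed
    ultimately show ?thesis
      using linear_eq_on_span[of "\<lambda>x. M (L x)" "\<lambda>x. x" B x] spanB linear_id by (simp add: id_def)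
  qed
  have "M (axis l 1) \<in> U" for l using M_axis \<beta>B B(1) by auto
  then show ?thesis using L(1) M LM inv_L by - (rule exI[of _ L], rule exI[of _ M], simp)
qed

theorem mainTheorem1:
  fixes w :: "real \<Rightarrow> real ^ 'm" and y0 :: "real ^ 'm"
  assumes "step_function w"
    and "inj (\<lambda>i. L1_of (\<lambda>x. w x $ i))"
    and "independent (range (\<lambda>i. L1_of (\<lambda>x. w x $ i)))"
    and "y0 \<in> interior (Lambda w ` Q_infty)"
  shows "linear (Lambda w) \<and> surj (Lambda w) \<and>
    (\<exists>\<tau>0. {\<tau>. (\<integral>x. sigma_fn (\<tau> \<bullet> w x) *\<^sub>R w x \<partial>unit_leb) = y0} = {\<tau>0} \<and>
      has_filtration_centroid profile_filtration
        (Lambda w -` {y0}) (Lambda w -` {y0} \<inter> Q_infty)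
        (L1_of (\<lambda>x. sigma_fn (\<tau>0 \<bullet> w x))))"
proof -
  obtain C where C: "1 \<le> C" "\<And>x. x \<in> {0..1} \<Longrightarrow> norm (w x) \<le> C"
    using step_function_bounded[OF assms(1)] by blast
  have w: "w \<in> borel_measurable unit_leb" by (rule step_function_measurable[OF assms(1)])
  obtain N where N: "finite N"
    "\<And>a b. {a<..<b} \<subseteq> {0..1} \<Longrightarrow> N \<inter> {a<..<b} = {} \<Longrightarrow> \<exists>c. \<forall>x\<in>{a<..<b}. w x = c"
    using step_function_breakpoints[OF assms(1)] by blast
  obtain \<delta> where \<delta>: "0 < \<delta>" "cball y0 \<delta> \<subseteq> Lambda w ` Q_infty"
    using assms(4) mem_interior_cball by blast
  have lin: "linear (Lambda w)"
    unfolding Lambda_eq_pairing by (rule bounded_linear.linear[OF bounded_linear_pairing[OF w C(2)]])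
  have surj: "y \<in> range (Lambda w)" for y
  proof -
    \<comment> \<open>Contracting towards \<open>y0\<close> by the factor \<open>c\<close> brings
      \<open>y\<close> into the ball of attained moments; linearity then extrapolates from preimages
      of \<open>y0\<close> and of the contracted point.\<close>
    define c where "c = norm (y - y0) / \<delta> + 1"
    have c: "0 < c" using \<delta>(1) by (simp add: c_def add_nonneg_pos)
    have "norm (y - y0) \<le> c * \<delta>" using \<delta>(1) by (simp add: c_def distrib_right)
    then have "y0 + (1 / c) *\<^sub>R (y - y0) \<in> cball y0 \<delta>" using c by (simp add: dist_norm pos_divide_le_eq mult.commute)
    with \<delta>(2) have "y0 + (1 / c) *\<^sub>R (y - y0) \<in> Lambda w ` Q_infty" by (rule subsetD)
    then obtain G where G: "Lambda w G = y0 + (1 / c) *\<^sub>R (y - y0)" by force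
    have "y0 \<in> cball y0 \<delta>" using \<delta>(1) by simp
    with \<delta>(2) have "y0 \<in> Lambda w ` Q_infty" by (rule subsetD)
    then obtain F where F: "Lambda w F = y0" by force
    have "Lambda w (F + c *\<^sub>R (G - F)) = y"
      using c by (simp add: linear_add[OF lin] linear_scale[OF lin] linear_diff[OF lin] F G)
    then show ?thesis by (rule range_eqI[OF sym])
  qed
  interpret moment_problem w y0 C \<delta>
  proof
    fix y assume "y \<in> cball y0 \<delta>"
    then obtain F where F: "F \<in> Q_infty" "Lambda w F = y" using \<delta>(2) by auto
    then show "\<exists>f. integrable unit_leb f \<and> (AE x in unit_leb. 0 \<le> f x \<and> f x \<le> 1) \<and> (\<integral>x. f x *\<^sub>R w x \<partial>unit_leb) = y"
      by (intro exI[of _ "L1_rep F"]) (auto simp: Q_infty_def Lambda_def)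
  qed (use w C \<delta>(1) in auto)
  obtain \<tau>0 where \<tau>0: "(\<integral>x. sigma_fn (\<tau>0 \<bullet> w x) *\<^sub>R w x \<partial>unit_leb) = y0"
    using saddlepoint_exists by blast
  have "span {u. \<exists>a b. 0 \<le> a \<and> a < b \<and> b \<le> 1 \<and> (\<forall>x\<in>{a<..<b}. w x = u)} = UNIV"
    by (rule interval_values_span[OF N])
  from basis_change[OF this]
  obtain L M :: "real ^ 'm \<Rightarrow> real ^ 'm" where "linear L \<and> linear M \<and> (\<forall>x. L (M x) = x) \<and> (\<forall>x. M (L x) = x) \<and>
    (\<forall>l. M (axis l 1) \<in> {u. \<exists>a b. 0 \<le> a \<and> a < b \<and> b \<le> 1 \<and> (\<forall>x\<in>{a<..<b}. w x = u)})"
    by (elim exE)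
  then have LM: "linear L" "linear M" "\<And>x. L (M x) = x" "\<And>x. M (L x) = x"
    and axes: "\<And>l. M (axis l 1) \<in> {u. \<exists>a b. 0 \<le> a \<and> a < b \<and> b \<le> 1 \<and> (\<forall>x\<in>{a<..<b}. w x = u)}"
    by simp_all
  have blL: "bounded_linear L" by (rule linear_conv_bounded_linear[THEN iffD1, OF LM(1)])
  then obtain K where K: "0 < K" "\<And>x. norm (L x) \<le> norm x * K" using bounded_linear.pos_bounded[OF blL] by blast
  \<comment> \<open>In the new coordinates the chosen basis values of \<open>w\<close> become unit
    vectors.\<close>
  define w' where "w' x = L (w x)" for x
  have w': "w' \<in> borel_measurable unit_leb"
    unfolding w'_def
    by (rule measurable_compose[OF w]) (intro borel_measurable_continuous_onI linear_continuous_on blL)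
  have wM: "w x = M (w' x)" for x by (simp add: w'_def LM)
  have w'C: "norm (w' x) \<le> max 1 (C * K)" if "x \<in> {0..1}" for x
  proof -
    have "norm (w' x) \<le> C * K"
      unfolding w'_def using K(2)[of "w x"] mult_right_mono[OF C(2)[OF that], of K] K(1) by linarith
    then show ?thesis by simp
  qed
  interpret axis: axis_step w' "max 1 (C * K)" N
  proof
    fix a b :: real assume "{a<..<b} \<subseteq> {0..1}" "N \<inter> {a<..<b} = {}"
    then obtain c where "\<forall>x\<in>{a<..<b}. w x = c" using N(2) by blast
    then show "\<exists>c. \<forall>x\<in>{a<..<b}. w' x = c" by (auto simp: w'_def)
  next
    fix l
    obtain a b where "0 \<le> a" "a < b" "b \<le> 1" "\<forall>x\<in>{a<..<b}. w x = M (axis l 1)" using axes[of l] by blast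
    then show "\<exists>a b. 0 \<le> a \<and> a < b \<and> b \<le> 1 \<and> (\<forall>x\<in>{a<..<b}. w' x = axis l 1)"
      by (intro exI[of _ a] exI[of _ b]) (simp add: w'_def LM(3))
  qed (use w' w'C N(1) in auto)
  \<comment> \<open>The adjoint moves the parameter so that the exponents agree pointwise; the limit
    function is thus the same in both coordinate systems.\<close>
  define \<tau>' where "\<tau>' = adjoint M \<tau>0"
  have \<tau>': "\<tau>' \<bullet> w' x = \<tau>0 \<bullet> w x" for x
    using adjoint_works[OF LM(2), of "w' x" \<tau>0] by (simp add: \<tau>'_def wM inner_commute)
  have "(\<integral>x. sigma_fn (\<tau>' \<bullet> w' x) *\<^sub>R w' x \<partial>unit_leb) = (\<integral>x. L (sigma_fn (\<tau>0 \<bullet> w x) *\<^sub>R w x) \<partial>unit_leb)"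
    unfolding \<tau>' by (simp add: w'_def linear_scale[OF LM(1)])
  also have "\<dots> = L y0"
    unfolding integral_bounded_linear[OF blL integrable_sigma_w] \<tau>0 ..
  finally have saddle': "(\<integral>x. sigma_fn (\<tau>' \<bullet> w' x) *\<^sub>R w' x \<partial>unit_leb) = L y0" .
  have Lam: "Lambda w' F = L (Lambda w F)" for F
  proof -
    have "Lambda w' F = (\<integral>x. L (L1_rep F x *\<^sub>R w x) \<partial>unit_leb)"
      by (simp add: Lambda_def w'_def linear_scale[OF LM(1)])
    also have "\<dots> = L (Lambda w F)"
      unfolding Lambda_def
      by (rule integral_bounded_linear[OF blL]) (rule integrable_pairing[OF w C(2) integrable_L1_rep])
    finally show ?thesis .
  qed
  have "L y = L y0 \<longleftrightarrow> y = y0" for y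
  proof
    assume "L y = L y0"
    then have "M (L y) = M (L y0)" by (rule arg_cong)
    then show "y = y0" by (simp only: LM(4))
  qed simp
  \<comment> \<open>As \<open>L\<close> is injective, both moment operators have the same fibre as a
    subset of L^1, so the centroids in question are literally the same.\<close>
  then have fibre: "Lambda w' -` {L y0} = Lambda w -` {y0}"
    unfolding vimage_def Lam by simp
  have "has_filtration_centroid profile_filtration (Lambda w -` {y0}) (Lambda w -` {y0} \<inter> Q_infty)
      (L1_of (\<lambda>x. sigma_fn (\<tau>0 \<bullet> w x)))"
    by (rule has_filtration_centroidI) (rule axis.centroid_limit[OF saddle', unfolded fibre \<tau>'])
  moreover have "{\<tau>. (\<integral>x. sigma_fn (\<tau> \<bullet> w x) *\<^sub>R w x \<partial>unit_leb) = y0} = {\<tau>0}"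
  proof (intro subset_antisym subsetI)
    fix \<tau> assume "\<tau> \<in> {\<tau>. (\<integral>x. sigma_fn (\<tau> \<bullet> w x) *\<^sub>R w x \<partial>unit_leb) = y0}"
    then show "\<tau> \<in> {\<tau>0}" using saddlepoint_unique[OF _ \<tau>0, of \<tau>] by simp
  qed (use \<tau>0 in simp)
  moreover have "surj (Lambda w)" using surj by (auto simp: set_eq_iff)
  ultimately show ?thesis using lin by - (intro conjI exI[of _ \<tau>0]; assumption)
qed

end
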